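(* Let $n\ge1$, $m\ge0$, $d=n+m$, let $H\in\mathbb{Z}^{d\times n}$ be a matrix of rank $n$ in reduced Hermite normal form, let $c\in\mathbb{Z}^n$, $b\in\mathbb{Z}^d$, and let $\Delta=\Delta(H)$. If all $n\times n$ submatrices of $H$ are non-singular and $n>\Delta(2\Delta+1)^2+\log_2\Delta$, then the integer linear programming problem $$\max\{c^\top x : x\in P(H,b)\cap\mathbb{Z}^n\}$$ can be solved by an algorithm with complexity $$O\bigl(\log\Delta\cdot n^4\cdot\Delta^4\cdot\mathrm{mult}(\mathrm{size}(c)+\log\Delta)\bigr).$$
   Context: $P(H,b)=\{x\in\mathbb{R}^n : Hx\le b\}$. For an integer matrix $A$, $\Delta_k(A)$ is the greatest absolute value of the determinants of all $k\times k$ submatrices of $A$, and $\Delta(A)=\Delta_{\mathrm{rank}(A)}(A)$. Reduced Hermite normal form: write $H_B$ for the $n\times n$ matrix of the first $n$ rows of $H$ and $H_N$ for the $m\times n$ matrix of its remaining rows. $H$ is in reduced Hermite normal form if $H_B$ is non-singular and lower triangular, $0\le H_{ij}<H_{ii}$ for all $1\le j<i\le n$, and there is $s\in\{0,\dots,n\}$ with $H_{ii}=1$ for $i\le s$ and $H_{ii}\ge 2$ for $s<i\le n$ (so the first $s$ rows of $H_B$ are those of the identity matrix). For an integer $x$, $\mathrm{size}(x)=1+\lceil\log_2(|x|+1)\rceil$; for an integer vector $v\in\mathbb{Z}^n$, $\mathrm{size}(v)=n+\sum_{i=1}^n\mathrm{size}(v_i)$. $\mathrm{mult}(k)$ is the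 bit complexity of multiplying two integers of bit size $k$.
   Formalization: The factor log Δ is read as max(1, log₂ Δ), since the literal bound is 0 for Δ = 1; the bound without size(b) counts operations on b and numbers linearly derived from it as elementary, and the full bit cost is bounded with size(b) added inside mult. *)

theory Defs
  imports
    Complex_Main
    "Jordan_Normal_Form.Determinant"
    "Jordan_Normal_Form.DL_Rank"
    "Jordan_Normal_Form.DL_Submatrix"
begin

section \<open>Matrices, minors and the reduced Hermite normal form\<close>

definition square_submatrices :: "nat \<Rightarrow> int mat \<Rightarrow> int mat set" where
  "square_submatrices k A =
     {submatrix A I J | I J. I \<subseteq> {..<dim_row A} \<and> J \<subseteq> {..<dim_col A} \<and> card I = k \<and> card J = k}"

definition Delta_k :: "nat \<Rightarrow> int mat \<Rightarrow> int" where
  "Delta_k k A = Max ((\<lambda>S. \<bar>det S\<bar>) ` square_submatrices k A)"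

definition rank_int :: "int mat \<Rightarrow> nat" where
  "rank_int A = vec_space.rank (dim_row A) (map_mat real_of_int A)"

definition Delta :: "int mat \<Rightarrow> int" where
  "Delta A = Delta_k (rank_int A) A"

definition top_square :: "int mat \<Rightarrow> int mat" where
  "top_square H = mat (dim_col H) (dim_col H) (\<lambda>(i, j). H $$ (i, j))"

text \<open>Rows and columns are numbered from 0.\<close>

definition reduced_hnf :: "int mat \<Rightarrow> bool" where
  "reduced_hnf H \<longleftrightarrow> (let n = dim_col H in
     n \<le> dim_row H \<and>
     det (top_square H) \<noteq> 0 \<and>
     (\<forall>i<n. \<forall>j<n. i < j \<longrightarrow> H $$ (i, j) = 0) \<and>
     (\<forall>i<n. \<forall>j<i. 0 \<le> H $$ (i, j) \<and> H $$ (i, j) < H $$ (i, i)) \<and>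
     (\<exists>s\<le>n. (\<forall>i<s. H $$ (i, i) = 1) \<and> (\<forall>i. s \<le> i \<and> i < n \<longrightarrow> 2 \<le> H $$ (i, i))))"


section \<open>Integer linear programming\<close>

definition polyhedron :: "int mat \<Rightarrow> int vec \<Rightarrow> real vec set" where
  "polyhedron H b =
     {x \<in> carrier_vec (dim_col H). map_mat real_of_int H *\<^sub>v x \<le> map_vec real_of_int b}"

definition integer_points :: "real vec set \<Rightarrow> int vec set" where
  "integer_points P = {x. map_vec real_of_int x \<in> P}"

datatype ilp_answer = Infeasible | Unbounded | Optimal "int vec"

fun ilp_correct :: "int vec \<Rightarrow> int vec set \<Rightarrow> ilp_answer \<Rightarrow> bool" where
  "ilp_correct c S Infeasible \<longleftrightarrow> S = {}"
| "ilp_correct c S Unbounded \<longleftrightarrow> (\<forall>K. \<exists>x\<in>S. c \<bullet> x > K)"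
| "ilp_correct c S (Optimal x) \<longleftrightarrow> x \<in> S \<and> (\<forall>y\<in>S. c \<bullet> y \<le> c \<bullet> x)"


section \<open>Bit sizes and the cost of multiplication\<close>

definition isize :: "int \<Rightarrow> nat" where
  "isize x = 1 + nat \<lceil>log 2 (real_of_int \<bar>x\<bar> + 1)\<rceil>"

definition vsize :: "int vec \<Rightarrow> nat" where
  "vsize v = dim_vec v + (\<Sum>i<dim_vec v. isize (v $ i))"

text \<open>
  The bit complexity of multiplication is a parameter, of which only the usual regularity is
  required: it is monotone, at least linear (the operands have to be read), and doubling the
  length of the operands changes it by a bounded factor.
\<close>

definition mult_cost :: "(nat \<Rightarrow> real) \<Rightarrow> bool" where
  "mult_cost mul \<longleftrightarrow>
     mono mul \<and> (\<forall>k. real k \<le> mul k) \<and> (\<exists>C. \<forall>k. mul (2 * k) \<le> C * mul k)"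


section \<open>Algorithms: random access programs over the integers\<close>

text \<open>
  Programs work on integer arrays; array names are part of the program text, indices are computed.
  Running times follow the logarithmic cost criterion: an elementary operation costs the bit size
  of what it reads, a multiplication or (floor) division of numbers of size at most k costs
  \<open>mul k\<close> (division has the bit complexity of multiplication up to a constant factor).

  There are two kinds of arrays, plain ones and right-hand side ones. The latter hold the
  entries of b and numbers derived from them, on which only linear operations are available;
  reduction modulo a plain number leads back to plain numbers. The size charged for a
  right-hand side number is given by the parameter rsz: taking isize gives the bit cost of the
  whole run, while taking the constant 0 counts operations on right-hand side numbers
  as elementary, so that only the bits of the plain operands (those of indices, H and c)
  are charged. Already an optimal solution of the system x \<le> b has the size of b, so a time
  bound that does not mention b can only be meant in the second way.
\<close>

datatype aexp =
    Num int
  | Ld nat aexp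
  | Add aexp aexp
  | Sub aexp aexp
  | Mul aexp aexp
  | Div aexp aexp
  | RMod rexp aexp
and rexp =
    RInt aexp
  | RLd nat aexp
  | RAdd rexp rexp
  | RSub rexp rexp
  | RMul aexp rexp
  | RDiv rexp aexp

datatype bexp =
    Less aexp aexp
  | RLess rexp rexp
  | Neg bexp
  | Conj bexp bexp

datatype com =
    Skip
  | Store nat aexp aexp
  | RStore nat aexp rexp
  | Seq com com
  | Cond bexp com com
  | While bexp com

text \<open>
  Reduction modulo 0 gives 0 rather than the dividend, which could have any size.
\<close>

type_synonym arrays = "nat \<Rightarrow> int \<Rightarrow> int"
type_synonym state = "arrays \<times> arrays"

primrec aval :: "aexp \<Rightarrow> state \<Rightarrow> int" and rval :: "rexp \<Rightarrow> state \<Rightarrow> int" where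
  "aval (Num x) s = x"
| "aval (Ld k a) s = fst s k (aval a s)"
| "aval (Add a a') s = aval a s + aval a' s"
| "aval (Sub a a') s = aval a s - aval a' s"
| "aval (Mul a a') s = aval a s * aval a' s"
| "aval (Div a a') s = aval a s div aval a' s"
| "aval (RMod r a) s = (if aval a s = 0 then 0 else rval r s mod aval a s)"
| "rval (RInt a) s = aval a s"
| "rval (RLd k a) s = snd s k (aval a s)"
| "rval (RAdd r r') s = rval r s + rval r' s"
| "rval (RSub r r') s = rval r s - rval r' s"
| "rval (RMul a r) s = aval a s * rval r s"
| "rval (RDiv r a) s = rval r s div aval a s"

primrec bval :: "bexp \<Rightarrow> state \<Rightarrow> bool" where
  "bval (Less a a') s = (aval a s < aval a' s)"
| "bval (RLess r r') s = (rval r s < rval r' s)"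
| "bval (Neg e) s = (\<not> bval e s)"
| "bval (Conj e e') s = (bval e s \<and> bval e' s)"

primrec acost :: "(nat \<Rightarrow> real) \<Rightarrow> (int \<Rightarrow> nat) \<Rightarrow> aexp \<Rightarrow> state \<Rightarrow> real"
  and rcost :: "(nat \<Rightarrow> real) \<Rightarrow> (int \<Rightarrow> nat) \<Rightarrow> rexp \<Rightarrow> state \<Rightarrow> real" where
  "acost mul rsz (Num x) s = isize x"
| "acost mul rsz (Ld k a) s =
     acost mul rsz a s + isize (aval a s) + isize (aval (Ld k a) s)"
| "acost mul rsz (Add a a') s =
     acost mul rsz a s + acost mul rsz a' s + isize (aval a s) + isize (aval a' s)"
| "acost mul rsz (Sub a a') s =
     acost mul rsz a s + acost mul rsz a' s + isize (aval a s) + isize (aval a' s)"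
| "acost mul rsz (Mul a a') s =
     acost mul rsz a s + acost mul rsz a' s + mul (max (isize (aval a s)) (isize (aval a' s)))"
| "acost mul rsz (Div a a') s =
     acost mul rsz a s + acost mul rsz a' s + mul (max (isize (aval a s)) (isize (aval a' s)))"
| "acost mul rsz (RMod r a) s =
     rcost mul rsz r s + acost mul rsz a s + mul (max (rsz (rval r s)) (isize (aval a s)))"
| "rcost mul rsz (RInt a) s = acost mul rsz a s + isize (aval a s)"
| "rcost mul rsz (RLd k a) s =
     acost mul rsz a s + isize (aval a s) + 1 + rsz (rval (RLd k a) s)"
| "rcost mul rsz (RAdd r r') s =
     rcost mul rsz r s + rcost mul rsz r' s + 1 + rsz (rval r s) + rsz (rval r' s)"
| "rcost mul rsz (RSub r r') s =
     rcost mul rsz r s + rcost mul rsz r' s + 1 + rsz (rval r s) + rsz (rval r' s)"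
| "rcost mul rsz (RMul a r) s =
     acost mul rsz a s + rcost mul rsz r s + mul (max (isize (aval a s)) (rsz (rval r s)))"
| "rcost mul rsz (RDiv r a) s =
     rcost mul rsz r s + acost mul rsz a s + mul (max (rsz (rval r s)) (isize (aval a s)))"

primrec bcost :: "(nat \<Rightarrow> real) \<Rightarrow> (int \<Rightarrow> nat) \<Rightarrow> bexp \<Rightarrow> state \<Rightarrow> real" where
  "bcost mul rsz (Less a a') s =
     acost mul rsz a s + acost mul rsz a' s + isize (aval a s) + isize (aval a' s)"
| "bcost mul rsz (RLess r r') s =
     rcost mul rsz r s + rcost mul rsz r' s + 1 + rsz (rval r s) + rsz (rval r' s)"
| "bcost mul rsz (Neg e) s = bcost mul rsz e s + 1"
| "bcost mul rsz (Conj e e') s = bcost mul rsz e s + bcost mul rsz e' s + 1"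

text \<open>\<open>exec mul rsz p s s' t\<close>: started in s, the program p terminates in s' after time t.\<close>

inductive exec :: "(nat \<Rightarrow> real) \<Rightarrow> (int \<Rightarrow> nat) \<Rightarrow> com \<Rightarrow> state \<Rightarrow> state \<Rightarrow> real \<Rightarrow> bool"
  for mul rsz where
  Skip: "exec mul rsz Skip s s 1"
| Store: "exec mul rsz (Store k a e) s
     ((fst s)(k := (fst s k)(aval a s := aval e s)), snd s)
     (acost mul rsz a s + acost mul rsz e s + isize (aval a s) + isize (aval e s))"
| RStore: "exec mul rsz (RStore k a r) s
     (fst s, (snd s)(k := (snd s k)(aval a s := rval r s)))
     (acost mul rsz a s + rcost mul rsz r s + isize (aval a s) + 1 + rsz (rval r s))"
| Seq: "exec mul rsz p s s' t \<Longrightarrow> exec mul rsz q s' s'' t' \<Longrightarrow>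
     exec mul rsz (Seq p q) s s'' (t + t')"
| CondTrue: "bval e s \<Longrightarrow> exec mul rsz p s s' t \<Longrightarrow>
     exec mul rsz (Cond e p q) s s' (bcost mul rsz e s + 1 + t)"
| CondFalse: "\<not> bval e s \<Longrightarrow> exec mul rsz q s s' t \<Longrightarrow>
     exec mul rsz (Cond e p q) s s' (bcost mul rsz e s + 1 + t)"
| WhileFalse: "\<not> bval e s \<Longrightarrow>
     exec mul rsz (While e p) s s (bcost mul rsz e s + 1)"
| WhileTrue: "bval e s \<Longrightarrow> exec mul rsz p s s' t \<Longrightarrow> exec mul rsz (While e p) s' s'' t' \<Longrightarrow>
     exec mul rsz (While e p) s s'' (bcost mul rsz e s + 1 + t + t')"

definition array_of :: "int list \<Rightarrow> int \<Rightarrow> int" where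
  "array_of xs i = (if 0 \<le> i \<and> nat i < length xs then xs ! nat i else 0)"

text \<open>
  Input: the plain arrays 0, 1, 2 hold the dimensions, H (row by row) and c; the right-hand side
  array 0 holds b; everything else is 0. Output: the plain array 0 holds at index 0 the status
  (0 infeasible, 1 unbounded, otherwise optimal), the right-hand side array 1 an optimal solution.
\<close>

definition ilp_input :: "int mat \<Rightarrow> int vec \<Rightarrow> int vec \<Rightarrow> state" where
  "ilp_input H c b =
     ((\<lambda>_ _. 0)(0 := array_of [int (dim_row H), int (dim_col H)],
                1 := array_of (concat (map list_of_vec (rows H))),
                2 := array_of (list_of_vec c)),
      (\<lambda>_ _. 0)(0 := array_of (list_of_vec b)))"

definition ilp_output :: "nat \<Rightarrow> state \<Rightarrow> ilp_answer" where
  "ilp_output n s =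
     (if fst s 0 0 = 0 then Infeasible
      else if fst s 0 0 = 1 then Unbounded
      else Optimal (vec n (\<lambda>j. snd s 1 (int j))))"

end

theory Submission imports Defs
begin

text \<open>
  All maximal minors being nonzero, two rows below the basis would have coordinate vectors
  \<open>w\<close> and \<open>w'\<close> over the basis rows (scaled by the determinant of the basis) for which the pairs
  \<open>(w i, w' i)\<close>, with entries between \<open>-\<Delta>\<close> and \<open>\<Delta>\<close>, are pairwise independent.
  There are at most \<open>(2 * \<Delta> + 1)\<^sup>2 < n\<close> such pairs, so there is at most one such row.

  Passing to slack vectors y = b - H x turns the problem into the minimisation of a linear cost over
  the multisets y of generators of the group of integer vectors modulo the columns of H that have the
  same value as b. A group element is determined by an element of a group of order
  \<open>\<delta> \<le> \<Delta>\<close>, the reduction of the basis part, and by one integer, the value of the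
  linear form \<open>\<sigma>\<close> that vanishes on the columns, whose coefficients are maximal minors. If
  \<open>\<sigma> b\<close> is large, an exchange argument shows that the slack of the inequality with the best
  ratio of cost to \<open>\<sigma>\<close> can be made large without loss; its right-hand side is decreased
  until \<open>\<sigma> b\<close> is at most \<open>2 * \<Delta>\<^sup>2\<close>. Any multiset can then be peeled off one
  generator at a time with all values of \<open>\<sigma>\<close> in that window, which leaves
  \<open>O(\<Delta>\<^sup>3)\<close> states; the Bellman-Ford algorithm on these states finds a cheapest multiset
  for each of them, and the problem is unbounded iff it is feasible and the zero state is
  reached at negative cost. This takes \<open>O(n\<^sup>3 * \<Delta>\<^sup>6)\<close> operations, and
  \<open>\<Delta>\<^sup>2 \<le> n\<close>.
\<close>

section \<open>Remainders modulo a lattice in Hermite normal form\<close>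

text \<open>The budget shapes the program: it does not mention b, so no loop may depend on the size
  of b, and a number derived from b becomes plain only as a remainder modulo a plain number. Hence
  the class of b is found by forward substitution with one floor division per row, whose remainders
  are the digits of a mixed-radix number, and the tightening is a single division instead of
  repeated exchanges. The columns of the adjugate solve H_B x = \<delta> e_k, so the same triangular
  solver supplies both linear forms; its integer results lie in a known symmetric interval and are
  made plain by a shifted remainder. With negative zero sums, cheapest multisets need not exist. The
  table is therefore only required to hold costs of actual multisets and to be no worse than every
  multiset of at most as many generators as there are slots. By the pigeonhole principle this length
  suffices both to expose a negative zero sum and, if there is none, to contain an optimal
  representative. Bit sizes are controlled by one fixed exponent per array, and a single step count
  is priced under both ways of charging.\<close>

lemma abs_div_le_abs: "\<bar>a div b\<bar> \<le> \<bar>a\<bar>" for a b :: int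
proof -
  have *: "\<bar>a div b\<bar> \<le> \<bar>a\<bar>" if "0 < b" for a b :: int
  proof (cases "0 \<le> a")
    case True
    then show ?thesis using that zdiv_mono2[of a 1 b] by (simp add: pos_imp_zdiv_nonneg_iff)
  next
    case False
    then have "a div 1 \<le> a div b" using that by (intro zdiv_mono2_neg) auto
    moreover have "a div b < 0" using that False by (simp add: pos_imp_zdiv_neg_iff)
    ultimately show ?thesis by simp
  qed
  consider "b = 0" | "0 < b" | "0 < - b" by linarith
  then show ?thesis
  proof cases
    case 3
    then show ?thesis using *[of "-b" "-a"] by simp
  qed (use * in auto)
qed

text \<open>Only the first \<open>n\<close> rows are constrained, so the same function
  \<open>H\<close> can also carry the row below the basis.\<close>

locale lower_hnf =
  fixes n :: nat and H :: "nat \<Rightarrow> nat \<Rightarrow> int"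
  assumes upper_zero: "i < n \<Longrightarrow> j < n \<Longrightarrow> i < j \<Longrightarrow> H i j = 0"
    and off_diag: "i < n \<Longrightarrow> j < i \<Longrightarrow> 0 \<le> H i j \<and> H i j < H i i"
    and diag_pos: "i < n \<Longrightarrow> 1 \<le> H i i"
begin

text \<open>Coefficients of the lattice vector whose subtraction leaves the canonical remainder
  \<open>rmd v\<close>. On a lattice vector the floors are exact, and this is the solution of the
  triangular system.\<close>

function quot :: "(nat \<Rightarrow> int) \<Rightarrow> nat \<Rightarrow> int" where
  "quot v i = (v i - (\<Sum>j<i. H i j * quot v j)) div H i i"
  by auto
termination by (relation "measure snd") auto

declare quot.simps [simp del]

definition rmd :: "(nat \<Rightarrow> int) \<Rightarrow> nat \<Rightarrow> int" where
  "rmd v i = (v i - (\<Sum>j<i. H i j * quot v j)) mod H i i"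

definition pivots :: "nat \<Rightarrow> int" where
  "pivots k = (\<Prod>i<k. H i i)"

text \<open>The number with digits \<open>rmd v i\<close> in the mixed radix \<open>H i i\<close>.
  It encodes classes injectively below \<open>pivots n\<close>, but addition of classes is not
  addition of these numbers.\<close>

primrec horner :: "(nat \<Rightarrow> int) \<Rightarrow> nat \<Rightarrow> int" where
  "horner v 0 = 0"
| "horner v (Suc i) = horner v i * H i i + rmd v i"

definition ix :: "(nat \<Rightarrow> int) \<Rightarrow> int" where
  "ix v = horner v n"

definition basis_lattice :: "(nat \<Rightarrow> int) \<Rightarrow> bool" where
  "basis_lattice z \<longleftrightarrow> (\<exists>x. \<forall>i<n. z i = (\<Sum>j<n. H i j * x j))"

lemma row_sum: "i < n \<Longrightarrow> (\<Sum>j<n. H i j * x j) = (\<Sum>j<i. H i j * x j) + H i i * x i"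
proof -
  assume i: "i < n"
  have "(\<Sum>j<n. H i j * x j) = (\<Sum>j<Suc i. H i j * x j)"
    using i by (intro sum.mono_neutral_right) (auto simp: upper_zero)
  then show ?thesis by simp
qed

lemma quot_rmd:
  assumes "i < n"
  shows "v i = (\<Sum>j<n. H i j * quot v j) + rmd v i"
proof -
  let ?a = "v i - (\<Sum>j<i. H i j * quot v j)"
  have "H i i * quot v i + rmd v i = ?a"
    unfolding rmd_def quot.simps[of v i] by (rule mult_div_mod_eq)
  then show ?thesis unfolding row_sum[OF assms, of "quot v"] by linarith
qed

lemma rmd_bounds: "i < n \<Longrightarrow> 0 \<le> rmd v i \<and> rmd v i < H i i"
  using diag_pos[of i] by (simp add: rmd_def)

text \<open>By induction on the row: once the earlier quotients are shifted by \<open>x\<close>, the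
  partial residue changes by \<open>x i\<close> times the pivot, which a floor division passes on to
  the quotient and a remainder does not see.\<close>

lemma rmd_eq_if_basis_lattice:
  assumes x: "\<And>i. i < n \<Longrightarrow> u i - v i = (\<Sum>j<n. H i j * x j)" and i: "i < n"
  shows "quot u i = quot v i + x i \<and> rmd u i = rmd v i"
  using i
proof (induction i rule: less_induct)
  case (less i)
  have "(\<Sum>j<i. H i j * quot u j) = (\<Sum>j<i. H i j * (quot v j + x j))"
    using less by (intro sum.cong) auto
  then have "u i - (\<Sum>j<i. H i j * quot u j) = (v i - (\<Sum>j<i. H i j * quot v j)) + x i * H i i"
    using x[OF less.prems] row_sum[OF less.prems, of x]
    by (simp add: sum.distrib distrib_left algebra_simps)
  then show ?case using diag_pos[OF less.prems]
    by (simp add: quot.simps[of u i] quot.simps[of v i] rmd_def)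
qed

lemma basis_lattice_iff_rmd:
  "basis_lattice (\<lambda>i. u i - v i) \<longleftrightarrow> (\<forall>i<n. rmd u i = rmd v i)"
proof
  assume "basis_lattice (\<lambda>i. u i - v i)"
  then show "\<forall>i<n. rmd u i = rmd v i"
    using rmd_eq_if_basis_lattice[of u v] unfolding basis_lattice_def by blast
next
  assume r: "\<forall>i<n. rmd u i = rmd v i"
  have "u i - v i = (\<Sum>j<n. H i j * (quot u j - quot v j))" if "i < n" for i
    using quot_rmd[OF that, of u] quot_rmd[OF that, of v] r that
    by (simp add: right_diff_distrib sum_subtractf)
  then show "basis_lattice (\<lambda>i. u i - v i)"
    unfolding basis_lattice_def by (intro exI[of _ "\<lambda>j. quot u j - quot v j"]) auto
qed

lemma pivots_Suc: "pivots (Suc k) = pivots k * H k k"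
  by (simp add: pivots_def)

lemma pivots_pos: "k \<le> n \<Longrightarrow> 1 \<le> pivots k"
proof (induction k)
  case (Suc k)
  then show ?case
    using mult_mono[of 1 "pivots k" 1 "H k k"] diag_pos[of k] by (simp add: pivots_Suc)
qed (simp add: pivots_def)

lemma pivots_mono: "j \<le> k \<Longrightarrow> k \<le> n \<Longrightarrow> pivots j \<le> pivots k"
proof (induction k)
  case (Suc k)
  show ?case
  proof (cases "j = Suc k")
    case False
    then have "pivots j \<le> pivots k * 1" using Suc by simp
    also have "\<dots> \<le> pivots k * H k k"
      using Suc.prems pivots_pos[of k] diag_pos[of k] by (intro mult_left_mono) auto
    finally show ?thesis by (simp add: pivots_Suc)
  qed simp
qed simp

lemma horner_bounds: "k \<le> n \<Longrightarrow> 0 \<le> horner v k \<and> horner v k < pivots k"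
proof (induction k)
  case (Suc k)
  then have h: "0 \<le> horner v k" "horner v k + 1 \<le> pivots k" by auto
  have r: "0 \<le> rmd v k" "rmd v k < H k k" using rmd_bounds[of k v] Suc.prems by auto
  have "(horner v k + 1) * H k k \<le> pivots k * H k k"
    using h(2) r by (intro mult_right_mono) auto
  then show ?case using h r by (simp add: pivots_Suc algebra_simps)
qed (simp add: pivots_def)

lemma horner_eq_iff: "k \<le> n \<Longrightarrow> horner u k = horner v k \<longleftrightarrow> (\<forall>i<k. rmd u i = rmd v i)"
proof (induction k)
  case (Suc k)
  have b: "0 \<le> rmd w k" "rmd w k < H k k" for w
    using rmd_bounds[of k w] Suc.prems by auto
  have "horner w (Suc k) div H k k = horner w k \<and> horner w (Suc k) mod H k k = rmd w k" for w
    using b[of w] by simp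
  then have "horner u (Suc k) = horner v (Suc k) \<longleftrightarrow> horner u k = horner v k \<and> rmd u k = rmd v k"
    by (metis horner.simps(2))
  then show ?case using Suc by (auto simp: less_Suc_eq)
qed simp

lemma ix_eq_iff: "ix u = ix v \<longleftrightarrow> basis_lattice (\<lambda>i. u i - v i)"
  by (simp add: ix_def horner_eq_iff basis_lattice_iff_rmd)

lemma ix_bounds: "0 \<le> ix v" "ix v < pivots n"
  using horner_bounds[of n v] by (auto simp: ix_def)

lemma quot_zero: "quot (\<lambda>_. 0) i = 0"
  by (induction i rule: less_induct) (subst quot.simps, simp)

lemma ix_zero: "ix (\<lambda>_. 0) = 0"
proof -
  have "horner (\<lambda>_. 0) k = 0" for k
    by (induction k) (simp_all add: rmd_def quot_zero)
  then show ?thesis by (simp add: ix_def)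
qed

lemma quot_exact:
  assumes "\<And>i. i < n \<Longrightarrow> v i = (\<Sum>j<n. H i j * x j)" "i < n"
  shows "quot v i = x i"
proof -
  show ?thesis
    using rmd_eq_if_basis_lattice[of v "\<lambda>_. 0" x i] assms by (simp add: quot_zero)
qed

text \<open>In a reduced form the off-diagonal entries are below the pivot of their row, so the
  pivot controls the growth. All \<open>k \<le> i\<close> are covered because the program stores
  every partial residue.\<close>

lemma partial_residue_bound:
  assumes B: "\<And>i. i < n \<Longrightarrow> \<bar>v i\<bar> \<le> B" and i: "i < n" and k: "k \<le> i"
  shows "\<bar>v i - (\<Sum>j<k. H i j * quot v j)\<bar> \<le> B + (H i i - 1) * (\<Sum>j<i. \<bar>quot v j\<bar>)"
proof -
  have "\<bar>\<Sum>j<k. H i j * quot v j\<bar> \<le> (\<Sum>j<k. (H i i - 1) * \<bar>quot v j\<bar>)"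
    using off_diag[of i] i k
    by (intro order_trans[OF sum_abs] sum_mono) (auto simp: abs_mult intro!: mult_right_mono)
  also have "\<dots> \<le> (\<Sum>j<i. (H i i - 1) * \<bar>quot v j\<bar>)"
    using k diag_pos[of i] i by (intro sum_mono2) auto
  finally show ?thesis using B[OF i] by (simp add: sum_distrib_left)
qed

text \<open>For \<open>T k = B + (\<Sum>j<k. \<bar>quot v j\<bar>)\<close> one step gives
  \<open>T (k + 1) \<le> H k k * T k + B\<close>. Hence the growth is governed by the product of the
  pivots, a determinant, and is not exponential in \<open>n\<close>.\<close>

lemma quot_sum_bound:
  assumes B: "\<And>i. i < n \<Longrightarrow> \<bar>v i\<bar> \<le> B" and B0: "0 \<le> B" and k: "k \<le> n"
  shows "B + (\<Sum>j<k. \<bar>quot v j\<bar>) \<le> (int k + 1) * B * pivots k"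
  using k
proof (induction k)
  case (Suc k)
  let ?S = "\<Sum>j<k. \<bar>quot v j\<bar>"
  have k: "k < n" using Suc.prems by simp
  have "\<bar>quot v k\<bar> \<le> \<bar>v k - (\<Sum>j<k. H k j * quot v j)\<bar>"
    using abs_div_le_abs by (simp add: quot.simps[of v k])
  also have "\<dots> \<le> B + (H k k - 1) * ?S"
    using partial_residue_bound[OF B k order_refl] .
  finally have "B + (\<Sum>j<Suc k. \<bar>quot v j\<bar>) \<le> B + (B + H k k * ?S)"
    by (simp add: algebra_simps)
  also have "\<dots> \<le> (B + ?S) * H k k + B"
    using mult_right_mono[of 1 "H k k" B] diag_pos[OF k] B0 by (simp add: algebra_simps)
  also have "\<dots> \<le> (int k + 1) * B * pivots k * H k k + B * pivots (Suc k)"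
    using Suc diag_pos[OF k] pivots_pos[of "Suc k"] mult_left_mono[of 1 "pivots (Suc k)" B] B0
    by (intro add_mono mult_right_mono) auto
  finally show ?case by (simp add: pivots_Suc algebra_simps)
qed (simp add: pivots_def)

lemma quot_bound:
  assumes B: "\<And>i. i < n \<Longrightarrow> \<bar>v i\<bar> \<le> B" and B0: "0 \<le> B" and i: "i < n"
  shows "\<bar>quot v i\<bar> \<le> (int n + 1) * B * pivots n"
proof -
  have "\<bar>quot v i\<bar> \<le> B + (\<Sum>j<n. \<bar>quot v j\<bar>)"
    using i B0 member_le_sum[of i "{..<n}" "\<lambda>j. \<bar>quot v j\<bar>"] by auto
  then show ?thesis using quot_sum_bound[of v B n, OF B B0] by simp
qed

lemma residue_bound:
  assumes B: "\<And>i. i < n \<Longrightarrow> \<bar>v i\<bar> \<le> B" and B0: "0 \<le> B" and i: "i < n" and k: "k \<le> i"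
  shows "\<bar>v i - (\<Sum>j<k. H i j * quot v j)\<bar> \<le> (int n + 1) * B * pivots n"
proof -
  define S where "S = (\<Sum>j<i. \<bar>quot v j\<bar>)"
  have S: "0 \<le> S" by (auto simp: S_def intro: sum_nonneg)
  have "\<bar>v i - (\<Sum>j<k. H i j * quot v j)\<bar> \<le> B + (H i i - 1) * S"
    unfolding S_def by (rule partial_residue_bound[OF B i k])
  also have "\<dots> \<le> (B + S) * H i i"
    using mult_right_mono[of 1 "H i i" B] diag_pos[OF i] B0 S
    by (simp add: algebra_simps)
  also have "\<dots> \<le> ((int i + 1) * B * pivots i) * H i i"
    using quot_sum_bound[of v B i, OF B B0] i diag_pos[OF i] S_def by (intro mult_right_mono) auto
  also have "\<dots> = (int i + 1) * B * pivots (Suc i)" by (simp add: pivots_Suc)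
  also have "\<dots> \<le> (int n + 1) * B * pivots n"
    using i B0 pivots_mono[of "Suc i" n] pivots_pos[of "Suc i"] by (intro mult_mono) auto
  finally show ?thesis .
qed

end

section \<open>Knapsack problems in a finitely generated abelian group\<close>

definition unit_at :: "nat \<Rightarrow> nat \<Rightarrow> int" where
  "unit_at k i = (if i = k then 1 else 0)"

definition dot :: "nat \<Rightarrow> (nat \<Rightarrow> int) \<Rightarrow> (nat \<Rightarrow> int) \<Rightarrow> int" where
  "dot d f v = (\<Sum>i<d. f i * v i)"

text \<open>Vanishing from \<open>d\<close> on makes equality of functions equality of multisets, so
  that rows of the table can be identified with multisets.\<close>

definition multisets :: "nat \<Rightarrow> (nat \<Rightarrow> int) set" where
  "multisets d = {v. (\<forall>i. 0 \<le> v i) \<and> (\<forall>i\<ge>d. v i = 0)}"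

abbreviation total :: "nat \<Rightarrow> (nat \<Rightarrow> int) \<Rightarrow> int" where
  "total d \<equiv> dot d (\<lambda>_. 1)"

lemma dot_add: "dot d f (\<lambda>i. u i + v i) = dot d f u + dot d f v"
  by (simp add: dot_def distrib_left sum.distrib)

lemma dot_diff: "dot d f (\<lambda>i. u i - v i) = dot d f u - dot d f v"
  by (simp add: dot_def right_diff_distrib sum_subtractf)

lemma dot_scale: "dot d f (\<lambda>i. t * v i) = t * dot d f v"
  by (simp add: dot_def sum_distrib_left mult.left_commute)

lemma dot_unit: "k < d \<Longrightarrow> dot d f (unit_at k) = f k"
proof -
  assume "k < d"
  then have "dot d f (unit_at k) = (\<Sum>i\<in>{k}. f i * unit_at k i)"
    unfolding dot_def by (intro sum.mono_neutral_right) (auto simp: unit_at_def)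
  then show ?thesis by (simp add: unit_at_def)
qed

lemma dot_zero: "dot d f (\<lambda>_. 0) = 0"
  by (simp add: dot_def)

lemmas dot_simps = dot_add dot_diff dot_scale dot_unit dot_zero

lemma dot_le_total:
  assumes "v \<in> multisets d" "\<And>i. i < d \<Longrightarrow> \<bar>f i\<bar> \<le> D"
  shows "\<bar>dot d f v\<bar> \<le> D * total d v"
proof -
  have "\<bar>dot d f v\<bar> \<le> (\<Sum>i<d. D * v i)" unfolding dot_def
    using assms by (intro order_trans[OF sum_abs] sum_mono)
      (auto simp: abs_mult multisets_def intro!: mult_right_mono)
  then show ?thesis by (simp add: dot_def sum_distrib_left)
qed

lemma total_nonneg: "v \<in> multisets d \<Longrightarrow> 0 \<le> total d v"
  by (auto simp: dot_def multisets_def intro!: sum_nonneg)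

lemma multisets_zero: "v \<in> multisets d \<Longrightarrow> total d v = 0 \<Longrightarrow> v = (\<lambda>_. 0)"
  by (rule ext, rename_tac i, case_tac "i < d")
     (auto simp: dot_def multisets_def sum_nonneg_eq_0_iff)

lemma multisets_minus_unit:
  "v \<in> multisets d \<Longrightarrow> 1 \<le> v k \<Longrightarrow> (\<lambda>i. v i - unit_at k i) \<in> multisets d"
  unfolding multisets_def unit_at_def by (cases "k < d") auto

lemma multisets_diff:
  "v \<in> multisets d \<Longrightarrow> u \<in> multisets d \<Longrightarrow> (\<And>i. u i \<le> v i) \<Longrightarrow> (\<lambda>i. v i - u i) \<in> multisets d"
  by (auto simp: multisets_def)

text \<open>Peeling off one generator at a time can be done without leaving the window: if the
  current sum is nonnegative, some generator in the multiset is nonnegative as well.\<close>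
lemma peel:
  assumes v: "v \<in> multisets d" and pos: "0 < total d v" and w: "\<bar>dot d f v\<bar> \<le> W"
    and D: "\<And>i. i < d \<Longrightarrow> \<bar>f i\<bar> \<le> D" "D \<le> W"
  shows "\<exists>k<d. 1 \<le> v k \<and> \<bar>dot d f v - f k\<bar> \<le> W"
proof (rule ccontr)
  assume none: "\<not> ?thesis"
  have nn: "0 \<le> v i" for i using v by (simp add: multisets_def)
  have "\<exists>k<d. v k \<noteq> 0"
    using pos by (auto simp: dot_def dest: sum.not_neutral_contains_not_neutral[OF less_imp_neq[THEN not_sym]])
  then obtain k0 where k0: "k0 < d" "0 < v k0" using nn by (metis order_le_imp_less_or_eq)
  show False
  proof (cases "0 \<le> dot d f v")
    case True
    have neg: "f i < 0" if "i < d" "1 \<le> v i" for i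
    proof -
      have "W < \<bar>dot d f v - f i\<bar>" using none that by auto
      then show ?thesis using w D(1)[OF that(1)] D(2) True by linarith
    qed
    have "dot d f v < (\<Sum>i<d. 0)" unfolding dot_def
    proof (rule sum_strict_mono_ex1)
      show "\<forall>i\<in>{..<d}. f i * v i \<le> 0"
      proof
        fix i assume "i \<in> {..<d}"
        then show "f i * v i \<le> 0"
          using neg[of i] nn[of i] by (cases "v i = 0") (auto simp: mult_nonpos_nonneg)
      qed
      show "\<exists>i\<in>{..<d}. f i * v i < 0"
        using k0 neg[of k0] by (auto intro!: bexI[of _ k0] simp: mult_neg_pos)
    qed auto
    then show False using True by simp
  next
    case False
    have pos: "0 < f i" if "i < d" "1 \<le> v i" for i
    proof -
      have "W < \<bar>dot d f v - f i\<bar>" using none that by auto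
      then show ?thesis using w D(1)[OF that(1)] D(2) False by linarith
    qed
    have "0 \<le> dot d f v" unfolding dot_def
    proof (rule sum_nonneg)
      fix i assume "i \<in> {..<d}"
      then show "0 \<le> f i * v i"
        using pos[of i] nn[of i] by (cases "v i = 0") auto
    qed
    then show False using False by simp
  qed
qed

text \<open>Peeling from the full multiset downwards: \<open>p k\<close> is what is left when
  \<open>k\<close> generators remain. The nesting makes the difference of two stages a multiset
  again, so a repetition of states can be cut out.\<close>

lemma chain:
  assumes "v \<in> multisets d" "total d v = int L" "\<bar>dot d f v\<bar> \<le> W"
    and D: "\<And>i. i < d \<Longrightarrow> \<bar>f i\<bar> \<le> D" "D \<le> W"
  shows "\<exists>p. (\<forall>k\<le>L. p k \<in> multisets d \<and> total d (p k) = int k \<and> \<bar>dot d f (p k)\<bar> \<le> W) \<and>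
    (\<forall>a b i. a \<le> b \<longrightarrow> b \<le> L \<longrightarrow> p a i \<le> p b i) \<and> p L = v"
  using assms(1-3)
proof (induction L arbitrary: v)
  case 0
  then show ?case by (intro exI[of _ "\<lambda>_. v"]) auto
next
  case (Suc L)
  obtain k where k: "k < d" "1 \<le> v k" "\<bar>dot d f v - f k\<bar> \<le> W"
    using peel[OF Suc.prems(1) _ Suc.prems(3) D] Suc.prems(2) by auto
  let ?u = "\<lambda>i. v i - unit_at k i"
  obtain p where p: "\<forall>k\<le>L. p k \<in> multisets d \<and> total d (p k) = int k \<and> \<bar>dot d f (p k)\<bar> \<le> W"
      "\<forall>a b i. a \<le> b \<longrightarrow> b \<le> L \<longrightarrow> p a i \<le> p b i" "p L = ?u"
    using Suc.IH[of ?u] multisets_minus_unit[OF Suc.prems(1) k(2)] Suc.prems k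
    by (auto simp: dot_simps)
  have le: "p a i \<le> v i" if "a \<le> L" for a i
    using p(2)[rule_format, of a L i] p(3) that by (auto simp: unit_at_def split: if_splits)
  show ?case
    by (intro exI[of _ "p(Suc L := v)"]) (use p le Suc.prems in \<open>auto simp: le_Suc_eq\<close>)
qed

text \<open>The group enters only through an index of classes: \<open>ix_add\<close> makes equality
  of indices a congruence, \<open>ix_torsion\<close> says that \<open>e\<close> annihilates the
  quotient, and \<open>sigma_cong\<close> that the index fixes the value of \<sigma> modulo
  \<open>e\<close>.\<close>

locale group_knapsack =
  fixes d :: nat and e D :: int and ix :: "(nat \<Rightarrow> int) \<Rightarrow> int" and \<sigma> \<gamma> :: "nat \<Rightarrow> int"
  assumes e_pos: "1 \<le> e" and e_le_D: "e \<le> D"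
    and ix_nonneg: "0 \<le> ix v" and ix_less: "ix v < e"
    and ix_add: "ix (\<lambda>i. u i + w i) = ix (\<lambda>i. v i + w i) \<longleftrightarrow> ix u = ix v"
    and ix_torsion: "ix (\<lambda>i. e * v i) = ix (\<lambda>_. 0)"
    and sigma_cong: "ix u = ix v \<Longrightarrow> e dvd dot d \<sigma> u - dot d \<sigma> v"
    and sigma_le: "i < d \<Longrightarrow> \<bar>\<sigma> i\<bar> \<le> D"
begin

abbreviation sg where "sg \<equiv> dot d \<sigma>"
abbreviation cost where "cost \<equiv> dot d \<gamma>"

text \<open>Homogeneous solutions: adding one to a multiset changes neither its class nor its value
  of \<sigma>. They play the role of integral recession directions.\<close>

definition zero_sum :: "(nat \<Rightarrow> int) \<Rightarrow> bool" where
  "zero_sum z \<longleftrightarrow> z \<in> multisets d \<and> ix z = ix (\<lambda>_. 0) \<and> sg z = 0"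

definition neg_free :: bool where
  "neg_free \<longleftrightarrow> (\<forall>z. zero_sum z \<longrightarrow> 0 \<le> cost z)"

lemma sg_le_total: "v \<in> multisets d \<Longrightarrow> \<bar>sg v\<bar> \<le> D * total d v"
  by (rule dot_le_total[OF _ sigma_le])

lemma ix_add_left: "ix (\<lambda>i. w i + u i) = ix (\<lambda>i. w i + v i) \<longleftrightarrow> ix u = ix v"
  using ix_add[of u w v] by (simp add: add.commute)

text \<open>Pigeonhole on the partial sums, which lie in only e(2W+1) states.\<close>
lemma repeated_state:
  assumes v: "v \<in> multisets d" "\<bar>sg v\<bar> \<le> W" "D \<le> W"
    and long: "e * (2 * W + 1) \<le> total d v - int lo"
  obtains z where "zero_sum z" "\<And>i. z i \<le> v i" "0 < total d z" "total d z \<le> total d v - int lo"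
    "(\<lambda>i. v i - z i) \<in> multisets d" "ix (\<lambda>i. v i - z i) = ix v"
proof -
  obtain L where L: "total d v = int L"
    using total_nonneg[OF v(1)] nonneg_int_cases by blast
  obtain p where p: "\<forall>k\<le>L. p k \<in> multisets d \<and> total d (p k) = int k \<and> \<bar>sg (p k)\<bar> \<le> W"
      "\<forall>a b i. a \<le> b \<longrightarrow> b \<le> L \<longrightarrow> p a i \<le> p b i" "p L = v"
    using chain[where f = \<sigma>, OF v(1) L v(2) sigma_le v(3)] by auto
  have W: "0 \<le> W" using v(2) by linarith
  let ?g = "\<lambda>k. (ix (p k), sg (p k))"
  have sub: "?g ` {lo..L} \<subseteq> {0..<e} \<times> {-W..W}"
    using p(1) ix_nonneg ix_less by (auto simp: abs_le_iff minus_le_iff)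
  have "card (?g ` {lo..L}) \<le> card ({0..<e} \<times> {-W..W})"
    by (rule card_mono[OF _ sub]) simp
  also have "\<dots> = nat (e * (2 * W + 1))"
    using W e_pos by (simp add: card_cartesian_product nat_mult_distrib add.commute)
  \<comment> \<open>The interval has \<open>L - lo + 1\<close> elements, so the weak inequality
    \<open>long\<close> already exceeds the number of states strictly.\<close>
  also have "\<dots> < card {lo..L}"
    using long L e_pos W by (simp add: nat_less_iff)
  finally have "\<not> inj_on ?g {lo..L}" by (rule pigeonhole)
  then obtain a b where ab: "a \<in> {lo..L}" "b \<in> {lo..L}" "a \<noteq> b" "?g a = ?g b"
    unfolding inj_on_def by auto
  then obtain a b where ab: "lo \<le> a" "a < b" "b \<le> L" "ix (p a) = ix (p b)" "sg (p a) = sg (p b)"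
    by (cases "a < b") (auto simp: not_less_iff_gr_or_eq)
  let ?z = "\<lambda>i. p b i - p a i"
  have mono: "p a i \<le> p b i" "p b i \<le> v i" for i
    using p(2)[rule_format, of a b i] p(2)[rule_format, of b L i] p(3) ab by auto
  have pm: "p a \<in> multisets d" "p b \<in> multisets d" using p(1) ab by auto
  have nn: "0 \<le> p a i" "0 \<le> p b i" for i using pm by (auto simp: multisets_def)
  have z: "?z \<in> multisets d" using pm mono(1) by (intro multisets_diff) auto
  have zs: "zero_sum ?z"
    using z ab ix_add_left[of "p a" ?z "\<lambda>_. 0"] by (simp add: zero_sum_def dot_simps)
  have le: "?z i \<le> v i" for i using mono(2)[of i] nn(1)[of i] by linarith
  have tot: "0 < total d ?z" "total d ?z \<le> total d v - int lo"
    using p(1)[rule_format, of a] p(1)[rule_format, of b] ab L by (auto simp: dot_simps)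
  have ixz: "ix (\<lambda>i. v i - ?z i) = ix v"
    using ix_add_left[of "\<lambda>i. v i - p b i" "p a" "p b"] ab(4) by (simp add: algebra_simps)
  show thesis
    by (rule that[OF zs le tot multisets_diff[OF v(1) z le] ixz])
qed

text \<open>Zero sums are cut out until the multiset is shorter than the number of states. Each cut
  preserves the state, and it cannot raise the cost if no zero sum is negative.\<close>

lemma short_representative:
  assumes "v \<in> multisets d" "\<bar>sg v\<bar> \<le> W" "D \<le> W"
  shows "\<exists>u\<in>multisets d. ix u = ix v \<and> sg u = sg v \<and> total d u \<le> e * (2 * W + 1) \<and>
    (neg_free \<longrightarrow> cost u \<le> cost v)"
  using assms(1,2)
proof (induction "nat (total d v)" arbitrary: v rule: less_induct)
  case less
  show ?case
  proof (cases "e * (2 * W + 1) \<le> total d v")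
    case True
    obtain z where z: "zero_sum z" "0 < total d z" "(\<lambda>i. v i - z i) \<in> multisets d"
        "ix (\<lambda>i. v i - z i) = ix v"
      using repeated_state[OF less.prems assms(3), of 0] True by auto
    let ?u = "\<lambda>i. v i - z i"
    have sz: "sg z = 0" using z by (simp add: zero_sum_def)
    have "nat (total d ?u) < nat (total d v)"
      using z(2) total_nonneg[OF z(3)] by (simp add: dot_simps)
    from less.hyps[OF this z(3)] less.prems sz
    obtain u where "u\<in>multisets d" "ix u = ix v" "sg u = sg v" "total d u \<le> e * (2 * W + 1)"
        "neg_free \<longrightarrow> cost u \<le> cost ?u"
      using z(4) by (auto simp: dot_simps)
    moreover have "neg_free \<longrightarrow> cost ?u \<le> cost v"
      using z(1) by (auto simp: neg_free_def dot_simps)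
    ultimately show ?thesis by (intro bexI[of _ u]) auto
  qed (use less.prems in auto)
qed

text \<open>A long zero sum splits into two shorter zero sums whose costs add up to its own, so one
  of them is negative again.\<close>

lemma short_negative:
  assumes "zero_sum z" "cost z < 0" "D \<le> W"
  shows "\<exists>z. zero_sum z \<and> cost z < 0 \<and> total d z \<le> e * (2 * W + 1)"
  using assms(1,2)
proof (induction "nat (total d z)" arbitrary: z rule: less_induct)
  case less
  have W: "0 \<le> W" using e_pos e_le_D assms(3) by linarith
  show ?case
  proof (cases "total d z \<le> e * (2 * W + 1)")
    case False
    have zm: "z \<in> multisets d" "\<bar>sg z\<bar> \<le> W" using less.prems W by (auto simp: zero_sum_def)
    \<comment> \<open>With \<open>lo = 1\<close> at least one generator stays outside
      \<open>u\<close>, so both parts are strictly shorter than \<open>z\<close>.\<close>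
    obtain u where u: "zero_sum u" "0 < total d u" "total d u \<le> total d z - 1"
        "(\<lambda>i. z i - u i) \<in> multisets d" "ix (\<lambda>i. z i - u i) = ix z"
      using repeated_state[OF zm assms(3), of 1] False by auto
    let ?w = "\<lambda>i. z i - u i"
    have w: "zero_sum ?w" using u less.prems by (auto simp: zero_sum_def dot_simps)
    have "cost u < 0 \<or> cost ?w < 0" using less.prems by (auto simp: dot_simps)
    then show ?thesis
    proof
      assume "cost u < 0"
      then show ?thesis using less.hyps[of u] u by simp
    next
      assume "cost ?w < 0"
      then show ?thesis using less.hyps[of ?w] u w by (simp add: dot_simps)
    qed
  qed (use less.prems in auto)
qed

text \<open>The quotient of the group of states by the k-th generator has order \<open>\<sigma> k\<close>: a fixed group
  index leaves one residue modulo e for the sum, so there are \<open>e * \<sigma> k\<close> states modulo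
  \<open>e * \<sigma> k\<close>, and the multiples of the k-th generator account for e of them.\<close>
lemma exchange_block:
  assumes M: "M \<in> multisets d" and k: "k < d" "0 < \<sigma> k" and long: "\<sigma> k \<le> total d M"
  obtains N t where "N \<in> multisets d" "\<And>i. N i \<le> M i" "0 < total d N" "sg N = t * \<sigma> k"
    "\<And>u. ix (\<lambda>i. u i - N i + t * unit_at k i) = ix u"
proof -
  define s where "s = \<sigma> k"
  have s: "0 < s" using k by (simp add: s_def)
  obtain L where L: "total d M = int L"
    using total_nonneg[OF M] nonneg_int_cases by blast
  have "1 \<le> total d M" using long s unfolding s_def by linarith
  then have DW: "D \<le> D * total d M"
    using mult_left_mono[of 1 "total d M" D] e_pos e_le_D by simp
  obtain p where p: "\<forall>k\<le>L. p k \<in> multisets d \<and> total d (p k) = int k"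
      "\<forall>a b i. a \<le> b \<longrightarrow> b \<le> L \<longrightarrow> p a i \<le> p b i" "p L = M"
    using chain[where f = \<sigma>, OF M L sg_le_total[OF M] sigma_le DW] by auto
  define q where "q = (\<lambda>(a, j) i. p a i + j * unit_at k i)"
  have sq: "sg (q (a, j)) = sg (p a) + j * s" for a j
    using k by (simp add: q_def dot_simps s_def)
  \<comment> \<open>The index already determines the sum modulo \<open>e\<close>. What is missing to
    know it modulo \<open>e * s\<close> is the quotient by \<open>e\<close>, which takes only
    \<open>s\<close> values.\<close>
  let ?g = "\<lambda>x. (ix (q x), sg (q x) mod (e * s) div e)"
  let ?A = "{..nat s} \<times> {0..<e}"
  have "0 \<le> x mod (e * s) div e \<and> x mod (e * s) div e < s" for x
  proof -
    let ?y = "x mod (e * s)"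
    have "0 < e * s" using e_pos s by simp
    then have y: "0 \<le> ?y" "?y < e * s" by auto
    have le: "?y div e * e \<le> ?y"
      using div_mult_mod_eq[of ?y e] pos_mod_sign[of e ?y] e_pos by linarith
    have "\<not> s \<le> ?y div e"
    proof
      assume "s \<le> ?y div e"
      then have "s * e \<le> ?y div e * e" using e_pos by (intro mult_right_mono) auto
      then show False using le y(2) by (simp only: mult.commute[of s e])
    qed
    then show ?thesis using y e_pos by (simp add: pos_imp_zdiv_nonneg_iff not_le)
  qed
  then have sub: "?g ` ?A \<subseteq> {0..<e} \<times> {0..<s}"
    using ix_nonneg ix_less by auto
  have "card (?g ` ?A) \<le> card ({0..<e} \<times> {0..<s})"
    by (rule card_mono[OF _ sub]) simp
  also have "\<dots> < card ?A" using e_pos s by (simp add: card_cartesian_product)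
  finally have "\<not> inj_on ?g ?A" by (rule pigeonhole)
  then obtain x y where xy: "x \<in> ?A" "y \<in> ?A" "x \<noteq> y" "?g x = ?g y"
    unfolding inj_on_def by blast
  have cong: "sg (q x) mod (e * s) = sg (q y) mod (e * s)"
  proof -
    have "e dvd sg (q x) - sg (q y)" using xy sigma_cong by simp
    then have "sg (q x) mod e = sg (q y) mod e" by (simp add: mod_eq_dvd_iff)
    then have "sg (q x) mod (e * s) mod e = sg (q y) mod (e * s) mod e"
      by (simp add: mod_mod_cancel)
    then show ?thesis using xy(4) by (metis div_mult_mod_eq prod.inject)
  qed
  \<comment> \<open>Two states with the same prefix would differ by fewer than \<open>e\<close>
    copies of the \<open>k\<close>-th generator, while equal sums modulo \<open>e * s\<close> force
    that number to be divisible by \<open>e\<close>.\<close>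
  have ne: "fst x \<noteq> fst y"
  proof
    assume eq: "fst x = fst y"
    obtain a j j' where x: "x = (a, j)" "y = (a, j')" using eq by (metis prod.collapse)
    have "e * s dvd (j - j') * s"
      using cong by (simp add: x sq mod_eq_dvd_iff left_diff_distrib)
    then have "e dvd j - j'" using s by simp
    moreover have "\<bar>j - j'\<bar> < e" using xy x by auto
    ultimately have "j = j'" using zdvd_imp_le[of e "\<bar>j - j'\<bar>"] by auto
    then show False using xy x by simp
  qed
  obtain x y where xy: "x \<in> ?A" "y \<in> ?A" "fst x < fst y" "ix (q x) = ix (q y)"
      "sg (q x) mod (e * s) = sg (q y) mod (e * s)"
  proof (cases "fst x < fst y")
    case False
    then show thesis using that[of y x] xy cong ne by auto
  qed (use that[of x y] xy cong in auto)
  obtain a j b j' where x: "x = (a, j)" and y: "y = (b, j')" by fastforce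
  have ab: "a < b" "b \<le> L" using xy x y long L unfolding s_def by auto
  have "e * s dvd sg (q y) - sg (q x)" using xy(5) by (metis mod_eq_dvd_iff)
  then obtain m where m: "sg (p b) + j' * s - (sg (p a) + j * s) = e * s * m"
    by (auto simp: x y sq dvd_def)
  \<comment> \<open>The sums agree only modulo \<open>e * s\<close>. Adding \<open>m * e\<close>
    copies of the \<open>k\<close>-th generator makes them agree exactly and, by torsion, does not
    move the class.\<close>
  let ?N = "\<lambda>i. p b i - p a i" and ?t = "j - j' + m * e"
  have mono: "p a i \<le> p b i" "p b i \<le> M i" for i
    using p(2)[rule_format, of a b i] p(2)[rule_format, of b L i] p(3) ab by auto
  have pm: "p a \<in> multisets d" "p b \<in> multisets d" using p(1) ab by auto
  have nn: "0 \<le> p a i" for i using pm by (auto simp: multisets_def)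
  show thesis
  proof (rule that[of ?N ?t])
    show "?N \<in> multisets d" using pm mono(1) by (intro multisets_diff) auto
    show "?N i \<le> M i" for i using mono(2)[of i] nn[of i] by linarith
    show "0 < total d ?N"
      using p(1)[rule_format, of a] p(1)[rule_format, of b] ab by (auto simp: dot_simps)
    show "sg ?N = ?t * \<sigma> k" using m by (simp add: dot_simps s_def algebra_simps)
    show "ix (\<lambda>i. u i - ?N i + ?t * unit_at k i) = ix u" for u
    proof -
      let ?r = "\<lambda>i. u i - p b i - j' * unit_at k i"
      have "ix (\<lambda>i. ?r i + q x i) = ix (\<lambda>i. ?r i + q y i)"
        by (rule iffD2[OF ix_add_left xy(4)])
      also have "(\<lambda>i. ?r i + q y i) = u" by (auto simp: y q_def)
      finally have "ix (\<lambda>i. ?r i + q x i) = ix u" .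
      moreover have "ix (\<lambda>i. (?r i + q x i) + e * (m * unit_at k i)) = ix (\<lambda>i. (?r i + q x i) + 0)"
        by (rule iffD2[OF ix_add_left ix_torsion])
      moreover have "(\<lambda>i. (?r i + q x i) + e * (m * unit_at k i)) = (\<lambda>i. u i - ?N i + ?t * unit_at k i)"
        by (rule ext) (simp add: x q_def algebra_simps)
      ultimately show ?thesis by simp
    qed
  qed
qed

text \<open>A sum above \<open>(\<sigma> k - 1) * D\<close> needs at least \<open>\<sigma> k\<close>
  generators, so a block exists. If its \<open>t\<close> is not positive, its own sum is not
  positive either; discarding it keeps the remaining sum above the threshold, and the search
  continues in a smaller multiset.\<close>

lemma positive_block:
  assumes "M \<in> multisets d" and k: "k < d" "0 < \<sigma> k" and "(\<sigma> k - 1) * D < sg M"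
  shows "\<exists>N t. N \<in> multisets d \<and> (\<forall>i. N i \<le> M i) \<and> 0 < t \<and> sg N = t * \<sigma> k \<and>
    (\<forall>u. ix (\<lambda>i. u i - N i + t * unit_at k i) = ix u)"
  using assms(1,4)
proof (induction "nat (total d M)" arbitrary: M rule: less_induct)
  case less
  have "\<sigma> k \<le> total d M"
  proof (rule ccontr)
    assume "\<not> ?thesis"
    then have "D * total d M \<le> D * (\<sigma> k - 1)"
      using e_pos e_le_D by (intro mult_left_mono) auto
    then show False using sg_le_total[OF less.prems(1)] less.prems(2)
      by (auto simp: mult.commute)
  qed
  then obtain N t where N: "N \<in> multisets d" "\<And>i. N i \<le> M i" "0 < total d N" "sg N = t * \<sigma> k"
      "\<And>u. ix (\<lambda>i. u i - N i + t * unit_at k i) = ix u"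
    using exchange_block[OF less.prems(1) k] by blast
  show ?case
  proof (cases "0 < t")
    case False
    let ?M = "\<lambda>i. M i - N i"
    have M: "?M \<in> multisets d" by (rule multisets_diff[OF less.prems(1) N(1,2)])
    have "t * \<sigma> k \<le> 0" using False k by (simp add: mult_nonpos_nonneg)
    then have "(\<sigma> k - 1) * D < sg ?M" using less.prems(2) N(4) by (simp add: dot_simps)
    moreover have "nat (total d ?M) < nat (total d M)"
      using N(3) total_nonneg[OF M] by (simp add: dot_simps)
    ultimately obtain N' t' where N': "N' \<in> multisets d" "\<forall>i. N' i \<le> M i - N i" "0 < t'"
        "sg N' = t' * \<sigma> k" "\<forall>u. ix (\<lambda>i. u i - N' i + t' * unit_at k i) = ix u"
      using less.hyps[OF _ M] by blast
    have "0 \<le> N i" for i using N(1) by (simp add: multisets_def)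
    then have "N' i \<le> M i" for i using N'(2)[rule_format, of i] order_trans[of "N' i"] by fastforce
    then show ?thesis using N' by blast
  qed (use N in blast)
qed

text \<open>As long as the \<open>k\<close>-th multiplicity is below \<open>T\<close>, the other
  generators keep a sum of at least \<open>\<sigma> k + D * D\<close>, so a positive block of them
  can be traded for copies of the \<open>k\<close>-th generator at the same class and sum. For the
  best ratio no trade raises the cost.\<close>

lemma exchange:
  assumes "v \<in> multisets d" and k: "k < d" "0 < \<sigma> k" and T: "T * \<sigma> k \<le> sg v - D * D"
  shows "\<exists>u\<in>multisets d. ix u = ix v \<and> sg u = sg v \<and> T \<le> u k \<and>
    ((\<forall>i<d. \<gamma> k * \<sigma> i \<le> \<gamma> i * \<sigma> k) \<longrightarrow> cost u \<le> cost v)"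
  using assms(1,4)
proof (induction "nat (T - v k)" arbitrary: v rule: less_induct)
  case less
  show ?case
  proof (cases "T \<le> v k")
    case False
    \<comment> \<open>The block is sought among the other generators, hence contains no copy of the
      \<open>k\<close>-th one, and the trade strictly increases that multiplicity.\<close>
    let ?M = "\<lambda>i. v i - v k * unit_at k i"
    have M: "?M \<in> multisets d" using less.prems(1) k by (auto simp: multisets_def unit_at_def)
    have "(v k + 1) * \<sigma> k \<le> T * \<sigma> k" using False k by (intro mult_right_mono) auto
    then have "\<sigma> k + D * D \<le> sg ?M"
      using less.prems(2) k by (simp add: dot_simps algebra_simps)
    moreover have "(\<sigma> k - 1) * D \<le> D * D"
      using sigma_le[OF k(1)] e_pos e_le_D by (intro mult_right_mono) auto
    ultimately have "(\<sigma> k - 1) * D < sg ?M" using k by linarith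
    then obtain N t where N: "N \<in> multisets d" "\<forall>i. N i \<le> ?M i" "0 < t" "sg N = t * \<sigma> k"
       "\<forall>u. ix (\<lambda>i. u i - N i + t * unit_at k i) = ix u"
      using positive_block[OF M k] by blast
    let ?u = "\<lambda>i. v i - N i + t * unit_at k i"
    have Nk: "N k = 0" using N(1) N(2)[rule_format, of k] by (simp add: multisets_def unit_at_def antisym)
    have Nle: "N i \<le> v i" for i
      using N(2)[rule_format, of i] less.prems(1)
      by (auto simp: unit_at_def multisets_def split: if_splits intro: order_trans[of _ 0])
    have u: "?u \<in> multisets d"
      using less.prems(1) N(1,3) Nle k by (auto simp: multisets_def unit_at_def)
    have su: "sg ?u = sg v" using N(4) k by (simp add: dot_simps)
    have "nat (T - ?u k) < nat (T - v k)" using N(3) Nk False by (simp add: unit_at_def)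
    from less.hyps[OF this u] obtain w where w: "w\<in>multisets d" "ix w = ix ?u" "sg w = sg ?u" "T \<le> w k"
        "(\<forall>i<d. \<gamma> k * \<sigma> i \<le> \<gamma> i * \<sigma> k) \<longrightarrow> cost w \<le> cost ?u"
      using less.prems(2) su by auto
    have "cost ?u \<le> cost v" if r: "\<forall>i<d. \<gamma> k * \<sigma> i \<le> \<gamma> i * \<sigma> k"
    proof -
      have "\<gamma> k * sg N \<le> \<sigma> k * cost N"
        unfolding dot_def sum_distrib_left
        using r N(1) by (intro sum_mono)
          (auto simp: multisets_def mult.assoc[symmetric] mult.commute[of "\<sigma> k"] intro!: mult_right_mono)
      then have "\<sigma> k * (\<gamma> k * t) \<le> \<sigma> k * cost N" using N(4) by (simp add: algebra_simps)
      then have "\<gamma> k * t \<le> cost N" using k by simp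
      then show ?thesis using k by (simp add: dot_simps mult.commute)
    qed
    then show ?thesis using w N(5) su by (intro bexI[of _ w]) auto
  qed (use less.prems in auto)
qed

text \<open>The best ratio is a dual solution: together with the k-th generator, a generator
  violating the inequality would form a zero sum of negative cost.\<close>
lemma min_ratio:
  assumes nf: neg_free and k: "k < d" "0 < \<sigma> k"
    and min: "\<And>i. i < d \<Longrightarrow> 0 < \<sigma> i \<Longrightarrow> \<gamma> k * \<sigma> i \<le> \<gamma> i * \<sigma> k" and i: "i < d"
  shows "\<gamma> k * \<sigma> i \<le> \<gamma> i * \<sigma> k"
proof (cases "0 < \<sigma> i")
  case False
  \<comment> \<open>The weights cancel the two values of \<sigma>; the factor \<open>e\<close> kills
    the class by torsion.\<close>
  let ?z = "\<lambda>j. e * (\<sigma> k * unit_at i j - \<sigma> i * unit_at k j)"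
  have "?z \<in> multisets d"
    using k i False e_pos by (auto simp: multisets_def unit_at_def)
  then have "zero_sum ?z"
    using k i ix_torsion by (simp add: zero_sum_def dot_simps)
  then have "0 \<le> cost ?z" using nf by (simp add: neg_free_def)
  then have "0 \<le> e * (\<sigma> k * \<gamma> i - \<sigma> i * \<gamma> k)" using k i by (simp add: dot_simps)
  then show ?thesis using e_pos by (simp add: zero_le_mult_iff algebra_simps)
qed (rule min[OF i])

end

section \<open>Slack vectors of the linear system\<close>

text \<open>If there is no row below the basis, the program reads zeros beyond the end of the array
  that holds H; then \<open>\<sigma>\<close> vanishes on the d generators, and both cases can be treated alike.\<close>
locale slack_system = lower_hnf n H for n H +
  fixes d :: nat and A :: "nat \<Rightarrow> nat \<Rightarrow> int" and c :: "nat \<Rightarrow> int" and D \<epsilon> :: int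
  assumes d: "d = n \<or> d = Suc n"
    and beyond: "d = n \<Longrightarrow> H n k = 0"
    and adjugate: "i < n \<Longrightarrow> j < n \<Longrightarrow> (\<Sum>k<n. H i k * A k j) = (if i = j then pivots n else 0)"
    and minor_le: "i < n \<Longrightarrow> \<bar>\<Sum>k<n. H n k * A k i\<bar> \<le> D"
    and pivots_le: "pivots n \<le> D"
    and sign: "\<epsilon> = 1 \<or> \<epsilon> = -1"
begin

definition w :: "nat \<Rightarrow> int" where
  "w i = (\<Sum>k<n. H n k * A k i)"

text \<open>The linear relation between the row below the basis and the basis rows, scaled by the
  pivot product. The sign \<epsilon> stays free so that the program can make the value at the
  right-hand side nonnegative.\<close>

definition \<sigma> :: "nat \<Rightarrow> int" where
  "\<sigma> i = \<epsilon> * (if i < n then w i else if i = n then - pivots n else 0)"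

text \<open>The objective expressed over the basis rows, times the pivot product: a point is
  determined by its basis slacks, hence the row below the basis has cost 0.\<close>

definition \<gamma> :: "nat \<Rightarrow> int" where
  "\<gamma> i = (if i < n then \<Sum>k<n. c k * A k i else 0)"

definition row :: "nat \<Rightarrow> (nat \<Rightarrow> int) \<Rightarrow> int" where
  "row i x = (\<Sum>j<n. H i j * x j)"

lemma row_adjugate: "i < n \<Longrightarrow> row i (\<lambda>j. \<Sum>l<n. A j l * v l) = pivots n * v i"
proof -
  assume i: "i < n"
  have "row i (\<lambda>j. \<Sum>l<n. A j l * v l) = (\<Sum>l<n. (\<Sum>j<n. H i j * A j l) * v l)"
    unfolding row_def sum_distrib_left sum_distrib_right
    by (subst sum.swap) (simp add: mult.assoc)
  also have "\<dots> = (\<Sum>l<n. if i = l then pivots n * v l else 0)"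
    using i by (intro sum.cong) (auto simp: adjugate)
  finally show ?thesis using i by simp
qed

text \<open>The locale only has the product of \<open>H\<close> with \<open>A\<close>. The product
  in the other order follows from uniqueness in the triangular system: both sides solve it for the
  right-hand side \<open>pivots n * z\<close>.\<close>

lemma adjugate_row:
  assumes z: "\<And>i. i < n \<Longrightarrow> z i = row i x" and k: "k < n"
  shows "(\<Sum>i<n. A k i * z i) = pivots n * x k"
proof -
  define v where "v = (\<lambda>i. pivots n * z i)"
  have 1: "v i = (\<Sum>j<n. H i j * (\<Sum>l<n. A j l * z l))" if "i < n" for i
    using row_adjugate[OF that, of z] by (simp add: v_def row_def)
  have 2: "v i = (\<Sum>j<n. H i j * (pivots n * x j))" if "i < n" for i
    using z[OF that] by (simp add: v_def row_def sum_distrib_left mult_ac)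
  have "quot v k = (\<Sum>l<n. A k l * z l)" by (rule quot_exact[OF 1 k])
  moreover have "quot v k = pivots n * x k" by (rule quot_exact[OF 2 k])
  ultimately show ?thesis by simp
qed

lemma functional_row:
  assumes z: "\<And>i. i < n \<Longrightarrow> z i = row i x"
  shows "(\<Sum>i<n. (\<Sum>k<n. f k * A k i) * z i) = pivots n * (\<Sum>k<n. f k * x k)"
proof -
  have "(\<Sum>i<n. (\<Sum>k<n. f k * A k i) * z i) = (\<Sum>k<n. f k * (\<Sum>i<n. A k i * z i))"
    unfolding sum_distrib_left sum_distrib_right by (subst sum.swap) (simp add: mult.assoc)
  also have "\<dots> = (\<Sum>k<n. f k * (pivots n * x k))"
    using adjugate_row[OF z] by (intro sum.cong) auto
  finally show ?thesis by (simp add: sum_distrib_left mult_ac)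
qed

lemma dot_sigma:
  assumes "\<And>i. i < n \<Longrightarrow> z i = row i x"
  shows "dot d \<sigma> z = (if d = n then 0 else \<epsilon> * pivots n * (row n x - z n))"
proof (cases "d = n")
  case True
  then show ?thesis by (simp add: dot_def \<sigma>_def w_def beyond)
next
  case False
  then have "d = Suc n" using d by simp
  then have "dot d \<sigma> z = \<epsilon> * (\<Sum>i<n. w i * z i) - \<epsilon> * pivots n * z n"
    by (simp add: dot_def \<sigma>_def sum_distrib_left mult_ac)
  also have "\<dots> = \<epsilon> * (pivots n * row n x) - \<epsilon> * pivots n * z n"
    using functional_row[OF assms, of "\<lambda>k. H n k"] by (simp add: w_def row_def)
  finally show ?thesis using False by (simp add: algebra_simps)
qed

lemma dot_gamma:
  assumes "\<And>i. i < n \<Longrightarrow> z i = row i x"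
  shows "dot d \<gamma> z = pivots n * dot n c x"
proof -
  have "dot d \<gamma> z = (\<Sum>i<n. (\<Sum>k<n. c k * A k i) * z i)"
    unfolding dot_def \<gamma>_def using d by (intro sum.mono_neutral_cong_right) auto
  then show ?thesis using functional_row[OF assms, of c] by (simp add: dot_def)
qed

lemma basis_lattice_row: "basis_lattice z \<longleftrightarrow> (\<exists>x. \<forall>i<n. z i = row i x)"
  by (simp add: basis_lattice_def row_def)

sublocale group_knapsack d "pivots n" D ix \<sigma> \<gamma>
proof
  show "1 \<le> pivots n" by (rule pivots_pos) simp
  show "pivots n \<le> D" by (rule pivots_le)
  show "0 \<le> ix v" "ix v < pivots n" for v by (fact ix_bounds)+
  show "ix (\<lambda>i. u i + w i) = ix (\<lambda>i. v i + w i) \<longleftrightarrow> ix u = ix v" for u v w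
    by (simp add: ix_eq_iff)
  show "ix (\<lambda>i. pivots n * v i) = ix (\<lambda>_. 0)" for v
    unfolding ix_eq_iff basis_lattice_row
    by (intro exI[of _ "\<lambda>j. \<Sum>l<n. A j l * v l"]) (simp add: row_adjugate)
  show "pivots n dvd dot d \<sigma> u - dot d \<sigma> v" if uv: "ix u = ix v" for u v
  proof -
    obtain x where "\<forall>i<n. u i - v i = row i x"
      using uv unfolding ix_eq_iff basis_lattice_row by auto
    then show ?thesis using dot_sigma[of "\<lambda>i. u i - v i" x]
      by (auto simp: dot_diff)
  qed
  show "\<bar>\<sigma> i\<bar> \<le> D" if "i < d" for i
    using that sign minor_le[of i] pivots_le pivots_pos[of n]
    by (auto simp: \<sigma>_def abs_mult w_def)
qed

section \<open>Slack vectors as an encoding of the feasible integer points\<close>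

definition feasible :: "(nat \<Rightarrow> int) \<Rightarrow> (nat \<Rightarrow> int) set" where
  "feasible b = {x. \<forall>i<d. row i x \<le> b i}"

definition slack :: "(nat \<Rightarrow> int) \<Rightarrow> (nat \<Rightarrow> int) \<Rightarrow> nat \<Rightarrow> int" where
  "slack b x i = (if i < d then b i - row i x else 0)"

definition slack_vectors :: "(nat \<Rightarrow> int) \<Rightarrow> (nat \<Rightarrow> int) set" where
  "slack_vectors b = {v \<in> multisets d. ix v = ix b \<and> sg v = sg b}"

lemma n_le_d: "n \<le> d" using d by auto

lemma row_diff: "row i (\<lambda>j. x j - y j) = row i x - row i y"
  by (simp add: row_def right_diff_distrib sum_subtractf)

lemma row_scale: "row i (\<lambda>j. t * x j) = t * row i x"
  by (simp add: row_def sum_distrib_left mult_ac)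

lemma slack_vector:
  assumes "x \<in> feasible b"
  shows "slack b x \<in> slack_vectors b" "cost (slack b x) = cost b - pivots n * dot n c x"
proof -
  have "ix b = ix (slack b x)"
    unfolding ix_eq_iff basis_lattice_row using n_le_d by (intro exI[of _ x]) (auto simp: slack_def)
  moreover have row: "b i - slack b x i = row i x" if "i < d" for i
    using that by (simp add: slack_def)
  moreover have "sg b - sg (slack b x) = 0"
    using dot_sigma[of "\<lambda>i. b i - slack b x i" x] row d by (auto simp: dot_diff)
  moreover have "slack b x \<in> multisets d"
    using assms by (auto simp: multisets_def slack_def feasible_def)
  ultimately show "slack b x \<in> slack_vectors b" by (simp add: slack_vectors_def)
  have "cost b - cost (slack b x) = pivots n * dot n c x"
    using dot_gamma[of "\<lambda>i. b i - slack b x i" x] row n_le_d by (simp add: dot_diff)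
  then show "cost (slack b x) = cost b - pivots n * dot n c x" by simp
qed

text \<open>Equal indices put \<open>b - v\<close> into the basis lattice, so the floors in
  \<open>quot\<close> are exact on the basis rows; equality of the values of \<sigma> then forces
  the equation of the row below the basis.\<close>

lemma slack_vector_solution:
  assumes v: "v \<in> slack_vectors b"
  defines "x \<equiv> quot (\<lambda>i. b i - v i)"
  shows "x \<in> feasible b" "pivots n * dot n c x = cost b - cost v" "\<And>i. i < d \<Longrightarrow> row i x = b i - v i"
proof -
  have "ix b = ix v" "sg b = sg v" "v \<in> multisets d" using v by (auto simp: slack_vectors_def)
  then obtain y where y: "\<And>i. i < n \<Longrightarrow> b i - v i = row i y"
    unfolding ix_eq_iff basis_lattice_row by auto
  have xy: "x j = y j" if "j < n" for j
    unfolding x_def using y that by (intro quot_exact) (auto simp: row_def)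
  have rxy: "row i x = row i y" for i unfolding row_def using xy by (intro sum.cong) auto
  have rown: "i < n \<Longrightarrow> b i - v i = row i x" for i using y rxy by simp
  show row: "row i x = b i - v i" if "i < d" for i
  proof (cases "i < n")
    case False
    then have "i = n" "d = Suc n" using that d by auto
    moreover have "dot d \<sigma> (\<lambda>i. b i - v i) = 0" using \<open>sg b = sg v\<close> by (simp add: dot_diff)
    ultimately show ?thesis
      using dot_sigma[of "\<lambda>i. b i - v i" x] rown sign pivots_pos[of n] by auto
  qed (use rown in simp)
  then show "x \<in> feasible b"
    using \<open>v \<in> multisets d\<close> by (auto simp: feasible_def multisets_def)
  show "pivots n * dot n c x = cost b - cost v"
    using dot_gamma[of "\<lambda>i. b i - v i" x] rown by (simp add: dot_diff)
qed

section \<open>Tightening one inequality without loss\<close>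

definition tightened :: "(nat \<Rightarrow> int) \<Rightarrow> nat \<Rightarrow> int \<Rightarrow> nat \<Rightarrow> int" where
  "tightened b k T i = b i - T * unit_at k i"

text \<open>The case \<open>T = 0\<close> stands for runs in which nothing is tightened, with
  \<open>k\<close> arbitrary. Ratios are compared only where \<sigma> is positive, as the program
  does; \<open>min_ratio\<close> supplies the rest when there is no negative zero sum.\<close>

definition tightening :: "(nat \<Rightarrow> int) \<Rightarrow> nat \<Rightarrow> int \<Rightarrow> bool" where
  "tightening b k T \<longleftrightarrow> T = 0 \<or> 0 \<le> T \<and> k < d \<and> 0 < \<sigma> k \<and> T * \<sigma> k \<le> sg b - D * D \<and>
     (\<forall>i<d. 0 < \<sigma> i \<longrightarrow> \<gamma> k * \<sigma> i \<le> \<gamma> i * \<sigma> k)"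

lemma tightened_feasible:
  assumes "tightening b k T"
  shows "feasible (tightened b k T) \<subseteq> feasible b"
proof -
  have "0 \<le> T" using assms by (auto simp: tightening_def)
  then have "tightened b k T i \<le> b i" for i by (simp add: tightened_def unit_at_def)
  then show ?thesis unfolding feasible_def by (blast intro: order_trans)
qed

text \<open>The exchange raises the slack of inequality \<open>k\<close> to at least
  \<open>T\<close>, and this amount can be taken off its right-hand side. If negative zero sums
  exist, only feasibility is transferred, which is all that the unbounded case asks for.\<close>

lemma tightened_dominates:
  assumes t: "tightening b k T" and x: "x \<in> feasible b"
  shows "\<exists>y\<in>feasible (tightened b k T). neg_free \<longrightarrow> dot n c x \<le> dot n c y"
proof (cases "T = 0")
  case True
  then have "tightened b k T = b" by (simp add: tightened_def[abs_def])
  then show ?thesis using x by auto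
next
  case False
  then have t: "0 \<le> T" "k < d" "0 < \<sigma> k" "T * \<sigma> k \<le> sg b - D * D"
      "\<And>i. i < d \<Longrightarrow> 0 < \<sigma> i \<Longrightarrow> \<gamma> k * \<sigma> i \<le> \<gamma> i * \<sigma> k"
    using t by (auto simp: tightening_def)
  have s: "slack b x \<in> multisets d" "ix (slack b x) = ix b" "sg (slack b x) = sg b"
    using slack_vector(1)[OF x] by (auto simp: slack_vectors_def)
  obtain u where u: "u \<in> multisets d" "ix u = ix b" "sg u = sg b" "T \<le> u k"
      "(\<forall>i<d. \<gamma> k * \<sigma> i \<le> \<gamma> i * \<sigma> k) \<longrightarrow> cost u \<le> cost (slack b x)"
    using exchange[OF s(1) t(2,3)] t(4) s by auto
  let ?v = "\<lambda>i. u i - T * unit_at k i"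
  have "?v \<in> multisets d" using u t by (auto simp: multisets_def unit_at_def)
  moreover have "ix ?v = ix (tightened b k T)"
    using u(2) ix_add[of u "\<lambda>i. - T * unit_at k i" b] by (simp add: tightened_def[abs_def])
  moreover have "sg ?v = sg (tightened b k T)"
    using u(3) by (simp add: tightened_def[abs_def] dot_simps)
  ultimately have v: "?v \<in> slack_vectors (tightened b k T)" by (simp add: slack_vectors_def)
  let ?y = "quot (\<lambda>i. tightened b k T i - ?v i)"
  have "dot n c x \<le> dot n c ?y" if neg_free
  proof -
    have "cost u \<le> cost (slack b x)" using u(5) min_ratio[OF that t(2,3,5)] by blast
    then have "pivots n * dot n c x \<le> pivots n * dot n c ?y"
      using slack_vector_solution(2)[OF v] slack_vector(2)[OF x]
      by (simp add: tightened_def[abs_def] dot_simps)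
    then show ?thesis using pivots_pos[of n] by simp
  qed
  then show ?thesis using slack_vector_solution(1)[OF v] by blast
qed

section \<open>Tables over the states and the answers they determine\<close>

definition slot :: "int \<Rightarrow> (nat \<Rightarrow> int) \<Rightarrow> int" where
  "slot W v = ix v * (2 * W + 1) + (sg v + W)"

definition slots :: "int \<Rightarrow> int" where
  "slots W = pivots n * (2 * W + 1)"

lemma slot_eq:
  assumes "\<bar>sg u\<bar> \<le> W" "\<bar>sg v\<bar> \<le> W" "slot W u = slot W v"
  shows "ix u = ix v" "sg u = sg v"
proof -
  have "slot W u div (2 * W + 1) = ix u \<and> slot W u mod (2 * W + 1) = sg u + W" if "\<bar>sg u\<bar> \<le> W" for u
    using that by (simp add: slot_def abs_le_iff)
  from this[OF assms(1)] this[OF assms(2)] show "ix u = ix v" "sg u = sg v"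
    using assms(3) by auto
qed

lemma slot_bounds:
  assumes "\<bar>sg v\<bar> \<le> W"
  shows "0 \<le> slot W v" "slot W v < slots W"
proof -
  have "(ix v + 1) * (2 * W + 1) \<le> slots W"
    unfolding slots_def using ix_less[of v] assms by (intro mult_right_mono) auto
  then show "slot W v < slots W" using assms by (simp add: slot_def algebra_simps)
  show "0 \<le> slot W v" using ix_nonneg[of v] assms by (auto simp: slot_def)
qed

definition reached :: "int \<Rightarrow> (int \<Rightarrow> int) \<Rightarrow> (int \<Rightarrow> int) \<Rightarrow> (nat \<Rightarrow> int) \<Rightarrow> bool" where
  "reached W F C v \<longleftrightarrow> 0 < F (slot W v) \<and> C (slot W v) \<le> cost v"

definition valid_entry :: "int \<Rightarrow> int \<Rightarrow> int \<Rightarrow> (nat \<Rightarrow> int) \<Rightarrow> bool" where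
  "valid_entry W q C v \<longleftrightarrow> v \<in> multisets d \<and> \<bar>sg v\<bar> \<le> W \<and> slot W v = q \<and> C = cost v"

text \<open>No minimality is claimed: a row may be longer than \<open>slots W\<close> and cheaper
  than all short multisets, as in-place updates produce it. Soundness of the entries and domination
  over the short multisets determine the answer.\<close>

definition closed_table :: "int \<Rightarrow> (int \<Rightarrow> int) \<Rightarrow> (int \<Rightarrow> int) \<Rightarrow> (int \<Rightarrow> nat \<Rightarrow> int) \<Rightarrow> bool" where
  "closed_table W F C Y \<longleftrightarrow>
     (\<forall>q. 0 \<le> q \<and> q < slots W \<and> 0 < F q \<longrightarrow> valid_entry W q (C q) (Y q)) \<and>
     (\<forall>v\<in>multisets d. \<bar>sg v\<bar> \<le> W \<and> total d v \<le> slots W \<longrightarrow> reached W F C v)"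

text \<open>The one situation in which a large value of \<sigma> cannot be reduced: there is no
  inequality to tighten, and nonnegative slacks cannot produce a positive value either.\<close>

lemma infeasible_nonpos_sigma:
  assumes "0 < sg b" "\<And>i. i < d \<Longrightarrow> \<sigma> i \<le> 0"
  shows "feasible b = {}"
proof (rule ccontr)
  assume "feasible b \<noteq> {}"
  then obtain x where x: "x \<in> feasible b" by blast
  have "sg (slack b x) \<le> 0" unfolding dot_def
    using slack_vector(1)[OF x] assms(2)
    by (intro sum_nonpos) (auto simp: slack_vectors_def multisets_def mult_nonpos_nonneg)
  then show False using slack_vector(1)[OF x] assms(1) by (simp add: slack_vectors_def)
qed

context
  fixes b b' k T W F C Y
  assumes tight: "tightening b k T" and b': "b' = tightened b k T"
    and W: "\<bar>sg b'\<bar> \<le> W" "D \<le> W" and table: "closed_table W F C Y"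
begin

lemma target_entry:
  assumes "0 < F (slot W b')"
  shows "Y (slot W b') \<in> slack_vectors b'" "C (slot W b') = cost (Y (slot W b'))"
  using table assms slot_bounds[OF W(1)] slot_eq[of "Y (slot W b')" W b'] W(1)
  by (auto simp: closed_table_def valid_entry_def slack_vectors_def)

lemma reached_slack:
  assumes "v \<in> slack_vectors b'"
  shows "0 < F (slot W b')" "neg_free \<Longrightarrow> C (slot W b') \<le> cost v"
proof -
  have v: "v \<in> multisets d" "\<bar>sg v\<bar> \<le> W" "ix v = ix b'" "sg v = sg b'"
    using assms W(1) by (auto simp: slack_vectors_def)
  obtain u where u: "u\<in>multisets d" "ix u = ix v" "sg u = sg v" "total d u \<le> slots W"
    "neg_free \<longrightarrow> cost u \<le> cost v"
    using short_representative[OF v(1,2) W(2)] by (auto simp: slots_def)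
  then have "reached W F C u" using table v by (auto simp: closed_table_def)
  moreover have "slot W u = slot W b'" using u v by (simp add: slot_def)
  ultimately show "0 < F (slot W b')" "neg_free \<Longrightarrow> C (slot W b') \<le> cost v"
    using u(5) by (auto simp: reached_def)
qed

lemma slot_zero: "slot W (\<lambda>_. 0) = W"
  by (simp add: slot_def dot_zero ix_zero)

lemma W_nonneg: "0 \<le> W"
  using W(2) pivots_le pivots_pos[of n] by simp

lemma zero_reached: "0 < F W"
proof -
  have "(\<lambda>_. 0) \<in> multisets d" by (simp add: multisets_def)
  moreover have "0 \<le> slots W" using W_nonneg pivots_pos[of n] by (simp add: slots_def)
  ultimately have "reached W F C (\<lambda>_. 0)"
    using table W_nonneg by (auto simp: closed_table_def dot_zero)
  then show ?thesis by (simp add: reached_def slot_zero)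
qed

text \<open>Slot \<open>W\<close> is the state of the empty multiset, index 0 and sum 0 shifted by
  \<open>W\<close>. Its entry is a zero sum, and by \<open>short_negative\<close> a negative zero
  sum shows up within the length that the table dominates.\<close>

lemma neg_free_iff: "neg_free \<longleftrightarrow> 0 \<le> C W"
proof
  assume nf: neg_free
  have "valid_entry W W (C W) (Y W)"
    using table zero_reached slot_bounds[of "\<lambda>_. 0" W] W_nonneg
    by (simp add: closed_table_def slot_zero dot_zero)
  then have "zero_sum (Y W)" "C W = cost (Y W)"
    using slot_eq[of "Y W" W "\<lambda>_. 0"] W_nonneg
    by (auto simp: valid_entry_def zero_sum_def slot_zero dot_zero)
  then show "0 \<le> C W" using nf by (simp add: neg_free_def)
next
  assume C: "0 \<le> C W"
  show neg_free
  proof (rule ccontr)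
    assume "\<not> neg_free"
    then obtain z where z: "zero_sum z" "cost z < 0" "total d z \<le> slots W"
      using short_negative[OF _ _ W(2)] unfolding neg_free_def slots_def by (meson not_le)
    then have "reached W F C z" using table W_nonneg by (auto simp: closed_table_def zero_sum_def)
    moreover have "slot W z = W"
      using z(1) by (simp add: zero_sum_def slot_def ix_zero)
    ultimately show False using z C by (simp add: reached_def)
  qed
qed

lemma answer_infeasible:
  assumes "\<not> 0 < F (slot W b')"
  shows "feasible b = {}"
proof (rule ccontr)
  assume "feasible b \<noteq> {}"
  then obtain x where "x \<in> feasible b'" using tightened_dominates[OF tight] b' by blast
  then show False using reached_slack(1)[OF slack_vector(1)] assms by simp
qed

lemma answer_unbounded:
  assumes "0 < F (slot W b')" "C W < 0"
  shows "\<exists>x\<in>feasible b. K < dot n c x"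
proof -
  obtain z where z: "zero_sum z" "cost z < 0"
    using assms(2) neg_free_iff by (auto simp: neg_free_def not_le)
  \<comment> \<open>Read as a right-hand side, \<open>z\<close> has the zero vector as a slack
    vector, so \<open>?u\<close> satisfies all its rows with equality. As \<open>z\<close> is
    nonnegative and has negative cost, subtracting \<open>?u\<close> from a point keeps it feasible
    and improves the objective.\<close>
  let ?x = "quot (\<lambda>i. b' i - Y (slot W b') i)" and ?u = "quot (\<lambda>i. z i - 0)"
  have "?x \<in> feasible b'" by (rule slack_vector_solution(1)[OF target_entry(1)[OF assms(1)]])
  moreover have "(\<lambda>_. 0) \<in> slack_vectors z"
    using z(1) by (simp add: zero_sum_def slack_vectors_def dot_zero multisets_def)
  then have u: "pivots n * dot n c ?u = cost z" "\<And>i. i < d \<Longrightarrow> row i ?u = z i"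
    using slack_vector_solution[of "\<lambda>_. 0" z] by (auto simp: dot_zero)
  have "\<not> 0 \<le> dot n c ?u"
  proof
    assume "0 \<le> dot n c ?u"
    then have "0 \<le> pivots n * dot n c ?u" using pivots_pos[of n] by simp
    then show False using u(1) z(2) by linarith
  qed
  then have "dot n c ?u < 0" by simp
  let ?t = "\<bar>K\<bar> + \<bar>dot n c ?x\<bar> + 1"
  let ?y = "\<lambda>j. ?x j - ?t * ?u j"
  have "row i ?y \<le> b' i" if "i < d" for i
  proof -
    have "0 \<le> z i" using z(1) by (simp add: zero_sum_def multisets_def)
    then have "0 \<le> ?t * z i" by simp
    moreover have "row i ?x \<le> b' i" using \<open>?x \<in> feasible b'\<close> that by (simp add: feasible_def)
    ultimately show ?thesis using u(2)[OF that] by (simp add: row_diff row_scale)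
  qed
  then have "?y \<in> feasible b'" by (simp add: feasible_def)
  then have "?y \<in> feasible b" using tightened_feasible[OF tight] b' by blast
  moreover have "K < dot n c ?y"
  proof -
    have "?t * dot n c ?u \<le> ?t * (-1)"
      using \<open>dot n c ?u < 0\<close> by (intro mult_left_mono) auto
    then show ?thesis by (simp add: dot_simps)
  qed
  ultimately show ?thesis by blast
qed

lemma answer_optimal:
  assumes "0 < F (slot W b')" "\<not> C W < 0"
  defines "x \<equiv> quot (\<lambda>i. b' i - Y (slot W b') i)"
  shows "x \<in> feasible b" "y \<in> feasible b \<Longrightarrow> dot n c y \<le> dot n c x"
proof -
  have nf: neg_free using assms(2) neg_free_iff by simp
  note Y = target_entry[OF assms(1)]
  have "x \<in> feasible b'" unfolding x_def by (rule slack_vector_solution(1)[OF Y(1)])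
  then show "x \<in> feasible b" using tightened_feasible[OF tight] b' by blast
  show "dot n c y \<le> dot n c x" if y: "y \<in> feasible b"
  proof -
    obtain z where z: "z \<in> feasible b'" "dot n c y \<le> dot n c z"
      using tightened_dominates[OF tight y] nf b' by blast
    have "cost (Y (slot W b')) \<le> cost (slack b' z)"
      using reached_slack(2)[OF slack_vector(1)[OF z(1)] nf] Y(2) by simp
    then have "pivots n * dot n c z \<le> pivots n * dot n c x"
      using slack_vector(2)[OF z(1)] slack_vector_solution(2)[OF Y(1)] by (simp add: x_def)
    then show ?thesis using z(2) pivots_pos[of n] by simp
  qed
qed

end
end

section \<open>Running times of programs\<close>

text \<open>
  The degrees of an invariant of the run: the entries of the k-th plain array stay below
  \<open>N ^ env k\<close>, those of the k-th right-hand side array below \<open>NR ^ renv k\<close>, for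
  numbers \<open>N\<close> and \<open>NR\<close> whose bit sizes are linear in the size of the plain input and of
  the whole input, respectively.
\<close>

definition env :: "nat \<Rightarrow> nat" where
  "env k = (if k < 27 then [1,3,1,1,1,1,1,3,6,4,1,1,1,8,1,6,6,1,7,9,5,8,1,0,24,14,15] ! k else 0)"

definition renv :: "nat \<Rightarrow> nat" where
  "renv k = (if k < 6 then [4,18,16,18,3,4] ! k else 0)"

text \<open>A sum raises the exponent by one because the base absorbs the factor 2. A quotient is
  bounded by its dividend and a remainder by its modulus; the latter is how numbers derived from b
  return to plain exponents.\<close>

primrec adeg :: "aexp \<Rightarrow> nat" and rdeg :: "rexp \<Rightarrow> nat" where
  "adeg (Num x) = (if \<bar>x\<bar> \<le> 1 then 0 else 1)"
| "adeg (Ld k a) = env k"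
| "adeg (Add a a') = Suc (max (adeg a) (adeg a'))"
| "adeg (Sub a a') = Suc (max (adeg a) (adeg a'))"
| "adeg (Mul a a') = adeg a + adeg a'"
| "adeg (Div a a') = adeg a"
| "adeg (RMod r a) = adeg a"
| "rdeg (RInt a) = adeg a"
| "rdeg (RLd k a) = renv k"
| "rdeg (RAdd r r') = Suc (max (rdeg r) (rdeg r'))"
| "rdeg (RSub r r') = Suc (max (rdeg r) (rdeg r'))"
| "rdeg (RMul a r) = adeg a + rdeg r"
| "rdeg (RDiv r a) = rdeg r"

text \<open>60 is the common cap at which the machine bounds bit sizes; literals up to 9 fit below a
  base of at least 10.\<close>

primrec awf :: "aexp \<Rightarrow> bool" and rwf :: "rexp \<Rightarrow> bool" where
  "awf (Num x) \<longleftrightarrow> \<bar>x\<bar> \<le> 9"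
| "awf (Ld k a) \<longleftrightarrow> awf a \<and> env k \<le> 60"
| "awf (Add a a') \<longleftrightarrow> awf a \<and> awf a' \<and> adeg (Add a a') \<le> 60"
| "awf (Sub a a') \<longleftrightarrow> awf a \<and> awf a' \<and> adeg (Sub a a') \<le> 60"
| "awf (Mul a a') \<longleftrightarrow> awf a \<and> awf a' \<and> adeg (Mul a a') \<le> 60"
| "awf (Div a a') \<longleftrightarrow> awf a \<and> awf a'"
| "awf (RMod r a) \<longleftrightarrow> rwf r \<and> awf a"
| "rwf (RInt a) \<longleftrightarrow> awf a"
| "rwf (RLd k a) \<longleftrightarrow> awf a \<and> renv k \<le> 60"
| "rwf (RAdd r r') \<longleftrightarrow> rwf r \<and> rwf r' \<and> rdeg (RAdd r r') \<le> 60"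
| "rwf (RSub r r') \<longleftrightarrow> rwf r \<and> rwf r' \<and> rdeg (RSub r r') \<le> 60"
| "rwf (RMul a r) \<longleftrightarrow> awf a \<and> rwf r \<and> rdeg (RMul a r) \<le> 60"
| "rwf (RDiv r a) \<longleftrightarrow> rwf r \<and> awf a"

primrec anodes :: "aexp \<Rightarrow> nat" and rnodes :: "rexp \<Rightarrow> nat" where
  "anodes (Num x) = 1"
| "anodes (Ld k a) = anodes a + 1"
| "anodes (Add a a') = anodes a + anodes a' + 1"
| "anodes (Sub a a') = anodes a + anodes a' + 1"
| "anodes (Mul a a') = anodes a + anodes a' + 1"
| "anodes (Div a a') = anodes a + anodes a' + 1"
| "anodes (RMod r a) = rnodes r + anodes a + 1"
| "rnodes (RInt a) = anodes a + 1"
| "rnodes (RLd k a) = anodes a + 1"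
| "rnodes (RAdd r r') = rnodes r + rnodes r' + 1"
| "rnodes (RSub r r') = rnodes r + rnodes r' + 1"
| "rnodes (RMul a r) = anodes a + rnodes r + 1"
| "rnodes (RDiv r a) = rnodes r + anodes a + 1"

primrec bwf :: "bexp \<Rightarrow> bool" where
  "bwf (Less a a') \<longleftrightarrow> awf a \<and> awf a'"
| "bwf (RLess r r') \<longleftrightarrow> rwf r \<and> rwf r'"
| "bwf (Neg e) \<longleftrightarrow> bwf e"
| "bwf (Conj e e') \<longleftrightarrow> bwf e \<and> bwf e'"

primrec bnodes :: "bexp \<Rightarrow> nat" where
  "bnodes (Less a a') = anodes a + anodes a' + 1"
| "bnodes (RLess r r') = rnodes r + rnodes r' + 1"
| "bnodes (Neg e) = bnodes e + 1"
| "bnodes (Conj e e') = bnodes e + bnodes e' + 1"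

primrec writes :: "com \<Rightarrow> nat set" where
  "writes Skip = {}"
| "writes (Store k a e) = {k}"
| "writes (RStore k a r) = {}"
| "writes (Seq p q) = writes p \<union> writes q"
| "writes (Cond e p q) = writes p \<union> writes q"
| "writes (While e p) = writes p"

primrec rwrites :: "com \<Rightarrow> nat set" where
  "rwrites Skip = {}"
| "rwrites (Store k a e) = {}"
| "rwrites (RStore k a r) = {k}"
| "rwrites (Seq p q) = rwrites p \<union> rwrites q"
| "rwrites (Cond e p q) = rwrites p \<union> rwrites q"
| "rwrites (While e p) = rwrites p"

lemma exec_frame:
  assumes "exec mul rsz p s s' t"
  shows "k \<notin> writes p \<Longrightarrow> fst s' k = fst s k" "k \<notin> rwrites p \<Longrightarrow> snd s' k = snd s k"
  using assms by (induction) auto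

definition st :: "nat \<Rightarrow> int \<Rightarrow> int \<Rightarrow> state \<Rightarrow> state" where
  "st k i x s = ((fst s)(k := (fst s k)(i := x)), snd s)"

definition rst :: "nat \<Rightarrow> int \<Rightarrow> int \<Rightarrow> state \<Rightarrow> state" where
  "rst k i x s = (fst s, (snd s)(k := (snd s k)(i := x)))"

lemma st_simps [simp]:
  "fst (st k i x s) k' = (if k' = k then (fst s k)(i := x) else fst s k')"
  "snd (st k i x s) = snd s"
  "fst (rst k i x s) = fst s"
  "snd (rst k i x s) k' = (if k' = k then (snd s k)(i := x) else snd s k')"
  by (auto simp: st_def rst_def)

lemma abs_mod_le: "b \<noteq> 0 \<Longrightarrow> \<bar>a mod b\<bar> \<le> \<bar>b\<bar>" for a b :: int
  by (rule order_less_imp_le) (rule abs_mod_less)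

section \<open>Size invariant and a calculus of total correctness with step counts\<close>

locale machine =
  fixes mul :: "nat \<Rightarrow> real" and N NR :: int and B0 B1 :: nat
  assumes mul_mono: "mono mul" and mul_linear: "real k \<le> mul k"
    and N_ge: "10 \<le> N" and N_le_NR: "N \<le> NR"
    and size_N: "\<bar>x\<bar> \<le> N ^ 60 \<Longrightarrow> isize x \<le> B0"
    and size_NR: "\<bar>x\<bar> \<le> NR ^ 60 \<Longrightarrow> isize x \<le> B1"
begin

definition bounded :: "state \<Rightarrow> bool" where
  "bounded s \<longleftrightarrow> (\<forall>k i. \<bar>fst s k i\<bar> \<le> N ^ env k) \<and> (\<forall>k i. \<bar>snd s k i\<bar> \<le> NR ^ renv k)"

lemma N_power_mono: "a \<le> b \<Longrightarrow> N ^ a \<le> N ^ b"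
  using N_ge by (intro power_increasing) auto

lemma NR_power_mono: "a \<le> b \<Longrightarrow> NR ^ a \<le> NR ^ b"
  using N_ge N_le_NR by (intro power_increasing) auto

lemma N_power_le_NR: "N ^ a \<le> NR ^ a"
  using N_ge N_le_NR by (intro power_mono) auto

lemma add_degree:
  fixes M x y :: int
  assumes "2 \<le> M" "\<bar>x\<bar> \<le> M ^ a" "\<bar>y\<bar> \<le> M ^ b"
  shows "\<bar>x\<bar> + \<bar>y\<bar> \<le> M ^ Suc (max a b)"
proof -
  have "M ^ a \<le> M ^ max a b" "M ^ b \<le> M ^ max a b"
    using assms(1) by (auto intro!: power_increasing)
  then have "\<bar>x\<bar> + \<bar>y\<bar> \<le> 2 * M ^ max a b" using assms by linarith
  also have "\<dots> \<le> M * M ^ max a b" using assms(1) by (intro mult_right_mono) auto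
  finally show ?thesis by simp
qed

lemma mult_degree:
  fixes M x y :: int
  assumes "\<bar>x\<bar> \<le> M ^ a" "\<bar>y\<bar> \<le> M ^ b"
  shows "\<bar>x * y\<bar> \<le> M ^ (a + b)"
  unfolding abs_mult power_add using assms by (intro mult_mono) auto

lemma value_degree:
  assumes b: "bounded s"
  shows "awf a \<Longrightarrow> \<bar>aval a s\<bar> \<le> N ^ adeg a" "rwf r \<Longrightarrow> \<bar>rval r s\<bar> \<le> NR ^ rdeg r"
proof (induction a and r)
  have N2: "2 \<le> N" "2 \<le> NR" using N_ge N_le_NR by auto
  {
    case (Num x)
    then show ?case using N_ge by auto
  next
    case (Ld k a)
    then show ?case using b by (simp add: bounded_def)
  next
    case (Add a a')
    then show ?case
      using add_degree[OF N2(1), of "aval a s" "adeg a" "aval a' s" "adeg a'"]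
      by (auto intro: order_trans[OF abs_triangle_ineq])
  next
    case (Sub a a')
    then show ?case
      using add_degree[OF N2(1), of "aval a s" "adeg a" "aval a' s" "adeg a'"]
      by (auto intro: order_trans[OF abs_triangle_ineq4])
  next
    case (Mul a a')
    then show ?case by (auto intro: mult_degree)
  next
    case (Div a a')
    then show ?case by (auto intro: order_trans[OF abs_div_le_abs])
  next
    case (RMod r a)
    then show ?case using N_ge by (auto intro: order_trans[OF abs_mod_le])
  next
    case (RInt a)
    then show ?case using order_trans[OF _ N_power_le_NR] by auto
  next
    case (RLd k a)
    then show ?case using b by (simp add: bounded_def)
  next
    case (RAdd r r')
    then show ?case
      using add_degree[OF N2(2), of "rval r s" "rdeg r" "rval r' s" "rdeg r'"]
      by (auto intro: order_trans[OF abs_triangle_ineq])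
  next
    case (RSub r r')
    then show ?case
      using add_degree[OF N2(2), of "rval r s" "rdeg r" "rval r' s" "rdeg r'"]
      by (auto intro: order_trans[OF abs_triangle_ineq4])
  next
    case (RMul a r)
    then have "\<bar>aval a s\<bar> \<le> NR ^ adeg a" using order_trans[OF _ N_power_le_NR] by auto
    then show ?case using RMul by (auto intro: mult_degree)
  next
    case (RDiv r a)
    then show ?case by (auto intro: order_trans[OF abs_div_le_abs])
  }
qed

lemma wf_degree: "awf a \<Longrightarrow> adeg a \<le> 60" "rwf r \<Longrightarrow> rdeg r \<le> 60"
  by (induction a and r) auto

lemma isize_value: "bounded s \<Longrightarrow> awf a \<Longrightarrow> isize (aval a s) \<le> B0"
  using value_degree(1) wf_degree(1) N_power_mono size_N order_trans by meson

text \<open>The two ways of charging right-hand side numbers are treated at once: both bound the charge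
  by some B, of which every plain number occurring in the run respects the bound as well.\<close>

definition charges :: "(int \<Rightarrow> nat) \<Rightarrow> nat \<Rightarrow> bool" where
  "charges rsz B \<longleftrightarrow> B0 \<le> B \<and> (\<forall>x. \<bar>x\<bar> \<le> NR ^ 60 \<longrightarrow> rsz x \<le> B)"

context
  fixes rsz B s
  assumes ch: "charges rsz B" and b: "bounded s"
begin

lemma charge_plain: "awf a \<Longrightarrow> real (isize (aval a s)) \<le> mul B"
  using isize_value[OF b, of a] ch mul_linear[of B] by (simp add: charges_def)

lemma size_rhs: "rwf r \<Longrightarrow> rsz (rval r s) \<le> B"
  using value_degree(2)[OF b] wf_degree(2) NR_power_mono ch order_trans
  unfolding charges_def by meson

lemma charge_rhs: "rwf r \<Longrightarrow> real (rsz (rval r s)) \<le> mul B"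
  using size_rhs[of r] mul_linear[of B] by simp

lemma one_le_mul: "1 \<le> mul B"
proof -
  have "isize 0 \<le> B0" using size_N[of 0] N_ge by simp
  then have "1 \<le> B" using ch by (simp add: isize_def charges_def)
  then show ?thesis using mul_linear[of B] by simp
qed

lemma mul_charge: "i \<le> B \<Longrightarrow> j \<le> B \<Longrightarrow> mul (max i j) \<le> mul B"
  using mul_mono by (simp add: mono_def)

text \<open>A node adds one multiplication charge or at most three charges for sizes and constants.
  Each is at most \<open>mul B\<close>, since \<open>mul\<close> is at least linear and
  \<open>B\<close> is positive.\<close>

lemma expression_cost:
  "awf a \<Longrightarrow> acost mul rsz a s \<le> real (anodes a) * (3 * mul B)"
  "rwf r \<Longrightarrow> rcost mul rsz r s \<le> real (rnodes r) * (3 * mul B)"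
proof (induction a and r)
  note c = charge_plain charge_rhs one_le_mul
  have B0: "B0 \<le> B" using ch by (simp add: charges_def)
  note m = mul_charge[OF order_trans[OF isize_value[OF b] B0] order_trans[OF isize_value[OF b] B0]]
    mul_charge[OF size_rhs order_trans[OF isize_value[OF b] B0]]
    mul_charge[OF order_trans[OF isize_value[OF b] B0] size_rhs]
  {
    case (Num x)
    then show ?case using c(1)[of "Num x"] c(3) by simp
  next
    case (Ld k a)
    then show ?case using c(1)[of a] c(1)[of "Ld k a"] c(3) by (simp add: algebra_simps)
  next
    case (Add a a')
    then show ?case using c(1)[of a] c(1)[of a'] c(3) by (simp add: algebra_simps)
  next
    case (Sub a a')
    then show ?case using c(1)[of a] c(1)[of a'] c(3) by (simp add: algebra_simps)
  next
    case (Mul a a')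
    then show ?case using m(1)[of a a'] c(3) by (simp add: algebra_simps)
  next
    case (Div a a')
    then show ?case using m(1)[of a a'] c(3) by (simp add: algebra_simps)
  next
    case (RMod r a)
    then show ?case using m(2)[of r a] c(3) by (simp add: algebra_simps)
  next
    case (RInt a)
    then show ?case using c(1)[of a] c(3) by (simp add: algebra_simps)
  next
    case (RLd k a)
    then show ?case using c(1)[of a] c(2)[of "RLd k a"] c(3) by (simp add: algebra_simps)
  next
    case (RAdd r r')
    then show ?case using c(2)[of r] c(2)[of r'] c(3) by (simp add: algebra_simps)
  next
    case (RSub r r')
    then show ?case using c(2)[of r] c(2)[of r'] c(3) by (simp add: algebra_simps)
  next
    case (RMul a r)
    then show ?case using m(3)[of a r] c(3) by (simp add: algebra_simps)
  next
    case (RDiv r a)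
    then show ?case using m(2)[of r a] c(3) by (simp add: algebra_simps)
  }
qed

lemma bool_cost: "bwf e \<Longrightarrow> bcost mul rsz e s \<le> real (bnodes e) * (3 * mul B)"
proof (induction e)
  case (Less a a')
  then show ?case
    using charge_plain[of a] charge_plain[of a'] one_le_mul expression_cost(1)[of a] expression_cost(1)[of a']
    by (simp add: algebra_simps)
next
  case (RLess r r')
  then show ?case
    using charge_rhs[of r] charge_rhs[of r'] one_le_mul expression_cost(2)[of r] expression_cost(2)[of r']
    by (simp add: algebra_simps)
qed (use one_le_mul in \<open>auto simp: algebra_simps\<close>)

end

text \<open>Quantifying over the charges inside gives one step count and one final state for both
  ways of charging; pricing a step is left to the end.\<close>

definition runs :: "com \<Rightarrow> state \<Rightarrow> state \<Rightarrow> nat \<Rightarrow> bool" where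
  "runs p s s' c \<longleftrightarrow> (\<forall>rsz B. charges rsz B \<longrightarrow>
     (\<exists>t. exec mul rsz p s s' t \<and> t \<le> real c * (3 * mul B)))"

text \<open>Total correctness: a terminating run into a bounded state exists. Boundedness travels
  with the triple and does not burden the postconditions.\<close>

definition triple :: "com \<Rightarrow> state \<Rightarrow> (state \<Rightarrow> nat \<Rightarrow> bool) \<Rightarrow> bool" where
  "triple p s Q \<longleftrightarrow> (bounded s \<longrightarrow> (\<exists>s' c. bounded s' \<and> runs p s s' c \<and> Q s' c))"

lemma tripleI: "(bounded s \<Longrightarrow> \<exists>s' c. bounded s' \<and> runs p s s' c \<and> Q s' c) \<Longrightarrow> triple p s Q"
  by (simp add: triple_def)

lemma triple_bounded: "(bounded s \<Longrightarrow> triple p s Q) \<Longrightarrow> triple p s Q"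
  by (simp add: triple_def)

text \<open>An admissible charge exists, so \<open>runs\<close> always yields an actual execution,
  to which the frame property applies.\<close>

lemma charges_0: "charges (\<lambda>_. 0) B0"
  by (simp add: charges_def)

lemma runs_frame:
  assumes "runs p s s' c"
  shows "k \<notin> writes p \<Longrightarrow> fst s' k = fst s k" "k \<notin> rwrites p \<Longrightarrow> snd s' k = snd s k"
  using assms charges_0 exec_frame unfolding runs_def by blast+

text \<open>The consequence rule also hands over the frame: facts on arrays that the program does
  not write need not be repeated in its postcondition.\<close>

lemma triple_mono:
  assumes "triple p s Q"
    and "\<And>s' c. Q s' c \<Longrightarrow> bounded s' \<Longrightarrow> \<forall>k. k \<notin> writes p \<longrightarrow> fst s' k = fst s k \<Longrightarrow>
      \<forall>k. k \<notin> rwrites p \<longrightarrow> snd s' k = snd s k \<Longrightarrow> R s' c"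
  shows "triple p s R"
  using assms runs_frame unfolding triple_def by meson

lemma triple_Skip: "Q s 1 \<Longrightarrow> triple Skip s Q"
proof (rule tripleI)
  assume "Q s 1" "bounded s"
  have "runs Skip s s 1" unfolding runs_def
  proof (intro allI impI)
    fix rsz B assume "charges rsz B"
    then have "1 \<le> mul B" using \<open>bounded s\<close> by (rule one_le_mul)
    then show "\<exists>t. exec mul rsz Skip s s t \<and> t \<le> real 1 * (3 * mul B)"
      by (intro exI[of _ 1]) (auto intro: exec.Skip)
  qed
  then show "\<exists>s' c. bounded s' \<and> runs Skip s s' c \<and> Q s' c"
    using \<open>Q s 1\<close> \<open>bounded s\<close> by blast
qed

text \<open>The size condition is semantic, for accumulators whose expression has a larger degree
  than their array; \<open>triple_Store_degree\<close> reads it off the expression.\<close>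

lemma triple_Store:
  assumes "awf a" "awf e" "bounded s \<Longrightarrow> \<bar>aval e s\<bar> \<le> N ^ env k"
    and "Q (st k (aval a s) (aval e s) s) (anodes a + anodes e + 1)"
  shows "triple (Store k a e) s Q"
proof (rule tripleI)
  assume b: "bounded s"
  let ?s = "st k (aval a s) (aval e s) s"
  have "bounded ?s" using b assms(3) by (auto simp: bounded_def)
  moreover have "runs (Store k a e) s ?s (anodes a + anodes e + 1)"
    unfolding runs_def
  proof (intro allI impI)
    fix rsz B assume ch: "charges rsz B"
    note e = expression_cost(1)[OF ch b] charge_plain[OF ch b] one_le_mul[OF ch b]
    show "\<exists>t. exec mul rsz (Store k a e) s ?s t \<and> t \<le> real (anodes a + anodes e + 1) * (3 * mul B)"
      using e(1)[OF assms(1)] e(1)[OF assms(2)] e(2)[OF assms(1)] e(2)[OF assms(2)] e(3)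
        exec.Store[of mul rsz k a e s]
      by (intro exI conjI) (auto simp: st_def algebra_simps)
  qed
  ultimately show "\<exists>s' c. bounded s' \<and> runs (Store k a e) s s' c \<and> Q s' c" using assms(4) by blast
qed

lemma triple_RStore:
  assumes "awf a" "rwf r" "bounded s \<Longrightarrow> \<bar>rval r s\<bar> \<le> NR ^ renv k"
    and "Q (rst k (aval a s) (rval r s) s) (anodes a + rnodes r + 1)"
  shows "triple (RStore k a r) s Q"
proof (rule tripleI)
  assume b: "bounded s"
  let ?s = "rst k (aval a s) (rval r s) s"
  have "bounded ?s" using b assms(3) by (auto simp: bounded_def)
  moreover have "runs (RStore k a r) s ?s (anodes a + rnodes r + 1)"
    unfolding runs_def
  proof (intro allI impI)
    fix rsz B assume ch: "charges rsz B"
    note e = expression_cost[OF ch b] charge_plain[OF ch b] charge_rhs[OF ch b] one_le_mul[OF ch b]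
    show "\<exists>t. exec mul rsz (RStore k a r) s ?s t \<and> t \<le> real (anodes a + rnodes r + 1) * (3 * mul B)"
      using e(1)[OF assms(1)] e(2)[OF assms(2)] e(3)[OF assms(1)] e(4)[OF assms(2)] e(5)
        exec.RStore[of mul rsz k a r s]
      by (intro exI conjI) (auto simp: rst_def algebra_simps)
  qed
  ultimately show "\<exists>s' c. bounded s' \<and> runs (RStore k a r) s s' c \<and> Q s' c" using assms(4) by blast
qed

lemma triple_Store_degree:
  assumes "awf a" "awf e" "adeg e \<le> env k"
    and "Q (st k (aval a s) (aval e s) s) (anodes a + anodes e + 1)"
  shows "triple (Store k a e) s Q"
  using assms value_degree(1) N_power_mono order_trans by (intro triple_Store) blast+

lemma triple_RStore_degree:
  assumes "awf a" "rwf r" "rdeg r \<le> renv k"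
    and "Q (rst k (aval a s) (rval r s) s) (anodes a + rnodes r + 1)"
  shows "triple (RStore k a r) s Q"
  using assms value_degree(2) NR_power_mono order_trans by (intro triple_RStore) blast+

lemma runs_Seq: "runs p s s' c \<Longrightarrow> runs q s' s'' c' \<Longrightarrow> runs (Seq p q) s s'' (c + c')"
  unfolding runs_def by (force intro: exec.Seq simp: distrib_right)

lemma triple_Seq: "triple p s (\<lambda>s' c. triple q s' (\<lambda>s'' c'. Q s'' (c + c'))) \<Longrightarrow> triple (Seq p q) s Q"
  unfolding triple_def using runs_Seq by blast

lemma runs_CondTrue:
  assumes "bwf e" "bounded s" "bval e s" "runs p s s' c"
  shows "runs (Cond e p q) s s' (bnodes e + 1 + c)"
  unfolding runs_def
proof (intro allI impI)
  fix rsz B assume ch: "charges rsz B"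
  obtain t where t: "exec mul rsz p s s' t" "t \<le> real c * (3 * mul B)"
    using assms(4) ch by (auto simp: runs_def)
  then show "\<exists>t. exec mul rsz (Cond e p q) s s' t \<and> t \<le> real (bnodes e + 1 + c) * (3 * mul B)"
    using exec.CondTrue[where q = q, OF assms(3) t(1)] bool_cost[OF ch assms(2,1)] one_le_mul[OF ch assms(2)]
    by (intro exI conjI) (auto simp: algebra_simps)
qed

lemma runs_CondFalse:
  assumes "bwf e" "bounded s" "\<not> bval e s" "runs q s s' c"
  shows "runs (Cond e p q) s s' (bnodes e + 1 + c)"
  unfolding runs_def
proof (intro allI impI)
  fix rsz B assume ch: "charges rsz B"
  obtain t where t: "exec mul rsz q s s' t" "t \<le> real c * (3 * mul B)"
    using assms(4) ch by (auto simp: runs_def)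
  then show "\<exists>t. exec mul rsz (Cond e p q) s s' t \<and> t \<le> real (bnodes e + 1 + c) * (3 * mul B)"
    using exec.CondFalse[where p = p, OF assms(3) t(1)] bool_cost[OF ch assms(2,1)] one_le_mul[OF ch assms(2)]
    by (intro exI conjI) (auto simp: algebra_simps)
qed

lemma triple_Cond:
  assumes "bwf e" "bval e s \<Longrightarrow> triple p s (\<lambda>s' c. Q s' (bnodes e + 1 + c))"
    "\<not> bval e s \<Longrightarrow> triple q s (\<lambda>s' c. Q s' (bnodes e + 1 + c))"
  shows "triple (Cond e p q) s Q"
  using assms runs_CondTrue runs_CondFalse unfolding triple_def by meson

lemma runs_WhileFalse:
  assumes "bwf e" "bounded s" "\<not> bval e s"
  shows "runs (While e p) s s (bnodes e + 1)"
  unfolding runs_def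
  using exec.WhileFalse[OF assms(3)] bool_cost[OF _ assms(2,1)] one_le_mul[OF _ assms(2)]
  by (force simp: algebra_simps)

lemma runs_WhileTrue:
  assumes "bwf e" "bounded s" "bval e s" "runs p s s' c" "runs (While e p) s' s'' c'"
  shows "runs (While e p) s s'' (bnodes e + 1 + c + c')"
  unfolding runs_def
proof (intro allI impI)
  fix rsz B assume ch: "charges rsz B"
  obtain t t' where t: "exec mul rsz p s s' t" "t \<le> real c * (3 * mul B)"
      "exec mul rsz (While e p) s' s'' t'" "t' \<le> real c' * (3 * mul B)"
    using assms(4,5) ch unfolding runs_def by meson
  then show "\<exists>t. exec mul rsz (While e p) s s'' t \<and> t \<le> real (bnodes e + 1 + c + c') * (3 * mul B)"
    using exec.WhileTrue[OF assms(3) t(1,3)] bool_cost[OF ch assms(2,1)] one_le_mul[OF ch assms(2)]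
    by (intro exI conjI) (auto simp: algebra_simps)
qed

end

abbreviation var :: "nat \<Rightarrow> aexp" where "var k \<equiv> Ld k (Num 0)"
abbreviation rvar :: "nat \<Rightarrow> rexp" where "rvar k \<equiv> RLd k (Num 0)"
abbreviation assign :: "nat \<Rightarrow> aexp \<Rightarrow> com" (infix "::=" 60) where "k ::= e \<equiv> Store k (Num 0) e"
abbreviation rassign :: "nat \<Rightarrow> rexp \<Rightarrow> com" (infix "::~" 60) where "k ::~ r \<equiv> RStore k (Num 0) r"
notation Seq (infixr ";;" 55)

definition for_loop :: "nat \<Rightarrow> nat \<Rightarrow> com \<Rightarrow> com" where
  "for_loop v u p = v ::= Num 0 ;; While (Less (var v) (var u)) (p ;; v ::= Add (var v) (Num 1))"

lemma for_loop_writes [simp]: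
  "writes (for_loop v u p) = insert v (writes p)" "rwrites (for_loop v u p) = rwrites p"
  by (auto simp: for_loop_def)

context machine
begin

text \<open>A round costs 12 beyond its body for test and increment, the failing test 6. The counter
  keeps its size because it never passes its limit, whose array has no larger exponent. The body may
  use the frame relative to the state before the loop, so \<open>I\<close> only describes what
  changes.\<close>

lemma triple_while_upto:
  assumes vu: "v \<noteq> u" "v \<notin> writes p" "u \<notin> writes p" "env v \<le> 58" "env u \<le> env v"
    and I: "I i s" "i \<le> m" "fst s v 0 = int i" "fst s u 0 = int m"
    and step: "\<And>i s'. i < m \<Longrightarrow> I i s' \<Longrightarrow> bounded s' \<Longrightarrow> fst s' v 0 = int i \<Longrightarrow>
      \<forall>k. k \<notin> insert v (writes p) \<longrightarrow> fst s' k = fst s k \<Longrightarrow> \<forall>k. k \<notin> rwrites p \<longrightarrow> snd s' k = snd s k \<Longrightarrow>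
      triple p s' (\<lambda>s'' c. c \<le> C \<and> I (Suc i) (st v 0 (1 + int i) s''))"
  shows "triple (While (Less (var v) (var u)) (p ;; v ::= Add (var v) (Num 1))) s
    (\<lambda>s' c. c \<le> (C + 12) * (m - i) + 6 \<and> I m s' \<and> fst s' v 0 = int m)"
  using I step
proof (induction "m - i" arbitrary: i s)
  case 0
  let ?p = "While (Less (var v) (var u)) (p ;; v ::= Add (var v) (Num 1))"
  show ?case
  proof (rule tripleI)
    assume "bounded s"
    then have "runs ?p s s 6"
      using runs_WhileFalse[of "Less (var v) (var u)" s] 0 vu by (simp add: eval_nat_numeral)
    then show "\<exists>s' c. bounded s' \<and> runs ?p s s' c \<and> c \<le> (C + 12) * (m - i) + 6 \<and> I m s' \<and> fst s' v 0 = int m"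
      using \<open>bounded s\<close> 0 by (intro exI[of _ s] exI[of _ 6]) simp
  qed
next
  case (Suc x)
  let ?b = "p ;; v ::= Add (var v) (Num 1)"
  let ?p = "While (Less (var v) (var u)) ?b"
  show ?case
  proof (rule tripleI)
    assume b: "bounded s"
    have im: "i < m" using Suc.hyps(2) by simp
    have "triple p s (\<lambda>s'' c. c \<le> C \<and> I (Suc i) (st v 0 (1 + int i) s''))"
      using Suc.prems(5)[OF im Suc.prems(1) b Suc.prems(3)] by simp
    then obtain s1 c where s1: "bounded s1" "runs p s s1 c" "c \<le> C" "I (Suc i) (st v 0 (1 + int i) s1)"
      using b by (auto simp: triple_def)
    have v1: "fst s1 v 0 = int i" "fst s1 u 0 = int m"
      using runs_frame(1)[OF s1(2)] vu Suc.prems by auto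
    have "\<bar>fst s u 0\<bar> \<le> N ^ env u" using b unfolding bounded_def by blast
    then have "int m \<le> N ^ env u" using Suc.prems(4) by simp
    then have mb: "int m \<le> N ^ env v" using N_power_mono[OF vu(5)] by linarith
    let ?s2 = "st v 0 (1 + int i) s1"
    have "triple (v ::= Add (var v) (Num 1)) s1 (\<lambda>s' c. s' = ?s2 \<and> c = 6)"
      using vu v1 mb im by (intro triple_Store) (auto simp: add.commute)
    then have s2: "bounded ?s2" "runs (v ::= Add (var v) (Num 1)) s1 ?s2 6"
      using s1(1) by (auto simp: triple_def)
    have run: "runs ?b s ?s2 (c + 6)" by (rule runs_Seq[OF s1(2) s2(2)])
    have "triple ?p ?s2 (\<lambda>s' c. c \<le> (C + 12) * (m - Suc i) + 6 \<and> I m s' \<and> fst s' v 0 = int m)"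
    proof (rule Suc.hyps(1))
      show "x = m - Suc i" "I (Suc i) ?s2" "Suc i \<le> m" using Suc.hyps(2) s1 by auto
      show "fst ?s2 v 0 = int (Suc i)" "fst ?s2 u 0 = int m" using v1 vu by auto
      fix j s' assume j: "j < m" "I j s'" "bounded s'" "fst s' v 0 = int j"
        and fr: "\<forall>k. k \<notin> insert v (writes p) \<longrightarrow> fst s' k = fst ?s2 k"
          "\<forall>k. k \<notin> rwrites p \<longrightarrow> snd s' k = snd ?s2 k"
      have "\<forall>k. k \<notin> insert v (writes p) \<longrightarrow> fst s' k = fst s k"
        "\<forall>k. k \<notin> rwrites p \<longrightarrow> snd s' k = snd s k"
        using fr runs_frame[OF s1(2)] by auto
      then show "triple p s' (\<lambda>s'' c. c \<le> C \<and> I (Suc j) (st v 0 (1 + int j) s''))"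
        using Suc.prems(5) j by blast
    qed
    then obtain s3 c' where s3: "bounded s3" "runs ?p ?s2 s3 c'" "c' \<le> (C + 12) * (m - Suc i) + 6"
        "I m s3" "fst s3 v 0 = int m"
      using s2(1) by (auto simp: triple_def)
    have "runs ?p s s3 (bnodes (Less (var v) (var u)) + 1 + (c + 6) + c')"
      using im Suc.prems vu by (intro runs_WhileTrue[OF _ b _ run s3(2)]) auto
    moreover have "bnodes (Less (var v) (var u)) + 1 + (c + 6) + c' \<le> (C + 12) * (m - i) + 6"
    proof -
      have "m - i = Suc (m - Suc i)" using im by simp
      then show ?thesis using s1(3) s3(3) by simp
    qed
    ultimately show "\<exists>s' c. bounded s' \<and> runs ?p s s' c \<and> c \<le> (C + 12) * (m - i) + 6 \<and> I m s' \<and> fst s' v 0 = int m"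
      using s3 by blast
  qed
qed

lemma triple_for:
  assumes vu: "v \<noteq> u" "v \<notin> writes p" "u \<notin> writes p" "env v \<le> 58" "env u \<le> env v"
    and m: "fst s u 0 = int m" and I: "I 0 (st v 0 0 s)"
    and step: "\<And>i s'. i < m \<Longrightarrow> I i s' \<Longrightarrow> bounded s' \<Longrightarrow> fst s' v 0 = int i \<Longrightarrow>
      \<forall>k. k \<notin> insert v (writes p) \<longrightarrow> fst s' k = fst s k \<Longrightarrow> \<forall>k. k \<notin> rwrites p \<longrightarrow> snd s' k = snd s k \<Longrightarrow>
      triple p s' (\<lambda>s'' c. c \<le> C \<and> I (Suc i) (st v 0 (1 + int i) s''))"
    and Q: "\<And>s' c. c \<le> (C + 12) * m + 9 \<Longrightarrow> I m s' \<Longrightarrow> bounded s' \<Longrightarrow>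
      \<forall>k. k \<notin> insert v (writes p) \<longrightarrow> fst s' k = fst s k \<Longrightarrow> \<forall>k. k \<notin> rwrites p \<longrightarrow> snd s' k = snd s k \<Longrightarrow> Q s' c"
  shows "triple (for_loop v u p) s Q"
proof -
  let ?p = "While (Less (var v) (var u)) (p ;; v ::= Add (var v) (Num 1))"
  have "triple ?p (st v 0 0 s) (\<lambda>s' c. c \<le> (C + 12) * (m - 0) + 6 \<and> I m s' \<and> fst s' v 0 = int m)"
  proof (rule triple_while_upto[where I = I and i = 0, OF vu I])
    show "fst (st v 0 0 s) v 0 = int 0" "fst (st v 0 0 s) u 0 = int m" using m vu by auto
    fix i s' assume a: "i < m" "I i s'" "bounded s'" "fst s' v 0 = int i"
      "\<forall>k. k \<notin> insert v (writes p) \<longrightarrow> fst s' k = fst (st v 0 0 s) k"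
      "\<forall>k. k \<notin> rwrites p \<longrightarrow> snd s' k = snd (st v 0 0 s) k"
    then show "triple p s' (\<lambda>s'' c. c \<le> C \<and> I (Suc i) (st v 0 (1 + int i) s''))"
      by (intro step) auto
  qed simp
  then have "triple (for_loop v u p) s (\<lambda>s' c. c \<le> (C + 12) * m + 9 \<and> I m s')"
    unfolding for_loop_def using vu
    by (intro triple_Seq triple_Store_degree) (auto elim!: triple_mono)
  then show ?thesis by (rule triple_mono) (auto intro: Q)
qed

end

section \<open>The triangular solver\<close>

lemma env_simps [simp]:
  "env 0 = 1" "env (Suc 0) = 3" "env 2 = 1" "env 3 = 1" "env 4 = 1" "env 5 = 1" "env 6 = 1" "env 7 = 3"
  "env 8 = 6" "env 9 = 4" "env 10 = 1" "env 11 = 1" "env 12 = 1" "env 13 = 8" "env 14 = 1" "env 15 = 6"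
  "env 16 = 6" "env 17 = 1" "env 18 = 7" "env 19 = 9" "env 20 = 5" "env 21 = 8" "env 22 = 1" "env 23 = 0"
  "env 24 = 24" "env 25 = 14" "env 26 = 15"
  "renv 0 = 4" "renv (Suc 0) = 18" "renv 2 = 16" "renv 3 = 18" "renv 4 = 3" "renv 5 = 4"
  by (simp_all add: env_def renv_def)

text \<open>
  Plain variables: 3, 4 dimensions d, n; 5 determinant of the basis; 6 bound D; 7 window W; 8 number
  of slots; 9 bound for solutions; 10, 11, 14, 15, 16, 17 loop counters; 12 group index; 13
  accumulator; 18 sum of a multiset; 19 slot, or position of the best ratio; 20 the width 2W+1.
  Plain arrays: 21 and 22 the functionals, 23 flags, 24 costs and 25 multisets of the table, 26 a
  multiset. Right-hand side arrays: 1 solution, 2 vector to be reduced, 3 accumulator, 4 weighted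
  sum of b, 5 amount of tightening.
\<close>

definition entry :: "aexp \<Rightarrow> aexp \<Rightarrow> aexp" where
  "entry i j = Ld 1 (Add (Mul i (var 4)) j)"

definition eliminate :: com where
  "eliminate = for_loop 11 10 (3 ::~ RSub (rvar 3) (RMul (entry (var 10) (var 11)) (RLd 1 (var 11))))"

text \<open>One pass yields the quotients and, by Horner's rule on the remainders, the class index.
  The remainders are the only information about the vector that becomes plain.\<close>

definition solve :: com where
  "solve = 12 ::= Num 0 ;; for_loop 10 4
     (3 ::~ RLd 2 (var 10) ;; eliminate ;;
      RStore 1 (var 10) (RDiv (rvar 3) (entry (var 10) (var 10))) ;;
      12 ::= Add (Mul (var 12) (entry (var 10) (var 10))) (RMod (rvar 3) (entry (var 10) (var 10))))"

lemma eliminate_writes [simp]: "writes eliminate = {11}" "rwrites eliminate = {3}"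
  by (auto simp: eliminate_def)

lemma solve_writes [simp]: "writes solve = {10, 11, 12}" "rwrites solve = {1, 3}"
  by (auto simp: solve_def)

locale solver = machine + lower_hnf n H for n H +
  fixes d :: nat and Harr :: "int \<Rightarrow> int"
  assumes n_pos: "1 \<le> n" and dims: "d = n \<or> d = Suc n"
    and Harr: "i \<le> n \<Longrightarrow> j < n \<Longrightarrow> Harr (int i * int n + int j) = H i j"
    and n_le_N: "int n + 2 \<le> N" and pivots_le_N: "pivots n \<le> N"
begin

definition layout :: "state \<Rightarrow> bool" where
  "layout s \<longleftrightarrow> fst s 3 0 = int d \<and> fst s 4 0 = int n \<and> fst s 1 = Harr"

text \<open>Origin of the exponent 18 of the right-hand side arrays 1 and 3: 16 for the reduced
  vector in array 2, and one each for \<open>n + 1\<close> and the pivot product.\<close>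

lemma solve_value_le:
  assumes x: "\<bar>x\<bar> \<le> (int n + 1) * NR ^ 16 * pivots n"
  shows "\<bar>x\<bar> \<le> NR ^ 18"
proof -
  have "(int n + 1) * NR ^ 16 * pivots n \<le> NR * NR ^ 16 * NR"
    using n_le_N N_le_NR N_ge pivots_le_N pivots_pos[of n] by (intro mult_mono) auto
  also have "\<dots> = NR ^ 18" by (simp add: eval_nat_numeral)
  finally show ?thesis using x by simp
qed

lemma triple_eliminate:
  assumes L: "layout s" and i: "fst s 10 0 = int i" "i < n" and v: "snd s 3 0 = v i"
    and q: "\<And>j. j < i \<Longrightarrow> snd s 1 (int j) = quot v j" and vb: "\<And>i. i < n \<Longrightarrow> \<bar>v i\<bar> \<le> NR ^ 16"
  shows "triple eliminate s (\<lambda>s' c. c \<le> 30 * n + 9 \<and> snd s' 3 0 = v i - (\<Sum>j<i. H i j * quot v j))"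
  unfolding eliminate_def
proof (rule triple_for[where m = i and C = 18 and
      I = "\<lambda>k s'. snd s' 3 0 = v i - (\<Sum>j<k. H i j * quot v j)"], goal_cases)
  case step: (8 k s')
  note k = step(1) and I = step(2) and kv = step(4) and f = step(5,6)
  have le: "\<bar>v i - (\<Sum>j<Suc k. H i j * quot v j)\<bar> \<le> NR ^ 18"
    using k i N_ge N_le_NR by (intro solve_value_le residue_bound[OF vb]) auto
  show ?case
    by (rule triple_RStore) (insert le f L i q[OF k] k I kv Harr[of i k], simp_all add: entry_def layout_def)
qed (use i v q L in \<open>auto\<close>)


lemma triple_solve:
  assumes L: "layout s" and v: "v = (\<lambda>i. snd s 2 (int i))"
  shows "triple solve s (\<lambda>s' c. c \<le> 120 * (n + 1)^2 \<and> fst s' 12 0 = ix v \<and> (\<forall>i<n. snd s' 1 (int i) = quot v i))"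
  unfolding solve_def
proof (rule triple_bounded, rule triple_Seq, rule triple_Store_degree)
  assume bs: "bounded s"
  let ?body = "3 ::~ RLd 2 (var 10) ;; eliminate ;;
      RStore 1 (var 10) (RDiv (rvar 3) (entry (var 10) (var 10))) ;;
      12 ::= Add (Mul (var 12) (entry (var 10) (var 10))) (RMod (rvar 3) (entry (var 10) (var 10)))"
  have vb: "\<bar>v i\<bar> \<le> NR ^ 16" for i
  proof -
    have "\<bar>snd s 2 (int i)\<bar> \<le> NR ^ renv 2" using bs unfolding bounded_def by blast
    then show ?thesis by (simp add: v)
  qed
  let ?s = "st 12 (aval (Num 0) s) (aval (Num 0) s) s"
  show "triple (for_loop 10 4 ?body) ?s (\<lambda>s'' c'.
      anodes (Num 0) + anodes (Num 0) + 1 + c' \<le> 120 * (n + 1)^2 \<and> fst s'' 12 0 = ix v \<and>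
      (\<forall>i<n. snd s'' 1 (int i) = quot v i))"
  proof (rule triple_for[where m = n and C = "30 * n + 70" and
      I = "\<lambda>k s'. fst s' 12 0 = horner v k \<and> (\<forall>i<k. snd s' 1 (int i) = quot v i)"], goal_cases)
    case step: (8 i s')
    note i = step(1) and I = step(2) and iv = step(4) and f = step(5,6)
    let ?a = "v i - (\<Sum>j<i. H i j * quot v j)"
    have q: "?a div H i i = quot v i" by (rule quot.simps[symmetric])
    have r: "?a mod H i i = rmd v i" by (simp add: rmd_def)
    \<comment> \<open>The index is bounded by its meaning, being below the product of the pivots
      seen so far; the degree of the expression exceeds the exponent of its array.\<close>
    have hle: "\<bar>horner v (Suc i)\<bar> \<le> N"
      using horner_bounds[of "Suc i" v] pivots_mono[of "Suc i" n] pivots_le_N i by auto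
    have L': "layout s'" using L f by (simp add: layout_def)
    have diag: "H i i \<noteq> 0" using diag_pos[OF i] by simp
    have *: "triple eliminate (rst 3 0 (v i) s') (\<lambda>s' c. c \<le> 30 * n + 9 \<and> snd s' 3 0 = ?a)"
      by (rule triple_eliminate) (insert L' i iv I vb, auto simp: layout_def)
    show ?case
    proof (rule triple_Seq, rule triple_RStore_degree)
      show "triple (eliminate ;;
          RStore 1 (var 10) (RDiv (rvar 3) (entry (var 10) (var 10))) ;;
          12 ::= Add (Mul (var 12) (entry (var 10) (var 10))) (RMod (rvar 3) (entry (var 10) (var 10))))
         (rst 3 (aval (Num 0) s') (rval (RLd 2 (var 10)) s') s')
         (\<lambda>s'' c'. anodes (Num 0) + rnodes (RLd 2 (var 10)) + 1 + c' \<le> 30 * n + 70 \<and>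
            fst (st 10 0 (1 + int i) s'') 12 0 = horner v (Suc i) \<and>
            (\<forall>j<Suc i. snd (st 10 0 (1 + int i) s'') 1 (int j) = quot v j))"
      proof (rule triple_Seq, rule triple_mono)
        show "triple eliminate (rst 3 (aval (Num 0) s') (rval (RLd 2 (var 10)) s') s')
          (\<lambda>s' c. c \<le> 30 * n + 9 \<and> snd s' 3 0 = ?a)"
          using * f iv by (simp add: v)
        fix s1 c assume s1: "c \<le> 30 * n + 9 \<and> snd s1 3 0 = ?a" "bounded s1"
          "\<forall>k. k \<notin> writes eliminate \<longrightarrow> fst s1 k = fst (rst 3 (aval (Num 0) s') (rval (RLd 2 (var 10)) s') s') k"
          "\<forall>k. k \<notin> rwrites eliminate \<longrightarrow> snd s1 k = snd (rst 3 (aval (Num 0) s') (rval (RLd 2 (var 10)) s') s') k"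
        have q': "snd s1 3 0 div H i i = quot v i" and r': "snd s1 3 0 mod H i i = rmd v i"
          using s1(1) q r by auto
        show "triple (RStore 1 (var 10) (RDiv (rvar 3) (entry (var 10) (var 10))) ;;
          12 ::= Add (Mul (var 12) (entry (var 10) (var 10))) (RMod (rvar 3) (entry (var 10) (var 10)))) s1
          (\<lambda>s'' c'. anodes (Num 0) + rnodes (RLd 2 (var 10)) + 1 + (c + c') \<le> 30 * n + 70 \<and>
            fst (st 10 0 (1 + int i) s'') 12 0 = horner v (Suc i) \<and>
            (\<forall>j<Suc i. snd (st 10 0 (1 + int i) s'') 1 (int j) = quot v j))"
          by (rule triple_Seq, rule triple_RStore_degree, simp_all add: entry_def, rule triple_Store)
            (insert hle s1 L' i iv I q' r' Harr[of i i] diag,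
              simp_all add: entry_def layout_def less_Suc_eq all_conj_distrib)
      qed
    qed (simp_all add: entry_def)
  next
    fix s' c assume "c \<le> (30 * n + 70 + 12) * n + 9"
      "fst s' 12 0 = horner v n \<and> (\<forall>i<n. snd s' 1 (int i) = quot v i)"
    then show "anodes (Num 0) + anodes (Num 0) + 1 + c \<le> 120 * (n + 1)^2 \<and> fst s' 12 0 = ix v \<and>
      (\<forall>i<n. snd s' 1 (int i) = quot v i)"
      by (auto simp: ix_def power2_eq_square algebra_simps)
  qed (use L in \<open>auto simp: layout_def\<close>)
qed simp_all

end

section \<open>Computing the functionals\<close>

context machine
begin

lemma triple_Seq_Store:
  assumes "awf a" "awf e" "bounded s \<Longrightarrow> \<bar>aval e s\<bar> \<le> N ^ env k"
    and "triple q (st k (aval a s) (aval e s) s) (\<lambda>s' c. Q s' (anodes a + anodes e + 1 + c))"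
  shows "triple (Store k a e ;; q) s Q"
  by (rule triple_Seq, rule triple_Store) (use assms in auto)

lemma triple_Seq_Store_degree:
  assumes "awf a" "awf e" "adeg e \<le> env k"
    and "triple q (st k (aval a s) (aval e s) s) (\<lambda>s' c. Q s' (anodes a + anodes e + 1 + c))"
  shows "triple (Store k a e ;; q) s Q"
  by (rule triple_Seq, rule triple_Store_degree) (use assms in auto)

lemma triple_Seq_RStore:
  assumes "awf a" "rwf r" "bounded s \<Longrightarrow> \<bar>rval r s\<bar> \<le> NR ^ renv k"
    and "triple q (rst k (aval a s) (rval r s) s) (\<lambda>s' c. Q s' (anodes a + rnodes r + 1 + c))"
  shows "triple (RStore k a r ;; q) s Q"
  by (rule triple_Seq, rule triple_RStore) (use assms in auto)

lemma triple_Seq_RStore_degree: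
  assumes "awf a" "rwf r" "rdeg r \<le> renv k"
    and "triple q (rst k (aval a s) (rval r s) s) (\<lambda>s' c. Q s' (anodes a + rnodes r + 1 + c))"
  shows "triple (RStore k a r ;; q) s Q"
  by (rule triple_Seq, rule triple_RStore_degree) (use assms in auto)

lemma triple_Seq_mono:
  assumes "triple p s P"
    and "\<And>s' c. P s' c \<Longrightarrow> bounded s' \<Longrightarrow> \<forall>k. k \<notin> writes p \<longrightarrow> fst s' k = fst s k \<Longrightarrow>
      \<forall>k. k \<notin> rwrites p \<longrightarrow> snd s' k = snd s k \<Longrightarrow> triple q s' (\<lambda>s'' c'. Q s'' (c + c'))"
  shows "triple (p ;; q) s Q"
  by (rule triple_Seq, rule triple_mono[OF assms(1)]) (rule assms(2))

end

text \<open>An integer of absolute value at most \<open>M\<close>, kept in variable 9, is recovered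
  from its remainder after a shift by \<open>M\<close>: this is the way from a right-hand side array
  back to a plain number.\<close>

definition solution_entry :: aexp where
  "solution_entry = Sub (RMod (RAdd (RLd 1 (var 11)) (RInt (var 9))) (Add (Mul (Num 2) (var 9)) (Num 1))) (var 9)"

definition weigh :: "aexp \<Rightarrow> com" where
  "weigh f = 13 ::= Num 0 ;; for_loop 11 4 (13 ::= Add (var 13) (Mul f solution_entry))"

lemma weigh_writes [simp]: "writes (weigh f) = {11, 13}" "rwrites (weigh f) = {}"
  by (auto simp: weigh_def)

definition clear_rhs :: com where
  "clear_rhs = for_loop 11 4 (RStore 2 (var 11) (RInt (Num 0)))"

lemma clear_rhs_writes [simp]: "writes clear_rhs = {11}" "rwrites clear_rhs = {2}"
  by (auto simp: clear_rhs_def)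

text \<open>Solving for the pivot product times a unit vector gives a column of the adjugate,
  exactly and without computing a cofactor. Weighing it with \<open>c\<close> and with the row below
  the basis gives one coefficient of each functional.\<close>

definition coefficient :: com where
  "coefficient = clear_rhs ;; RStore 2 (var 14) (RInt (var 5)) ;; solve ;;
     weigh (Ld 2 (var 11)) ;; Store 21 (var 14) (var 13) ;;
     weigh (entry (var 4) (var 11)) ;; Store 22 (var 14) (var 13)"

lemma coefficient_writes [simp]:
  "writes coefficient = {10, 11, 12, 13, 21, 22}" "rwrites coefficient = {1, 2, 3}"
  by (auto simp: coefficient_def)

locale program = solver mul N NR B0 B1 n H d Harr + slack_system n H d A c D \<epsilon>
  for mul N NR B0 B1 n H d Harr A c D \<epsilon> +
  assumes D_le_N: "D \<le> N"
begin

definition layout_c :: "state \<Rightarrow> bool" where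
  "layout_c s \<longleftrightarrow> layout s \<and> (\<forall>j<n. fst s 2 (int j) = c j)"

lemma triple_clear_rhs:
  "layout s \<Longrightarrow> triple clear_rhs s (\<lambda>s' c. c \<le> 20 * n + 9 \<and> (\<forall>j<n. snd s' 2 (int j) = 0))"
  unfolding clear_rhs_def
  by (rule triple_for[where m = n and C = 5 and I = "\<lambda>k s'. \<forall>j<k. snd s' 2 (int j) = 0"];
      (rule triple_RStore_degree)?)
    (auto simp: layout_def less_Suc_eq)

lemma triple_weigh:
  assumes L: "layout s" and f: "awf f" "adeg f \<le> 3" "anodes f \<le> 20"
    and fval: "\<And>s' j. j < n \<Longrightarrow> fst s' 4 0 = int n \<Longrightarrow> fst s' 1 = Harr \<Longrightarrow> fst s' 2 = fst s 2 \<Longrightarrow>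
      fst s' 11 0 = int j \<Longrightarrow> aval f s' = F j"
    and Fle: "\<And>j. j < n \<Longrightarrow> \<bar>F j\<bar> \<le> N ^ 3"
    and x: "\<And>j. j < n \<Longrightarrow> snd s 1 (int j) = x j" and xM: "\<And>j. j < n \<Longrightarrow> \<bar>x j\<bar> \<le> M"
    and M: "fst s 9 0 = M" "M \<le> N ^ 4"
  shows "triple (weigh f) s (\<lambda>s' c. c \<le> 60 * n + 15 \<and> fst s' 13 0 = (\<Sum>j<n. F j * x j))"
  unfolding weigh_def
proof (rule triple_Seq_Store_degree)
  let ?s = "st 13 (aval (Num 0) s) (aval (Num 0) s) s"
  let ?body = "13 ::= Add (var 13) (Mul f solution_entry)"
  show "triple (for_loop 11 4 ?body) ?s
    (\<lambda>s' c. anodes (Num 0) + anodes (Num 0) + 1 + c \<le> 60 * n + 15 \<and> fst s' 13 0 = (\<Sum>j<n. F j * x j))"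
  proof (rule triple_for[where m = n and C = 43 and I = "\<lambda>k s'. fst s' 13 0 = (\<Sum>j<k. F j * x j)"], goal_cases)
    case step: (8 k s')
    note k = step(1) and I = step(2) and kv = step(4) and fr = step(5,6)
    have e: "aval solution_entry s' = x k"
    proof -
      have "(x k + M) mod (2 * M + 1) = x k + M"
        using xM[OF k] by (intro mod_pos_pos_trivial) auto
      moreover have "2 * M + 1 \<noteq> 0" by presburger
      ultimately show ?thesis using fr x[OF k] kv M by (simp add: solution_entry_def)
    qed
    have fv: "aval f s' = F k"
      using fr kv L by (intro fval[OF k]) (simp_all add: layout_def)
    \<comment> \<open>Origin of the exponent 8 of the accumulator: 3 for the weights, 4 for the
      solution and 1 for the number of terms.\<close>
    have "\<bar>\<Sum>j<Suc k. F j * x j\<bar> \<le> (\<Sum>j<Suc k. N ^ 3 * N ^ 4)"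
    proof (intro order_trans[OF sum_abs] sum_mono)
      fix j assume j: "j \<in> {..<Suc k}"
      have "\<bar>F j\<bar> \<le> N ^ 3" using Fle[of j] j k by simp
      moreover have "\<bar>x j\<bar> \<le> N ^ 4" using xM[of j] M j k by simp
      ultimately show "\<bar>F j * x j\<bar> \<le> N ^ 3 * N ^ 4" unfolding abs_mult using N_ge by (intro mult_mono) auto
    qed
    also have "\<dots> = int (Suc k) * N ^ 7" by (simp only: sum_constant power_add[symmetric]) simp
    also have "\<dots> \<le> N * N ^ 7" using k n_le_N N_ge by (intro mult_right_mono) auto
    also have "\<dots> = N ^ 8" by (simp add: eval_nat_numeral)
    finally have le: "\<bar>\<Sum>j<Suc k. F j * x j\<bar> \<le> N ^ 8" .
    have se: "awf solution_entry" "adeg solution_entry = 7" "anodes solution_entry = 17"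
      by (simp_all add: solution_entry_def)
    show ?case
      by (rule triple_Store) (use f se le I e fv in simp_all)
  qed (use L in \<open>auto simp: layout_def\<close>)
qed simp_all

lemma quot_unit:
  assumes "k < n" "j < n" "v = (\<lambda>i. if i = k then pivots n else 0)"
  shows "quot v j = A j k"
  using assms adjugate[of _ k] by (intro quot_exact) auto

lemma triple_coefficient:
  assumes L: "layout_c s" and k: "fst s 14 0 = int k" "k < n"
    and piv: "fst s 5 0 = pivots n" and M: "fst s 9 0 = (int n + 1) * pivots n * pivots n"
  shows "triple coefficient s (\<lambda>s' t. t \<le> 500 * (n + 1)^2 \<and>
    fst s' 21 = (fst s 21)(int k := \<gamma> k) \<and> fst s' 22 = (fst s 22)(int k := w k))"
  unfolding coefficient_def
proof (rule triple_Seq_mono[OF triple_clear_rhs])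
  show "layout s" using L by (simp add: layout_c_def)
  fix s1 t1 assume s1: "t1 \<le> 20 * n + 9 \<and> (\<forall>j<n. snd s1 2 (int j) = 0)" "bounded s1"
    "\<forall>k. k \<notin> writes clear_rhs \<longrightarrow> fst s1 k = fst s k" "\<forall>k. k \<notin> rwrites clear_rhs \<longrightarrow> snd s1 k = snd s k"
  define v :: "nat \<Rightarrow> int" where "v = (\<lambda>i. if i = k then pivots n else 0)"
  define M where "M = (int n + 1) * pivots n * pivots n"
  have M4: "M \<le> N ^ 4"
  proof -
    have "M \<le> N * N * N" unfolding M_def
      using n_le_N pivots_le_N pivots_pos[of n] N_ge by (intro mult_mono) auto
    also have "\<dots> = N ^ 3" by (simp add: eval_nat_numeral)
    also have "\<dots> \<le> N ^ 4" by (rule N_power_mono) simp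
    finally show ?thesis .
  qed
  have A: "quot v j = A j k" if "j < n" for j using quot_unit k(2) that v_def by blast
  have AM: "\<bar>A j k\<bar> \<le> M" if "j < n" for j
    using quot_bound[of v "pivots n" j] pivots_pos[of n] that A[OF that] by (auto simp: v_def M_def)
  let ?s2 = "rst 2 (aval (var 14) s1) (rval (RInt (var 5)) s1) s1"
  let ?Q = "\<lambda>s' t. t \<le> 500 * (n + 1)^2 \<and>
    fst s' 21 = (fst s 21)(int k := \<gamma> k) \<and> fst s' 22 = (fst s 22)(int k := w k)"
  show "triple (RStore 2 (var 14) (RInt (var 5)) ;; solve ;;
     weigh (Ld 2 (var 11)) ;; Store 21 (var 14) (var 13) ;;
     weigh (entry (var 4) (var 11)) ;; Store 22 (var 14) (var 13)) s1 (\<lambda>s'' t. ?Q s'' (t1 + t))"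
  proof (rule triple_Seq_RStore_degree)
    have L2: "layout ?s2" using L s1(3) by (simp add: layout_def layout_c_def)
    let ?v2 = "\<lambda>i. snd ?s2 2 (int i)"
    have v2: "?v2 i = v i" if "i < n" for i
      using that s1 k piv by (simp add: v_def)
    \<comment> \<open>Array 2 is only known on its first \<open>n\<close> positions; the vectors
      differ there by the zero combination, so their quotients agree.\<close>
    have q2: "quot ?v2 i = A i k" if "i < n" for i
    proof -
      have "quot ?v2 i = quot v i"
        using rmd_eq_if_basis_lattice[of ?v2 v "\<lambda>_. 0" i] v2 that by simp
      then show ?thesis using A that by simp
    qed
    let ?t2 = "t1 + (anodes (var 14) + rnodes (RInt (var 5)) + 1)"
    show "triple (solve ;; weigh (Ld 2 (var 11)) ;; Store 21 (var 14) (var 13) ;;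
      weigh (entry (var 4) (var 11)) ;; Store 22 (var 14) (var 13)) ?s2
      (\<lambda>s' t. ?Q s' (t1 + (anodes (var 14) + rnodes (RInt (var 5)) + 1 + t)))"
    proof (rule triple_Seq_mono[OF triple_solve[OF L2 refl]], goal_cases)
      case s3: (1 s3 t3)
      have f3: "\<forall>k. k \<notin> {10, 11, 12} \<longrightarrow> fst s3 k = fst s k" using s3(3) s1(3) by simp
      have x3: "snd s3 1 (int j) = A j k" if "j < n" for j using s3(1) q2[OF that] that by simp
      have L3: "layout s3" using L f3 by (simp add: layout_def layout_c_def)
      have c3: "\<bar>c j\<bar> \<le> N ^ 3" if "j < n" for j
      proof -
        have "\<bar>fst s3 2 (int j)\<bar> \<le> N ^ env 2" using s3(2) unfolding bounded_def by blast
        then have "\<bar>c j\<bar> \<le> N ^ 1" using L f3 that by (simp add: layout_c_def)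
        then show ?thesis using N_power_mono[of 1 3] by linarith
      qed
      have H3: "\<bar>H n j\<bar> \<le> N ^ 3" if "j < n" for j
      proof -
        have "\<bar>fst s3 1 (int n * int n + int j)\<bar> \<le> N ^ env 1" using s3(2) unfolding bounded_def by blast
        then show ?thesis using L3 Harr[of n j] that by (simp add: layout_def)
      qed
      have w1: "triple (weigh (Ld 2 (var 11))) s3
          (\<lambda>s' t. t \<le> 60 * n + 15 \<and> fst s' 13 0 = (\<Sum>j<n. c j * A j k))"
        by (rule triple_weigh[OF L3, where M = M])
          (use c3 x3 AM M4 f3 L M in \<open>simp_all add: layout_c_def M_def\<close>)
      show ?case
      proof (rule triple_Seq_mono[OF w1], rule triple_Seq_Store_degree)
        fix s4 t4 assume s4: "t4 \<le> 60 * n + 15 \<and> fst s4 13 0 = (\<Sum>j<n. c j * A j k)" "bounded s4"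
          "\<forall>k. k \<notin> writes (weigh (Ld 2 (var 11))) \<longrightarrow> fst s4 k = fst s3 k"
          "\<forall>k. k \<notin> rwrites (weigh (Ld 2 (var 11))) \<longrightarrow> snd s4 k = snd s3 k"
        let ?s5 = "st 21 (aval (var 14) s4) (aval (var 13) s4) s4"
        have L5: "layout ?s5" using L3 s4(3) by (simp add: layout_def)
        have w2: "triple (weigh (entry (var 4) (var 11))) ?s5
            (\<lambda>s' t. t \<le> 60 * n + 15 \<and> fst s' 13 0 = (\<Sum>j<n. H n j * A j k))"
          by (rule triple_weigh[OF L5, where M = M])
            (use H3 x3 AM M4 f3 L M s4 Harr[of n] in \<open>simp_all add: M_def entry_def\<close>)
        show "triple (weigh (entry (var 4) (var 11)) ;; Store 22 (var 14) (var 13)) ?s5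
          (\<lambda>s' t. ?Q s' (t1 + (anodes (var 14) + rnodes (RInt (var 5)) + 1 +
             (t3 + (t4 + (anodes (var 14) + anodes (var 13) + 1 + t))))))"
        proof (rule triple_Seq_mono[OF w2], rule triple_Store)
          fix s6 t6 assume s6: "t6 \<le> 60 * n + 15 \<and> fst s6 13 0 = (\<Sum>j<n. H n j * A j k)" "bounded s6"
            "\<forall>k. k \<notin> writes (weigh (entry (var 4) (var 11))) \<longrightarrow> fst s6 k = fst ?s5 k"
            "\<forall>k. k \<notin> rwrites (weigh (entry (var 4) (var 11))) \<longrightarrow> snd s6 k = snd ?s5 k"
          \<comment> \<open>The accumulator has exponent 8, but this value is bounded by
            \<open>D\<close> through \<open>minor_le\<close> and fits into an array of exponent
            1.\<close>
          have "\<bar>w k\<bar> \<le> N" using minor_le[OF k(2)] D_le_N by (simp add: w_def)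
          then show "\<bar>aval (var 13) s6\<bar> \<le> N ^ env 22" using s6(1) by (simp add: w_def)
          have t: "20 * n + 9 + 120 * (n + 1)^2 + (60 * n + 15) + (60 * n + 15) + 30 \<le> 500 * (n + 1)^2"
            by (simp add: power2_eq_square algebra_simps)
          show "?Q (st 22 (aval (var 14) s6) (aval (var 13) s6) s6)
            (t1 + (anodes (var 14) + rnodes (RInt (var 5)) + 1 + (t3 + (t4 + (anodes (var 14) + anodes (var 13) + 1 +
             (t6 + (anodes (var 14) + anodes (var 13) + 1)))))))"
            using t s1(1) s3(1) s4 s6 f3 k by (simp add: \<gamma>_def w_def)
        qed simp_all
      qed simp_all
    qed
  qed simp_all
qed

end

section \<open>Dynamic programming over the slots\<close>

definition load_row :: com where
  "load_row = for_loop 11 3 (Store 26 (var 11) (Ld 25 (Add (Mul (var 16) (var 3)) (var 11))))"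

definition row_to_rhs :: com where
  "row_to_rhs = for_loop 11 4 (RStore 2 (var 11) (RInt (Ld 26 (var 11))))"

definition save_row :: com where
  "save_row = for_loop 11 3 (Store 25 (Add (Mul (var 19) (var 3)) (var 11)) (Ld 26 (var 11)))"

lemma row_writes [simp]:
  "writes load_row = {11, 26}" "rwrites load_row = {}"
  "writes row_to_rhs = {11}" "rwrites row_to_rhs = {2}"
  "writes save_row = {11, 25}" "rwrites save_row = {}"
  by (auto simp: load_row_def row_to_rhs_def save_row_def)

definition improve :: com where
  "improve = Cond (Neg (Conj (Less (Num 0) (Ld 23 (var 19)))
       (Neg (Less (Add (Ld 24 (var 16)) (Ld 21 (var 17))) (Ld 24 (var 19))))))
     (Store 23 (var 19) (Num 1) ;; Store 24 (var 19) (Add (Ld 24 (var 16)) (Ld 21 (var 17))) ;; save_row)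
     Skip"

text \<open>The index of the extended multiset is recomputed by the solver from its entries, since
  the mixed-radix code cannot simply be added. This accounts for the quadratic cost of a
  relaxation.\<close>

definition extend :: com where
  "extend = load_row ;; Store 26 (var 17) (Add (Ld 26 (var 17)) (Num 1)) ;; row_to_rhs ;; solve ;;
     19 ::= Add (Mul (var 12) (var 20)) (Add (var 18) (var 7)) ;; improve"

text \<open>The value of \<sigma> is read off the slot number, so a step that leaves the window is
  rejected before any vector is touched.\<close>

definition relax :: com where
  "relax = 18 ::= Add (Sub (RMod (RInt (var 16)) (var 20)) (var 7)) (Ld 22 (var 17)) ;;
     Cond (Conj (Less (Num 0) (Ld 23 (var 16)))
         (Conj (Neg (Less (var 18) (Sub (Num 0) (var 7)))) (Neg (Less (var 7) (var 18)))))
       extend Skip"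

text \<open>Setting one flag initialises the table: cost 0 and the zero row, the defaults of the
  arrays, are the entry of the empty multiset, whose slot is \<open>W\<close>.\<close>

definition fill_table :: com where
  "fill_table = Store 23 (var 7) (Num 1) ;; for_loop 15 8 (for_loop 16 8 (for_loop 17 3 relax))"

lemma table_writes [simp]:
  "writes improve = {11, 23, 24, 25}" "rwrites improve = {}"
  "writes extend = {10, 11, 12, 19, 23, 24, 25, 26}" "rwrites extend = {1, 2, 3}"
  "writes relax = {10, 11, 12, 18, 19, 23, 24, 25, 26}" "rwrites relax = {1, 2, 3}"
  "writes fill_table = {10, 11, 12, 15, 16, 17, 18, 19, 23, 24, 25, 26}" "rwrites fill_table = {1, 2, 3}"
  by (auto simp: improve_def extend_def relax_def fill_table_def)

context program
begin

lemma d_le: "d \<le> n + 1"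
  using dims by auto

lemma triple_load_row:
  "layout s \<Longrightarrow> triple load_row s (\<lambda>s' t. t \<le> 40 * d + 9 \<and>
     (\<forall>i<d. fst s' 26 (int i) = fst s 25 (fst s 16 0 * int d + int i)))"
  unfolding load_row_def
  by (rule triple_for[where m = d and C = 12 and
        I = "\<lambda>k s'. \<forall>i<k. fst s' 26 (int i) = fst s 25 (fst s 16 0 * int d + int i)"];
      (rule triple_Store_degree)?)
    (auto simp: layout_def less_Suc_eq)

lemma triple_row_to_rhs:
  "layout s \<Longrightarrow> triple row_to_rhs s (\<lambda>s' t. t \<le> 40 * n + 9 \<and> (\<forall>i<n. snd s' 2 (int i) = fst s 26 (int i)))"
  unfolding row_to_rhs_def
  by (rule triple_for[where m = n and C = 12 and I = "\<lambda>k s'. \<forall>i<k. snd s' 2 (int i) = fst s 26 (int i)"];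
      (rule triple_RStore_degree)?)
    (auto simp: layout_def less_Suc_eq)

lemma triple_save_row:
  assumes L: "layout s" and le: "\<And>i. i < d \<Longrightarrow> \<bar>fst s 26 (int i)\<bar> \<le> N ^ 14"
  shows "triple save_row s (\<lambda>s' t. t \<le> 40 * d + 9 \<and>
     fst s' 25 = (\<lambda>x. if fst s 19 0 * int d \<le> x \<and> x < fst s 19 0 * int d + int d
       then fst s 26 (x - fst s 19 0 * int d) else fst s 25 x))"
  unfolding save_row_def
proof (rule triple_for[where m = d and C = 12 and
      I = "\<lambda>k s'. fst s' 25 = (\<lambda>x. if fst s 19 0 * int d \<le> x \<and> x < fst s 19 0 * int d + int k
       then fst s 26 (x - fst s 19 0 * int d) else fst s 25 x)"])
  let ?body = "Store 25 (Add (Mul (var 19) (var 3)) (var 11)) (Ld 26 (var 11))"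
  fix k s' assume k: "k < d" and I: "fst s' 25 = (\<lambda>x. if fst s 19 0 * int d \<le> x \<and> x < fst s 19 0 * int d + int k
       then fst s 26 (x - fst s 19 0 * int d) else fst s 25 x)" and kv: "fst s' 11 0 = int k"
    and f: "\<forall>k. k \<notin> insert 11 (writes ?body) \<longrightarrow> fst s' k = fst s k"
      "\<forall>k. k \<notin> rwrites ?body \<longrightarrow> snd s' k = snd s k"
  show "triple ?body s' (\<lambda>s'' c. c \<le> 12 \<and> fst (st 11 0 (1 + int k) s'') 25 =
      (\<lambda>x. if fst s 19 0 * int d \<le> x \<and> x < fst s 19 0 * int d + int (Suc k)
       then fst s 26 (x - fst s 19 0 * int d) else fst s 25 x))"
    by (rule triple_Store) (insert L le[OF k] I kv f, auto simp: layout_def)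
qed (use L in \<open>auto simp: layout_def\<close>)

section \<open>Invariants of the table under one relaxation\<close>

definition entry_of :: "state \<Rightarrow> int \<Rightarrow> nat \<Rightarrow> int" where
  "entry_of s q i = (if i < d then fst s 25 (q * int d + int i) else 0)"

text \<open>The number \<open>t\<close> counts relaxations. Each raises a multiplicity by at most
  one, whence the bound on array 25; the number of rounds would not do, since in-place updates can
  lengthen a multiset several times per round.\<close>

definition table_inv :: "int \<Rightarrow> int \<Rightarrow> state \<Rightarrow> bool" where
  "table_inv W t s \<longleftrightarrow> layout s \<and> fst s 7 0 = W \<and> fst s 8 0 = slots W \<and> fst s 20 0 = 2 * W + 1 \<and>
     (\<forall>i<d. fst s 21 (int i) = \<gamma> i \<and> fst s 22 (int i) = \<sigma> i) \<and>
     (\<forall>x. 0 \<le> fst s 25 x \<and> fst s 25 x \<le> t) \<and>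
     (\<forall>q. 0 \<le> q \<and> q < slots W \<and> 0 < fst s 23 q \<longrightarrow> valid_entry W q (fst s 24 q) (entry_of s q))"

abbreviation reached_in :: "int \<Rightarrow> state \<Rightarrow> (nat \<Rightarrow> int) \<Rightarrow> bool" where
  "reached_in W s \<equiv> reached W (fst s 23) (fst s 24)"

definition in_window :: "int \<Rightarrow> (nat \<Rightarrow> int) \<Rightarrow> bool" where
  "in_window W v \<longleftrightarrow> v \<in> multisets d \<and> \<bar>sg v\<bar> \<le> W"

definition add_unit :: "(nat \<Rightarrow> int) \<Rightarrow> nat \<Rightarrow> nat \<Rightarrow> int" where
  "add_unit v l i = v i + unit_at l i"

definition refines :: "int \<Rightarrow> state \<Rightarrow> state \<Rightarrow> bool" where
  "refines W s s' \<longleftrightarrow> (\<forall>v. in_window W v \<longrightarrow> reached_in W s v \<longrightarrow> reached_in W s' v)"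

lemma ix_cong: "(\<And>i. i < n \<Longrightarrow> u i = v i) \<Longrightarrow> ix u = ix v"
  unfolding ix_eq_iff basis_lattice_def by (intro exI[of _ "\<lambda>_. 0"]) auto

lemma slot_mod: "\<bar>sg v\<bar> \<le> W \<Longrightarrow> slot W v mod (2 * W + 1) = sg v + W"
  by (simp add: slot_def abs_le_iff)

lemma sg_add_unit: "l < d \<Longrightarrow> dot d f (add_unit v l) = dot d f v + f l"
  by (simp add: add_unit_def[abs_def] dot_simps)

lemma add_unit_multisets: "l < d \<Longrightarrow> v \<in> multisets d \<Longrightarrow> add_unit v l \<in> multisets d"
  by (auto simp: multisets_def add_unit_def unit_at_def)

lemma slot_add_unit:
  assumes "ix u = ix v" "sg u = sg v" "l < d"
  shows "slot W (add_unit u l) = slot W (add_unit v l)"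
  using assms ix_add[of u "unit_at l" v] by (simp add: slot_def sg_add_unit add_unit_def[abs_def] dot_simps)

lemma triple_improve:
  assumes inv: "table_inv W t s" and q: "fst s 16 0 = q" "0 \<le> q" "q < slots W" "0 < fst s 23 q"
    and l: "fst s 17 0 = int l" "l < d"
    and u: "u = add_unit (entry_of s q) l" "in_window W u" "fst s 19 0 = slot W u"
    and row: "\<And>i. i < d \<Longrightarrow> fst s 26 (int i) = u i"
    and t: "0 \<le> t" "t + 1 \<le> N ^ 14"
  shows "triple improve s (\<lambda>s' c. c \<le> 40 * d + 60 \<and> table_inv W (t + 1) s' \<and> refines W s s' \<and>
    (\<forall>v. in_window W v \<longrightarrow> slot W v = q \<longrightarrow> reached_in W s v \<longrightarrow> reached_in W s' (add_unit v l)))"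
    (is "triple improve s ?Q")
proof (rule triple_bounded)
  assume bs: "bounded s"
  have L: "layout s" using inv by (simp add: table_inv_def)
  have uw: "u \<in> multisets d" "\<bar>sg u\<bar> \<le> W" using u(2) by (auto simp: in_window_def)
  have ve: "valid_entry W q (fst s 24 q) (entry_of s q)" using inv q by (simp add: table_inv_def)
  have Cq: "fst s 24 q + \<gamma> l = cost u"
    using ve l(2) by (simp add: valid_entry_def u sg_add_unit)
  have g: "fst s 21 (int l) = \<gamma> l" using inv l by (simp add: table_inv_def)
  have q': "0 \<le> slot W u" "slot W u < slots W" using slot_bounds[OF uw(2)] by auto
  have ub: "0 \<le> u i \<and> u i \<le> t + 1" for i
  proof -
    have "0 \<le> entry_of s q i \<and> entry_of s q i \<le> t" for i
      using inv t by (simp add: entry_of_def table_inv_def)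
    from this[of i] show ?thesis by (auto simp: u add_unit_def unit_at_def)
  qed
  \<comment> \<open>Exponents 8 for \<gamma>, 14 for the multiplicities and 1 for the number of
    terms stay below the exponent 24 of the cost array.\<close>
  have cle: "\<bar>cost u\<bar> \<le> N ^ 24"
  proof -
    have "\<bar>cost u\<bar> \<le> (\<Sum>i<d. N ^ 8 * N ^ 14)" unfolding dot_def
    proof (intro order_trans[OF sum_abs] sum_mono)
      fix i assume "i \<in> {..<d}"
      then have "\<gamma> i = fst s 21 (int i)" using inv by (simp add: table_inv_def)
      moreover have "\<bar>fst s 21 (int i)\<bar> \<le> N ^ env 21" using bs unfolding bounded_def by blast
      ultimately have "\<bar>\<gamma> i\<bar> \<le> N ^ 8" by simp
      moreover have "\<bar>u i\<bar> \<le> N ^ 14" using ub[of i] t by simp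
      ultimately show "\<bar>\<gamma> i * u i\<bar> \<le> N ^ 8 * N ^ 14" unfolding abs_mult using N_ge by (intro mult_mono) auto
    qed
    also have "\<dots> = int d * N ^ 22" by (simp add: power_add[symmetric])
    also have "\<dots> \<le> N * N ^ 22" using d_le n_le_N N_ge by (intro mult_right_mono) auto
    also have "\<dots> = N ^ 23" by (simp add: eval_nat_numeral)
    also have "\<dots> \<le> N ^ 24" by (rule N_power_mono) simp
    finally show ?thesis .
  qed
  \<comment> \<open>All multisets in slot \<open>q\<close> share class and sum with the stored one,
    so their extensions share a slot and a single relaxation serves them all.\<close>
  have same: "slot W (add_unit v l) = slot W u" if v: "in_window W v" "slot W v = q" for v
  proof -
    have "ix v = ix (entry_of s q)" "sg v = sg (entry_of s q)"
      using slot_eq[of v W "entry_of s q"] v ve by (auto simp: valid_entry_def in_window_def)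
    then show ?thesis unfolding u by (rule slot_add_unit) (rule l)
  qed
  have low: "cost u \<le> cost (add_unit v l)" if v: "slot W v = q" "reached_in W s v" for v
    using v Cq l(2) by (simp add: reached_def sg_add_unit)
  show "triple improve s ?Q"
    unfolding improve_def
  proof (rule triple_Cond)
    assume c: "bval (Neg (Conj (Less (Num 0) (Ld 23 (var 19)))
       (Neg (Less (Add (Ld 24 (var 16)) (Ld 21 (var 17))) (Ld 24 (var 19)))))) s"
    then have better: "0 < fst s 23 (slot W u) \<longrightarrow> cost u < fst s 24 (slot W u)"
      using q l u g Cq by auto
    let ?s1 = "st 23 (slot W u) 1 s" and ?s2 = "st 24 (slot W u) (cost u) (st 23 (slot W u) 1 s)"
    let ?Q1 = "\<lambda>s' c. ?Q s' (bnodes (Neg (Conj (Less (Num 0) (Ld 23 (var 19)))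
       (Neg (Less (Add (Ld 24 (var 16)) (Ld 21 (var 17))) (Ld 24 (var 19)))))) + 1 + c)"
    have "triple save_row ?s2 (\<lambda>s' c. ?Q1 s' (anodes (var 19) + anodes (Num 1) + 1 +
        (anodes (var 19) + anodes (Add (Ld 24 (var 16)) (Ld 21 (var 17))) + 1 + c)))"
    proof (rule triple_mono[OF triple_save_row])
      show "layout ?s2" using L by (simp add: layout_def)
      show "\<bar>fst ?s2 26 (int i)\<bar> \<le> N ^ 14" if "i < d" for i
        using that row ub[of i] t by simp
      fix s' c assume s': "c \<le> 40 * d + 9 \<and> fst s' 25 =
          (\<lambda>x. if fst ?s2 19 0 * int d \<le> x \<and> x < fst ?s2 19 0 * int d + int d
           then fst ?s2 26 (x - fst ?s2 19 0 * int d) else fst ?s2 25 x)" "bounded s'"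
        "\<forall>k. k \<notin> writes save_row \<longrightarrow> fst s' k = fst ?s2 k"
        "\<forall>k. k \<notin> rwrites save_row \<longrightarrow> snd s' k = snd ?s2 k"
      have F': "fst s' 23 = (fst s 23)(slot W u := 1)" and C': "fst s' 24 = (fst s 24)(slot W u := cost u)"
        using s'(3) by auto
      have Y': "fst s' 25 x = (if slot W u * int d \<le> x \<and> x < slot W u * int d + int d
           then fst s 26 (x - slot W u * int d) else fst s 25 x)" for x
        using s'(1) u(3) by simp
      have E1: "entry_of s' (slot W u) = u"
      proof
        fix i show "entry_of s' (slot W u) i = u i"
          using uw(1) row[of i] by (auto simp: entry_of_def Y' multisets_def)
      qed
      have E2: "entry_of s' q' = entry_of s q'" if "q' \<noteq> slot W u" for q'
      proof
        fix i
        have "\<not> (slot W u * int d \<le> q' * int d + int i \<and> q' * int d + int i < slot W u * int d + int d)"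
          if i: "i < d"
        proof (cases "q' < slot W u")
          case True
          then have "(q' + 1) * int d \<le> slot W u * int d" by (intro mult_right_mono) auto
          then show ?thesis using i by (simp add: distrib_right)
        next
          case False
          then have "(slot W u + 1) * int d \<le> q' * int d" using that \<open>q' \<noteq> slot W u\<close> by (intro mult_right_mono) auto
          then show ?thesis by (simp add: distrib_right)
        qed
        then show "entry_of s' q' i = entry_of s q' i" by (auto simp: entry_of_def Y')
      qed
      have "valid_entry W q' (fst s' 24 q') (entry_of s' q')"
        if "0 \<le> q'" "q' < slots W" "0 < fst s' 23 q'" for q'
      proof (cases "q' = slot W u")
        case True
        then show ?thesis using uw by (simp add: E1 C' valid_entry_def)
      next
        case False
        then show ?thesis using that inv by (simp add: E2 C' F' table_inv_def)
      qed
      moreover have "0 \<le> fst s' 25 x \<and> fst s' 25 x \<le> t + 1" for x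
      proof (cases "slot W u * int d \<le> x \<and> x < slot W u * int d + int d")
        case True
        then obtain i where "x = slot W u * int d + int i" "i < d"
          by (intro that[of "nat (x - slot W u * int d)"]) auto
        then show ?thesis using ub[of i] row[of i] by (simp add: Y')
      next
        case False
        have "0 \<le> fst s 25 x \<and> fst s 25 x \<le> t" using inv by (simp add: table_inv_def)
        then show ?thesis using False by (auto simp: Y')
      qed
      ultimately have inv': "table_inv W (t + 1) s'"
        using inv s'(3) by (simp add: table_inv_def layout_def)
      have "refines W s s'"
        using better by (auto simp: refines_def reached_def F' C')
      moreover have "reached_in W s' (add_unit v l)"
        if "in_window W v" "slot W v = q" "reached_in W s v" for v
        using same[OF that(1,2)] low[OF that(2,3)] by (simp add: reached_def F' C')
      ultimately show "?Q1 s' (anodes (var 19) + anodes (Num 1) + 1 +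
        (anodes (var 19) + anodes (Add (Ld 24 (var 16)) (Ld 21 (var 17))) + 1 + c))"
        using s'(1) inv' by simp
    qed
    then show "triple (Store 23 (var 19) (Num 1) ;;
        Store 24 (var 19) (Add (Ld 24 (var 16)) (Ld 21 (var 17))) ;; save_row) s ?Q1"
      by - (rule triple_Seq_Store_degree, simp, simp, simp, rule triple_Seq_Store,
        insert u(3) q l g Cq cle, simp_all)
  next
    assume c: "\<not> bval (Neg (Conj (Less (Num 0) (Ld 23 (var 19)))
       (Neg (Less (Add (Ld 24 (var 16)) (Ld 21 (var 17))) (Ld 24 (var 19)))))) s"
    then have "0 < fst s 23 (slot W u)" "fst s 24 (slot W u) \<le> cost u"
      using q l u g Cq by auto
    then have "reached_in W s (add_unit v l)"
      if "in_window W v" "slot W v = q" "reached_in W s v" for v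
      using same[OF that(1,2)] low[OF that(2,3)] by (simp add: reached_def)
    moreover have "table_inv W (t + 1) s"
      using inv unfolding table_inv_def by (auto intro: order_trans)
    ultimately show "triple Skip s (\<lambda>s' c. ?Q s' (bnodes (Neg (Conj (Less (Num 0) (Ld 23 (var 19)))
       (Neg (Less (Add (Ld 24 (var 16)) (Ld 21 (var 17))) (Ld 24 (var 19)))))) + 1 + c))"
      by (intro triple_Skip) (simp add: refines_def)
  qed simp
qed


lemma entry_of_cong: "fst s' 25 = fst s 25 \<Longrightarrow> entry_of s' = entry_of s"
  by (simp add: fun_eq_iff entry_of_def)

lemma table_inv_frame:
  assumes "\<forall>k. k \<notin> {10, 11, 12, 15, 16, 17, 18, 19, 26} \<longrightarrow> fst s' k = fst s k"
  shows "table_inv W t s' \<longleftrightarrow> table_inv W t s" "reached_in W s' = reached_in W s"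
proof -
  have "entry_of s' = entry_of s" using assms by (intro entry_of_cong) simp
  then show "table_inv W t s' \<longleftrightarrow> table_inv W t s" "reached_in W s' = reached_in W s"
    using assms by (simp_all add: table_inv_def layout_def)
qed

lemma triple_extend:
  assumes inv: "table_inv W t s" and q: "fst s 16 0 = q" "0 \<le> q" "q < slots W" "0 < fst s 23 q"
    and l: "fst s 17 0 = int l" "l < d"
    and u: "u = add_unit (entry_of s q) l" "in_window W u" "fst s 18 0 = sg u"
    and t: "0 \<le> t" "t + 1 \<le> N ^ 14"
  shows "triple extend s (\<lambda>s' c. c \<le> 120 * (n + 1)^2 + 40 * n + 80 * d + 120 \<and>
    table_inv W (t + 1) s' \<and> refines W s s' \<and>
    (\<forall>v. in_window W v \<longrightarrow> slot W v = q \<longrightarrow> reached_in W s v \<longrightarrow> reached_in W s' (add_unit v l)))"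
    (is "triple extend s ?Q")
proof -
  have L: "layout s" using inv by (simp add: table_inv_def)
  let ?p4 = "19 ::= Add (Mul (var 12) (var 20)) (Add (var 18) (var 7)) ;; improve"
  show ?thesis
    unfolding extend_def
  proof (rule triple_Seq_mono[OF triple_load_row[OF L]], goal_cases)
    case s1: (1 s1 c1)
    let ?e = "Add (Ld 26 (var 17)) (Num 1)"
    let ?s2 = "st 26 (aval (var 17) s1) (aval ?e s1) s1"
    have y1: "fst s1 26 (int i) = entry_of s q i" if "i < d" for i
      using s1(1) that q by (simp add: entry_of_def)
    have y2: "fst ?s2 26 (int i) = u i" if "i < d" for i
      using y1[OF that] y1[OF l(2)] s1(3) l by (auto simp: u(1) add_unit_def unit_at_def)
    have f2: "\<forall>k. k \<notin> {11, 26} \<longrightarrow> fst ?s2 k = fst s k" using s1(3) by simp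
    have le: "\<bar>aval ?e s1\<bar> \<le> N ^ env 26"
    proof -
      have "0 \<le> entry_of s q l \<and> entry_of s q l \<le> t" using inv t by (simp add: entry_of_def table_inv_def)
      then have "\<bar>aval ?e s1\<bar> \<le> N ^ 14" using y1[OF l(2)] s1(3) l t by simp
      then show ?thesis using N_power_mono[of 14 15] by simp
    qed
    show ?case
    proof (rule triple_Seq_Store)
      show "triple (row_to_rhs ;; solve ;; ?p4) ?s2 (\<lambda>s' c. ?Q s' (c1 + (anodes (var 17) + anodes ?e + 1 + c)))"
      proof (rule triple_Seq_mono[OF triple_row_to_rhs])
        show "layout ?s2" using L f2 by (simp add: layout_def)
        fix s3 c3 assume s3: "c3 \<le> 40 * n + 9 \<and> (\<forall>i<n. snd s3 2 (int i) = fst ?s2 26 (int i))" "bounded s3"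
          "\<forall>k. k \<notin> writes row_to_rhs \<longrightarrow> fst s3 k = fst ?s2 k"
          "\<forall>k. k \<notin> rwrites row_to_rhs \<longrightarrow> snd s3 k = snd ?s2 k"
        have f3: "\<forall>k. k \<notin> {11, 26} \<longrightarrow> fst s3 k = fst s k" "fst s3 26 = fst ?s2 26"
          using s3(3) f2 by simp_all
        have L3: "layout s3" using L f3 by (simp add: layout_def)
        show "triple (solve ;; ?p4) s3 (\<lambda>s' c. ?Q s' (c1 + (anodes (var 17) + anodes ?e + 1 + (c3 + c))))"
        proof (rule triple_Seq_mono[OF triple_solve[OF L3 refl]], goal_cases)
          case s4: (1 s4 c4)
          have f4: "\<forall>k. k \<notin> {10, 11, 12, 26} \<longrightarrow> fst s4 k = fst s k" "fst s4 26 = fst ?s2 26"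
            using s4(3) f3 by simp_all
          have "ix (\<lambda>i. snd s3 2 (int i)) = ix u"
            using s3(1) y2 n_le_d by (intro ix_cong) simp
          then have g: "fst s4 12 0 = ix u" using s4(1) by simp
          let ?f = "Add (Mul (var 12) (var 20)) (Add (var 18) (var 7))"
          let ?s5 = "st 19 (aval (Num 0) s4) (aval ?f s4) s4"
          have f5: "\<forall>k. k \<notin> {10, 11, 12, 19, 26} \<longrightarrow> fst ?s5 k = fst s k" "fst ?s5 26 = fst ?s2 26"
            using f4 by simp_all
          have slot5: "fst ?s5 19 0 = slot W u"
            using g u(3) f4(1) inv by (simp add: slot_def table_inv_def)
          have fr5: "table_inv W t' ?s5 \<longleftrightarrow> table_inv W t' s" "reached_in W ?s5 = reached_in W s" for t'
            by (rule table_inv_frame; use f5(1) in simp)+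
          have e5: "entry_of ?s5 = entry_of s" using f5(1) by (intro entry_of_cong) simp
          show ?case
          proof (rule triple_Seq_Store_degree)
            have "triple improve ?s5 (\<lambda>s' c. c \<le> 40 * d + 60 \<and> table_inv W (t + 1) s' \<and> refines W ?s5 s' \<and>
                (\<forall>v. in_window W v \<longrightarrow> slot W v = q \<longrightarrow> reached_in W ?s5 v \<longrightarrow> reached_in W s' (add_unit v l)))"
            proof (rule triple_improve)
              show "table_inv W t ?s5" using inv fr5 by simp
              show "fst ?s5 16 0 = q" "0 \<le> q" "q < slots W" "0 < fst ?s5 23 q" "fst ?s5 17 0 = int l" "l < d"
                using f5(1) q l by simp_all
              show "u = add_unit (entry_of ?s5 q) l" "in_window W u" "fst ?s5 19 0 = slot W u"
                using u e5 slot5 by simp_all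
              show "fst ?s5 26 (int i) = u i" if "i < d" for i using y2[OF that] f5(2) by simp
              show "0 \<le> t" "t + 1 \<le> N ^ 14" by fact+
            qed
            then show "triple improve ?s5 (\<lambda>s' c. ?Q s' (c1 + (anodes (var 17) + anodes ?e + 1 + (c3 + (c4 +
                (anodes (Num 0) + anodes ?f + 1 + c))))))"
            proof (rule triple_mono)
              fix s' c assume a: "c \<le> 40 * d + 60 \<and> table_inv W (t + 1) s' \<and> refines W ?s5 s' \<and>
                (\<forall>v. in_window W v \<longrightarrow> slot W v = q \<longrightarrow> reached_in W ?s5 v \<longrightarrow> reached_in W s' (add_unit v l))"
              have "refines W s s'" using a fr5(2) by (simp add: refines_def)
              then show "?Q s' (c1 + (anodes (var 17) + anodes ?e + 1 + (c3 + (c4 + (anodes (Num 0) + anodes ?f + 1 + c)))))"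
                using a fr5(2) s1(1) s3(1) s4(1) by simp
            qed
          qed simp_all
        qed
      qed
    qed (use le in simp_all)
  qed
qed

definition relax_cost :: nat where
  "relax_cost = 120 * (n + 1)^2 + 40 * n + 80 * d + 170"

lemma triple_relax:
  assumes inv: "table_inv W t s" and q: "fst s 16 0 = q" "0 \<le> q" "q < slots W"
    and l: "fst s 17 0 = int l" "l < d" and W: "0 \<le> W"
    and t: "0 \<le> t" "t + 1 \<le> N ^ 14"
  shows "triple relax s (\<lambda>s' c. c \<le> relax_cost \<and> table_inv W (t + 1) s' \<and> refines W s s' \<and>
    (\<forall>v. in_window W v \<longrightarrow> slot W v = q \<longrightarrow> reached_in W s v \<longrightarrow> \<bar>sg v + \<sigma> l\<bar> \<le> W \<longrightarrow>
      reached_in W s' (add_unit v l)))"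
    (is "triple relax s ?Q")
proof -
  let ?f = "Add (Sub (RMod (RInt (var 16)) (var 20)) (var 7)) (Ld 22 (var 17))"
  let ?s1 = "st 18 (aval (Num 0) s) (aval ?f s) s"
  let ?u = "add_unit (entry_of s q) l"
  have fr1: "table_inv W t' ?s1 \<longleftrightarrow> table_inv W t' s" "reached_in W ?s1 = reached_in W s" for t'
    by (rule table_inv_frame; simp)+
  have v1: "fst ?s1 18 0 = q mod (2 * W + 1) - W + \<sigma> l"
    using inv q(1) l W by (simp add: table_inv_def)
  have ve: "valid_entry W q (fst s 24 q) (entry_of s q)" if "0 < fst s 23 q"
    using inv q that by (simp add: table_inv_def)
  have vu: "fst ?s1 18 0 = sg ?u" if "0 < fst s 23 q"
  proof -
    have "\<bar>sg (entry_of s q)\<bar> \<le> W" "slot W (entry_of s q) = q" using ve[OF that] by (auto simp: valid_entry_def)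
    then show ?thesis using slot_mod[of "entry_of s q" W] l(2) unfolding v1 by (simp add: sg_add_unit)
  qed
  let ?cond = "Conj (Less (Num 0) (Ld 23 (var 16)))
         (Conj (Neg (Less (var 18) (Sub (Num 0) (var 7)))) (Neg (Less (var 7) (var 18))))"
  have cond: "bval ?cond ?s1 \<longleftrightarrow> 0 < fst s 23 q \<and> \<bar>sg ?u\<bar> \<le> W"
    using vu q(1) inv by (auto simp: table_inv_def abs_le_iff)
  show ?thesis
    unfolding relax_def
  proof (rule triple_Seq_Store_degree)
    show "triple (Cond ?cond extend Skip) ?s1 (\<lambda>s' c. ?Q s' (anodes (Num 0) + anodes ?f + 1 + c))"
    proof (rule triple_Cond)
      assume "bval ?cond ?s1"
      then have c: "0 < fst s 23 q" "\<bar>sg ?u\<bar> \<le> W" using cond by auto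
      have "?u \<in> multisets d" using ve[OF c(1)] l(2) by (intro add_unit_multisets) (auto simp: valid_entry_def)
      then have w: "in_window W ?u" using c by (simp add: in_window_def)
      have e1: "entry_of ?s1 = entry_of s" by (intro entry_of_cong) simp
      have "triple extend ?s1 (\<lambda>s' c. c \<le> 120 * (n + 1)^2 + 40 * n + 80 * d + 120 \<and>
          table_inv W (t + 1) s' \<and> refines W ?s1 s' \<and>
          (\<forall>v. in_window W v \<longrightarrow> slot W v = q \<longrightarrow> reached_in W ?s1 v \<longrightarrow> reached_in W s' (add_unit v l)))"
      proof (rule triple_extend)
        show "table_inv W t ?s1" using inv fr1 by simp
        show "fst ?s1 16 0 = q" "0 \<le> q" "q < slots W" "0 < fst ?s1 23 q" "fst ?s1 17 0 = int l" "l < d"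
          using q l c by simp_all
        show "?u = add_unit (entry_of ?s1 q) l" "in_window W ?u" "fst ?s1 18 0 = sg ?u"
          using e1 w vu[OF c(1)] by simp_all
        show "0 \<le> t" "t + 1 \<le> N ^ 14" by fact+
      qed
      then show "triple extend ?s1 (\<lambda>s' c. ?Q s' (anodes (Num 0) + anodes ?f + 1 + (bnodes ?cond + 1 + c)))"
      proof (rule triple_mono)
        fix s' c assume a: "c \<le> 120 * (n + 1)^2 + 40 * n + 80 * d + 120 \<and>
          table_inv W (t + 1) s' \<and> refines W ?s1 s' \<and>
          (\<forall>v. in_window W v \<longrightarrow> slot W v = q \<longrightarrow> reached_in W ?s1 v \<longrightarrow> reached_in W s' (add_unit v l))"
        have "refines W s s'" using a fr1(2) by (simp add: refines_def)
        then show "?Q s' (anodes (Num 0) + anodes ?f + 1 + (bnodes ?cond + 1 + c))"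
          using a fr1(2) by (simp add: relax_cost_def)
      qed
    next
      assume "\<not> bval ?cond ?s1"
      then have c: "0 < fst s 23 q \<Longrightarrow> \<not> \<bar>sg ?u\<bar> \<le> W" using cond by auto
      \<comment> \<open>After a rejection there is nothing to reach: any reached multiset in slot
        \<open>q\<close> has the sum of the stored entry, whose extension leaves the window.\<close>
      have no: False if v: "in_window W v" "slot W v = q" "reached_in W s v" "\<bar>sg v + \<sigma> l\<bar> \<le> W" for v
      proof -
        have F: "0 < fst s 23 q" using v by (simp add: reached_def)
        have "sg v = sg (entry_of s q)"
          using slot_eq(2)[of v W "entry_of s q"] v ve[OF F] by (auto simp: valid_entry_def in_window_def)
        then show False using c[OF F] v(4) l(2) by (simp add: sg_add_unit)
      qed
      have "table_inv W (t + 1) s" using inv unfolding table_inv_def by (auto intro: order_trans)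
      then have "table_inv W (t + 1) ?s1" using fr1 by simp
      moreover have "refines W s ?s1" using fr1(2) by (simp add: refines_def)
      ultimately show "triple Skip ?s1 (\<lambda>s' c. ?Q s' (anodes (Num 0) + anodes ?f + 1 + (bnodes ?cond + 1 + c)))"
        using no by (intro triple_Skip) (auto simp: relax_cost_def)
    qed simp
  qed simp_all
qed

section \<open>Rounds of the Bellman-Ford algorithm\<close>

definition reached_upto :: "int \<Rightarrow> nat \<Rightarrow> state \<Rightarrow> bool" where
  "reached_upto W r s \<longleftrightarrow> (\<forall>v. in_window W v \<and> total d v \<le> int r \<longrightarrow> reached_in W s v)"

text \<open>Stated through multisets of bounded length and not through the current entry of slot
  \<open>q\<close>: an inequality between table costs could fail once slot \<open>q\<close> is
  improved later in the round, whereas this condition persists.\<close>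

definition relaxed_at :: "int \<Rightarrow> nat \<Rightarrow> int \<Rightarrow> nat \<Rightarrow> state \<Rightarrow> bool" where
  "relaxed_at W r q l s \<longleftrightarrow> (\<forall>v. in_window W v \<and> total d v \<le> int r \<and> slot W v = q \<and> \<bar>sg v + \<sigma> l\<bar> \<le> W \<longrightarrow>
     reached_in W s (add_unit v l))"

lemma in_window_add_unit:
  "in_window W v \<Longrightarrow> l < d \<Longrightarrow> \<bar>sg v + \<sigma> l\<bar> \<le> W \<Longrightarrow> in_window W (add_unit v l)"
  by (simp add: in_window_def add_unit_multisets sg_add_unit)

lemma refines_reached_upto: "refines W s s' \<Longrightarrow> reached_upto W r s \<Longrightarrow> reached_upto W r s'"
  by (simp add: refines_def reached_upto_def)

lemma refines_relaxed_at: "refines W s s' \<Longrightarrow> l < d \<Longrightarrow> relaxed_at W r q l s \<Longrightarrow> relaxed_at W r q l s'"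
  using in_window_add_unit by (simp add: refines_def relaxed_at_def)

text \<open>Peeling off one generator inside the window leaves a predecessor that is already
  reached; the relaxation of its slot by that generator reaches the multiset itself.\<close>

lemma reached_upto_Suc:
  assumes W: "D \<le> W" and r: "reached_upto W r s"
    and rel: "\<And>q l. 0 \<le> q \<Longrightarrow> q < slots W \<Longrightarrow> l < d \<Longrightarrow> relaxed_at W r q l s"
  shows "reached_upto W (Suc r) s"
  unfolding reached_upto_def
proof (intro allI impI)
  fix v assume v: "in_window W v \<and> total d v \<le> int (Suc r)"
  show "reached_in W s v"
  proof (cases "total d v \<le> int r")
    case True
    then show ?thesis using r v by (simp add: reached_upto_def)
  next
    case False
    then obtain k where k: "k < d" "1 \<le> v k" "\<bar>sg v - \<sigma> k\<bar> \<le> W"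
      using peel[where f = \<sigma> and d = d and v = v and W = W and D = D] sigma_le W v
      by (auto simp: in_window_def)
    let ?u = "\<lambda>i. v i - unit_at k i"
    have u: "in_window W ?u" "total d ?u \<le> int r" "\<bar>sg ?u + \<sigma> k\<bar> \<le> W"
      using v k multisets_minus_unit[of v d k] by (auto simp: in_window_def dot_simps)
    then have s: "0 \<le> slot W ?u" "slot W ?u < slots W" using slot_bounds by (auto simp: in_window_def)
    have "add_unit ?u k = v" by (simp add: add_unit_def[abs_def])
    moreover have "reached_in W s (add_unit ?u k)"
      using rel[OF s k(1)] u unfolding relaxed_at_def by blast
    ultimately show ?thesis by simp
  qed
qed

definition fill_cost :: "nat \<Rightarrow> nat" where
  "fill_cost m = ((((relax_cost + 12) * d + 9) + 12) * m + 9 + 12) * m + 20"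

lemma triple_fill_table:
  assumes inv: "table_inv W 0 (st 23 W 1 s)" and W: "D \<le> W" "0 \<le> W"
    and start: "reached_upto W 0 (st 23 W 1 s)" and m: "slots W = int m"
  shows "triple fill_table s (\<lambda>s' c. c \<le> fill_cost m \<and>
    closed_table W (fst s' 23) (fst s' 24) (entry_of s'))"
proof (rule triple_bounded)
  assume bs: "bounded s"
  have mN: "int m \<le> N ^ 6"
  proof -
    have "\<bar>fst s 8 0\<bar> \<le> N ^ env 8" using bs unfolding bounded_def by blast
    then show ?thesis using inv m by (simp add: table_inv_def)
  qed
  let ?s0 = "st 23 W 1 s"
  have s7: "fst s 7 0 = W" using inv by (simp add: table_inv_def)
  \<comment> \<open>\<open>(r * m + q) * d + l\<close> relaxations precede this one. With
    \<open>m \<le> N ^ 6\<close> and \<open>d \<le> N\<close> there are at most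
    \<open>N ^ 13\<close> in all, which fits the exponent 14 of the stored multisets.\<close>
  have iter: "(int r * int m + int q) * int d + int l + 1 \<le> N ^ 14" if "r < m" "q < m" "l < d" for r q l
  proof -
    have "int r * int m + int q + 1 \<le> int m * int m"
    proof -
      have "(int r + 1) * int m \<le> int m * int m" using that by (intro mult_right_mono) auto
      then show ?thesis using that by (simp add: distrib_right)
    qed
    then have "(int r * int m + int q + 1) * int d \<le> (int m * int m) * int d" by (intro mult_right_mono) auto
    then have "(int r * int m + int q) * int d + int l + 1 \<le> (int m * int m) * int d"
      using that by (simp add: distrib_right)
    also have "\<dots> \<le> (N ^ 6 * N ^ 6) * N"
      using mN d_le n_le_N N_ge by (intro mult_mono) auto
    also have "\<dots> = N ^ 13" by (simp add: eval_nat_numeral)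
    also have "\<dots> \<le> N ^ 14" by (rule N_power_mono) simp
    finally show ?thesis .
  qed
  have time0: "0 \<le> (int r * int m + int q) * int d + int l" for r q l by simp
  let ?inner = "for_loop 17 3 relax" and ?middle = "for_loop 16 8 (for_loop 17 3 relax)"
  let ?I1 = "\<lambda>r s'. table_inv W (int r * int m * int d) s' \<and> reached_upto W r s'"
  let ?I2 = "\<lambda>r q s'. table_inv W ((int r * int m + int q) * int d) s' \<and> reached_upto W r s' \<and>
      (\<forall>q' l'. 0 \<le> q' \<and> q' < int q \<and> l' < d \<longrightarrow> relaxed_at W r q' l' s')"
  let ?I3 = "\<lambda>r q l s'. table_inv W ((int r * int m + int q) * int d + int l) s' \<and> reached_upto W r s' \<and>
      (\<forall>q' l'. 0 \<le> q' \<and> q' < int q \<and> l' < d \<longrightarrow> relaxed_at W r q' l' s') \<and>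
      (\<forall>l'. l' < l \<longrightarrow> relaxed_at W r (int q) l' s')"
  have frame: "?I1 r (st 15 0 x s') = ?I1 r s'" "?I2 r q (st 15 0 x s') = ?I2 r q s'"
    "?I2 r q (st 16 0 x s') = ?I2 r q s'" "?I3 r q l (st 17 0 x s') = ?I3 r q l s'" for r q l x s'
    by (simp_all add: table_inv_frame[of "st 15 0 x s'" s'] table_inv_frame[of "st 16 0 x s'" s']
      table_inv_frame[of "st 17 0 x s'" s'] reached_upto_def relaxed_at_def)
  have T3: "triple ?inner s2 (\<lambda>s' c. c \<le> (relax_cost + 12) * d + 9 \<and> ?I2 r (Suc q) s')"
    if r: "r < m" and q: "q < m" "fst s2 16 0 = int q" and I: "?I2 r q s2" for r q s2
  proof (rule triple_for[where m = d and C = relax_cost and I = "?I3 r q"])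
    show "fst s2 3 0 = int d" using I by (simp add: table_inv_def layout_def)
    show "?I3 r q 0 (st 17 0 0 s2)" using I by (simp only: frame) simp
    fix l s3 assume l: "l < d" and I3: "?I3 r q l s3" and lv: "fst s3 17 0 = int l"
      and f: "\<forall>k. k \<notin> insert 17 (writes relax) \<longrightarrow> fst s3 k = fst s2 k"
        "\<forall>k. k \<notin> rwrites relax \<longrightarrow> snd s3 k = snd s2 k"
    have q3: "fst s3 16 0 = int q" using f q by simp
    have "triple relax s3 (\<lambda>s' c. c \<le> relax_cost \<and> table_inv W ((int r * int m + int q) * int d + int l + 1) s' \<and>
        refines W s3 s' \<and> (\<forall>v. in_window W v \<longrightarrow> slot W v = int q \<longrightarrow> reached_in W s3 v \<longrightarrow>
          \<bar>sg v + \<sigma> l\<bar> \<le> W \<longrightarrow> reached_in W s' (add_unit v l)))"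
      by (rule triple_relax[OF _ q3]) (use I3 lv l W q m iter[OF r q(1) l] time0 in auto)
    then show "triple relax s3 (\<lambda>s'' c. c \<le> relax_cost \<and> ?I3 r q (Suc l) (st 17 0 (1 + int l) s''))"
    proof (rule triple_mono)
      fix s4 c assume a: "c \<le> relax_cost \<and> table_inv W ((int r * int m + int q) * int d + int l + 1) s4 \<and>
        refines W s3 s4 \<and> (\<forall>v. in_window W v \<longrightarrow> slot W v = int q \<longrightarrow> reached_in W s3 v \<longrightarrow>
          \<bar>sg v + \<sigma> l\<bar> \<le> W \<longrightarrow> reached_in W s4 (add_unit v l))"
      have ref: "refines W s3 s4" using a by blast
      have "relaxed_at W r (int q) l s4"
        using a I3 by (auto simp: relaxed_at_def reached_upto_def)
      then have "\<forall>l'. l' < Suc l \<longrightarrow> relaxed_at W r (int q) l' s4"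
        using I3 refines_relaxed_at[OF ref] l by (auto simp: less_Suc_eq)
      moreover have "\<forall>q' l'. 0 \<le> q' \<and> q' < int q \<and> l' < d \<longrightarrow> relaxed_at W r q' l' s4"
        using I3 refines_relaxed_at[OF ref] by blast
      moreover have "reached_upto W r s4" using I3 refines_reached_upto[OF ref] by blast
      moreover have "table_inv W ((int r * int m + int q) * int d + int (Suc l)) s4"
        using a by (simp add: add.assoc add.commute[of 1])
      ultimately show "c \<le> relax_cost \<and> ?I3 r q (Suc l) (st 17 0 (1 + int l) s4)"
        using a by (simp only: frame)
    qed
  next
    fix s' c assume "c \<le> (relax_cost + 12) * d + 9" and I3: "?I3 r q d s'"
    have "relaxed_at W r q' l' s'" if "0 \<le> q'" "q' < int (Suc q)" "l' < d" for q' l'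
      using I3 that by (cases "q' = int q") auto
    moreover have "(int r * int m + int q) * int d + int d = (int r * int m + int (Suc q)) * int d"
      by (simp add: algebra_simps)
    ultimately show "c \<le> (relax_cost + 12) * d + 9 \<and> ?I2 r (Suc q) s'"
      using \<open>c \<le> (relax_cost + 12) * d + 9\<close> I3 by metis
  qed auto
  have T2: "triple ?middle s1 (\<lambda>s' c. c \<le> ((relax_cost + 12) * d + 9 + 12) * m + 9 \<and> ?I1 (Suc r) s')"
    if r: "r < m" and I: "?I1 r s1" for r s1
  proof (rule triple_for[where m = m and C = "(relax_cost + 12) * d + 9" and I = "?I2 r"])
    show "fst s1 8 0 = int m" using I m by (simp add: table_inv_def)
    show "?I2 r 0 (st 16 0 0 s1)" using I by (simp only: frame) auto
    fix q s2 assume q: "q < m" and I2: "?I2 r q s2" and qv: "fst s2 16 0 = int q"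
    show "triple ?inner s2 (\<lambda>s'' c. c \<le> (relax_cost + 12) * d + 9 \<and> ?I2 r (Suc q) (st 16 0 (1 + int q) s''))"
      unfolding frame by (rule T3[OF r q qv I2])
  next
    fix s' c assume "c \<le> ((relax_cost + 12) * d + 9 + 12) * m + 9" and I2: "?I2 r m s'"
    have "reached_upto W (Suc r) s'"
      using I2 m by (intro reached_upto_Suc[OF W(1)]) auto
    moreover have "(int r * int m + int m) * int d = int (Suc r) * int m * int d"
      by (simp add: algebra_simps)
    ultimately show "c \<le> ((relax_cost + 12) * d + 9 + 12) * m + 9 \<and> ?I1 (Suc r) s'"
      using \<open>c \<le> ((relax_cost + 12) * d + 9 + 12) * m + 9\<close> I2 by metis
  qed auto
  have T1: "triple (for_loop 15 8 ?middle) ?s0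
     (\<lambda>s' c. c \<le> (((relax_cost + 12) * d + 9 + 12) * m + 9 + 12) * m + 9 \<and> ?I1 m s')"
  proof (rule triple_for[where m = m and C = "((relax_cost + 12) * d + 9 + 12) * m + 9" and I = ?I1])
    show "fst ?s0 8 0 = int m" using inv m by (simp add: table_inv_def)
    show "?I1 0 (st 15 0 0 ?s0)" using inv start by (simp only: frame) simp
    fix r s1 assume r: "r < m" and I1: "?I1 r s1"
    show "triple ?middle s1 (\<lambda>s'' c. c \<le> ((relax_cost + 12) * d + 9 + 12) * m + 9 \<and> ?I1 (Suc r) (st 15 0 (1 + int r) s''))"
      unfolding frame by (rule T2[OF r I1])
  qed auto
  show "triple fill_table s (\<lambda>s' c. c \<le> fill_cost m \<and> closed_table W (fst s' 23) (fst s' 24) (entry_of s'))"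
    unfolding fill_table_def
  proof (rule triple_Seq_Store_degree)
    have "triple (for_loop 15 8 ?middle) ?s0 (\<lambda>s' c.
        anodes (var 7) + anodes (Num 1) + 1 + c \<le> fill_cost m \<and>
        closed_table W (fst s' 23) (fst s' 24) (entry_of s'))"
    proof (rule triple_mono[OF T1])
      fix s' c assume a: "c \<le> (((relax_cost + 12) * d + 9 + 12) * m + 9 + 12) * m + 9 \<and> ?I1 m s'"
      have "closed_table W (fst s' 23) (fst s' 24) (entry_of s')"
        unfolding closed_table_def using a m by (auto simp: table_inv_def reached_upto_def in_window_def)
      then show "anodes (var 7) + anodes (Num 1) + 1 + c \<le> fill_cost m \<and>
        closed_table W (fst s' 23) (fst s' 24) (entry_of s')"
        using a by (simp add: fill_cost_def)
    qed
    then show "triple (for_loop 15 8 ?middle) (st 23 (aval (var 7) s) (aval (Num 1) s) s) (\<lambda>s' c.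
        anodes (var 7) + anodes (Num 1) + 1 + c \<le> fill_cost m \<and>
        closed_table W (fst s' 23) (fst s' 24) (entry_of s'))"
      using s7 by simp
  qed simp_all
qed

end

section \<open>Tightening one inequality and reading off the answer\<close>

definition set_window :: com where
  "set_window = 7 ::= Mul (Num 2) (Mul (var 6) (var 6)) ;;
     20 ::= Add (Mul (Num 2) (var 7)) (Num 1) ;; 8 ::= Mul (var 5) (var 20)"

text \<open>Ratios are compared by cross multiplication. The value -1 means that no positive
  \<sigma> has been seen; the comparison then reads position -1, but the test of the sign overrides
  its outcome.\<close>

definition choose_ratio :: com where
  "choose_ratio = 19 ::= Num (-1) ;; for_loop 14 3
     (Cond (Conj (Less (Num 0) (Ld 22 (var 14)))
         (Neg (Conj (Neg (Less (var 19) (Num 0)))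
            (Neg (Less (Mul (Ld 21 (var 14)) (Ld 22 (var 19))) (Mul (Ld 21 (var 19)) (Ld 22 (var 14))))))))
       (19 ::= var 14) Skip)"

text \<open>One floor division takes the largest amount that the exchange argument permits. What
  remains of the sum is \<open>D * D\<close> plus a remainder below
  \<open>\<sigma> k \<le> D\<close>, hence at most \<open>2 * (D * D)\<close>: the origin of the
  window.\<close>

definition tighten :: com where
  "tighten = Cond (Conj (RLess (RInt (Mul (var 6) (var 6))) (rvar 4)) (Neg (Less (var 19) (Num 0))))
     (5 ::~ RDiv (RSub (rvar 4) (RInt (Mul (var 6) (var 6)))) (Ld 22 (var 19)) ;;
      RStore 0 (var 19) (RSub (RLd 0 (var 19)) (rvar 5)) ;;
      4 ::~ RSub (rvar 4) (RMul (Ld 22 (var 19)) (rvar 5)))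
     Skip"

definition load_b :: com where
  "load_b = for_loop 11 4 (RStore 2 (var 11) (RLd 0 (var 11)))"

definition load_difference :: com where
  "load_difference = for_loop 11 4
     (RStore 2 (var 11) (RSub (RLd 0 (var 11)) (RInt (Ld 25 (Add (Mul (var 19) (var 3)) (var 11))))))"

text \<open>A sum still above the window means that no \<sigma> is positive, hence infeasibility.
  Otherwise it lies between 0 and \<open>W\<close>, and the reduction modulo \<open>W + 1\<close>
  only turns it into a plain number.\<close>

definition read_answer :: com where
  "read_answer = Cond (RLess (RInt (var 7)) (rvar 4)) (Store 0 (Num 0) (Num 0))
     (load_b ;; solve ;;
      19 ::= Add (Mul (var 12) (var 20)) (Add (RMod (rvar 4) (Add (var 7) (Num 1))) (var 7)) ;;
      Cond (Less (Num 0) (Ld 23 (var 19)))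
        (Cond (Less (Ld 24 (var 7)) (Num 0)) (Store 0 (Num 0) (Num 1))
           (Store 0 (Num 0) (Num 2) ;; load_difference ;; solve))
        (Store 0 (Num 0) (Num 0)))"

lemma finish_writes [simp]:
  "writes set_window = {7, 8, 20}" "rwrites set_window = {}"
  "writes choose_ratio = {14, 19}" "rwrites choose_ratio = {}"
  "writes tighten = {}" "rwrites tighten = {0, 4, 5}"
  "writes load_b = {11}" "rwrites load_b = {2}"
  "writes load_difference = {11}" "rwrites load_difference = {2}"
  by (auto simp: set_window_def choose_ratio_def tighten_def load_b_def load_difference_def)

lemma ratio_trans:
  fixes a b c x y z :: int
  assumes "0 < x" "0 < y" "a * y \<le> b * x" "b * z \<le> c * y" "0 < z"
  shows "a * z \<le> c * x"
proof -
  have "a * y * z \<le> b * x * z" using assms by (intro mult_right_mono) auto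
  also have "b * x * z = b * z * x" by simp
  also have "\<dots> \<le> c * y * x" using assms by (intro mult_right_mono) auto
  finally have "y * (a * z) \<le> y * (c * x)" by (simp add: mult_ac)
  then show ?thesis using assms(2) by simp
qed

context program
begin

definition correct_answer :: "(nat \<Rightarrow> int) \<Rightarrow> state \<Rightarrow> bool" where
  "correct_answer b s \<longleftrightarrow>
     (if fst s 0 0 = 0 then feasible b = {}
      else if fst s 0 0 = 1 then \<forall>K. \<exists>x\<in>feasible b. K < dot n c x
      else (\<lambda>j. snd s 1 (int j)) \<in> feasible b \<and>
        (\<forall>y\<in>feasible b. dot n c y \<le> dot n c (\<lambda>j. snd s 1 (int j))))"

lemma D_pos: "1 \<le> D"
  using pivots_le pivots_pos[of n] by simp

definition functionals :: "state \<Rightarrow> bool" where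
  "functionals s \<longleftrightarrow> (\<forall>i<d. fst s 21 (int i) = \<gamma> i \<and> fst s 22 (int i) = \<sigma> i)"

lemma triple_set_window:
  assumes "fst s 5 0 = pivots n" "fst s 6 0 = D"
  shows "triple set_window s (\<lambda>s' t. t \<le> 60 \<and> fst s' 7 0 = 2 * (D * D) \<and>
     fst s' 20 0 = 2 * (2 * (D * D)) + 1 \<and> fst s' 8 0 = slots (2 * (D * D)))"
  unfolding set_window_def
  by (rule triple_Seq_Store_degree, simp, simp, simp, rule triple_Seq_Store_degree, simp, simp, simp,
      rule triple_Store_degree) (use assms in \<open>simp_all add: slots_def\<close>)

definition best_ratio :: "int \<Rightarrow> nat \<Rightarrow> bool" where
  "best_ratio k m \<longleftrightarrow> (k = -1 \<and> (\<forall>i<m. \<sigma> i \<le> 0)) \<or>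
     (\<exists>k'<d. k = int k' \<and> 0 < \<sigma> k' \<and> (\<forall>i<m. 0 < \<sigma> i \<longrightarrow> \<gamma> k' * \<sigma> i \<le> \<gamma> i * \<sigma> k'))"

lemma triple_choose_ratio:
  assumes L: "layout s" and F: "functionals s"
  shows "triple choose_ratio s (\<lambda>s' t. t \<le> 80 * d + 20 \<and> best_ratio (fst s' 19 0) d)"
  unfolding choose_ratio_def
proof (rule triple_Seq_Store_degree)
  let ?s = "st 19 (aval (Num 0) s) (aval (Num (- 1)) s) s"
  let ?c = "Conj (Less (Num 0) (Ld 22 (var 14)))
         (Neg (Conj (Neg (Less (var 19) (Num 0)))
            (Neg (Less (Mul (Ld 21 (var 14)) (Ld 22 (var 19))) (Mul (Ld 21 (var 19)) (Ld 22 (var 14)))))))"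
  let ?body = "Cond ?c (19 ::= var 14) Skip"
  show "triple (for_loop 14 3 ?body) ?s (\<lambda>s' t. anodes (Num 0) + anodes (Num (-1)) + 1 + t \<le> 80 * d + 20 \<and>
      best_ratio (fst s' 19 0) d)"
  proof (rule triple_for[where m = d and C = 60 and I = "\<lambda>i s'. best_ratio (fst s' 19 0) i"], goal_cases)
    case step: (8 i s')
    note i = step(1) and I = step(2) and iv = step(4) and f = step(5,6)
    have F': "fst s' 21 (int j) = \<gamma> j" "fst s' 22 (int j) = \<sigma> j" if "j < d" for j
      using F f that by (simp_all add: functionals_def)
    have cond: "bval ?c s' \<longleftrightarrow> 0 < \<sigma> i \<and> (fst s' 19 0 < 0 \<or>
        \<gamma> i * fst s' 22 (fst s' 19 0) < fst s' 21 (fst s' 19 0) * \<sigma> i)"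
      using F'[OF i] iv by simp
    show ?case
    proof (rule triple_Cond)
      assume b: "bval ?c s'"
      then have si: "0 < \<sigma> i" using cond by simp
      have "best_ratio (int i) (Suc i)"
        unfolding best_ratio_def
      proof (intro disjI2 exI conjI allI impI)
        fix j assume j: "j < Suc i" "0 < \<sigma> j"
        show "\<gamma> i * \<sigma> j \<le> \<gamma> j * \<sigma> i"
        proof (cases "j = i")
          case False
          then have ji: "j < i" using j by simp
          from I consider "fst s' 19 0 = -1" "\<forall>i'<i. \<sigma> i' \<le> 0"
            | k where "k < d" "fst s' 19 0 = int k" "0 < \<sigma> k" "\<forall>i'<i. 0 < \<sigma> i' \<longrightarrow> \<gamma> k * \<sigma> i' \<le> \<gamma> i' * \<sigma> k"
            unfolding best_ratio_def by blast
          then show ?thesis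
          proof cases
            case 1
            then show ?thesis using ji j(2) by auto
          next
            case (2 k)
            have "\<gamma> i * \<sigma> k < \<gamma> k * \<sigma> i" using b cond 2 F'[OF 2(1)] by auto
            then show ?thesis using ratio_trans[of "\<sigma> i" "\<sigma> k" "\<gamma> i" "\<gamma> k" "\<sigma> j" "\<gamma> j"] 2 ji j(2) si by auto
          qed
        qed simp
      qed (use i si in auto)
      then show "triple (19 ::= var 14) s' (\<lambda>s'' c. bnodes ?c + 1 + c \<le> 60 \<and>
          best_ratio (fst (st 14 0 (1 + int i) s'') 19 0) (Suc i))"
        by - (rule triple_Store_degree, insert iv, simp_all)
    next
      assume b: "\<not> bval ?c s'"
      have "best_ratio (fst s' 19 0) (Suc i)"
      proof -
        from I consider "fst s' 19 0 = -1" "\<forall>i'<i. \<sigma> i' \<le> 0"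
          | k where "k < d" "fst s' 19 0 = int k" "0 < \<sigma> k" "\<forall>i'<i. 0 < \<sigma> i' \<longrightarrow> \<gamma> k * \<sigma> i' \<le> \<gamma> i' * \<sigma> k"
          unfolding best_ratio_def by blast
        then show ?thesis
        proof cases
          case 1
          then show ?thesis using b cond by (auto simp: best_ratio_def less_Suc_eq)
        next
          case (2 k)
          then have "0 < \<sigma> i \<longrightarrow> \<gamma> k * \<sigma> i \<le> \<gamma> i * \<sigma> k" using b cond F'[OF 2(1)] by auto
          then show ?thesis using 2 unfolding best_ratio_def by (auto simp: less_Suc_eq)
        qed
      qed
      then show "triple Skip s' (\<lambda>s'' c. bnodes ?c + 1 + c \<le> 60 \<and>
          best_ratio (fst (st 14 0 (1 + int i) s'') 19 0) (Suc i))"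
        by (intro triple_Skip) simp
    qed simp
  qed (use L in \<open>auto simp: layout_def best_ratio_def\<close>)
qed simp_all

lemma triple_tighten:
  assumes F: "functionals s" and DD: "fst s 6 0 = D" and k: "best_ratio (fst s 19 0) d"
    and b: "\<And>i. i < d \<Longrightarrow> snd s 0 (int i) = b i" "\<And>i. i < d \<Longrightarrow> \<bar>b i\<bar> \<le> NR"
    and beta: "snd s 4 0 = sg b" "0 \<le> sg b"
  shows "triple tighten s (\<lambda>s' t. t \<le> 80 \<and> (\<exists>k T. tightening b k T \<and>
     (\<forall>i<d. snd s' 0 (int i) = tightened b k T i) \<and> snd s' 4 0 = sg (tightened b k T) \<and>
     0 \<le> sg (tightened b k T) \<and>
     (sg (tightened b k T) \<le> 2 * (D * D) \<or> 0 < sg b \<and> (\<forall>i<d. \<sigma> i \<le> 0))))"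
    (is "triple tighten s (\<lambda>s' t. t \<le> 80 \<and> ?Q s')")
  unfolding tighten_def
proof (rule triple_bounded, rule triple_Cond)
  let ?c = "Conj (RLess (RInt (Mul (var 6) (var 6))) (rvar 4)) (Neg (Less (var 19) (Num 0)))"
  have DDpos: "1 \<le> D * D" using D_pos mult_mono[of 1 D 1 D] by simp
  {
    assume bs: "bounded s" and c: "bval ?c s"
    have beta3: "sg b \<le> NR ^ 3"
    proof -
      have "\<bar>snd s 4 0\<bar> \<le> NR ^ renv 4" using bs unfolding bounded_def by blast
      then show ?thesis using beta by simp
    qed
    obtain k where kd: "k < d" "fst s 19 0 = int k" "0 < \<sigma> k"
        "\<forall>i<d. 0 < \<sigma> i \<longrightarrow> \<gamma> k * \<sigma> i \<le> \<gamma> i * \<sigma> k"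
      using c k by (auto simp: best_ratio_def)
    have gt: "D * D < sg b" using c DD beta by simp
    define T where "T = (sg b - D * D) div \<sigma> k"
    have T0: "0 \<le> T" using gt kd(3) by (simp add: T_def pos_imp_zdiv_nonneg_iff)
    have TD: "T * \<sigma> k + (sg b - D * D) mod \<sigma> k = sg b - D * D"
      unfolding T_def by (rule div_mult_mod_eq)
    have md: "0 \<le> (sg b - D * D) mod \<sigma> k" "(sg b - D * D) mod \<sigma> k < \<sigma> k" using kd(3) by auto
    have tg: "tightening b k T" using T0 kd TD md by (auto simp: tightening_def)
    have sgt: "sg (tightened b k T) = sg b - T * \<sigma> k"
      using kd(1) by (simp add: tightened_def[abs_def] dot_simps)
    have "\<sigma> k \<le> D * D"
      using sigma_le[OF kd(1)] D_pos mult_left_mono[of 1 D D] by linarith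
    then have rng: "0 \<le> sg (tightened b k T)" "sg (tightened b k T) \<le> 2 * (D * D)"
      unfolding sgt using TD md DDpos by linarith+
    \<comment> \<open>As \<open>\<sigma> k\<close> is at least 1, the amount is bounded by the part
      of the sum it removes, which limits its size.\<close>
    have Tle: "T \<le> T * \<sigma> k" using mult_left_mono[of 1 "\<sigma> k" T] kd(3) T0 by simp
    have T3: "\<bar>T\<bar> \<le> NR ^ 3" using Tle TD md DDpos T0 beta3 by linarith
    have bT: "\<bar>b k - T\<bar> \<le> NR ^ 4"
    proof -
      have "NR ^ 1 \<le> NR ^ 3" by (rule NR_power_mono) simp
      then have "\<bar>b k - T\<bar> \<le> 2 * NR ^ 3" using b(2)[OF kd(1)] T3 by simp
      also have "\<dots> \<le> NR * NR ^ 3" using N_ge N_le_NR by (intro mult_right_mono) auto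
      finally show ?thesis by (simp add: eval_nat_numeral)
    qed
    let ?p1 = "RDiv (RSub (rvar 4) (RInt (Mul (var 6) (var 6)))) (Ld 22 (var 19))"
    let ?s1 = "rst 5 0 T s" and ?s2 = "rst 0 (int k) (b k - T) (rst 5 0 T s)"
    let ?s3 = "rst 4 0 (sg b - \<sigma> k * T) ?s2"
    have sk: "fst s 22 (int k) = \<sigma> k" using F kd(1) by (simp add: functionals_def)
    have Q3: "?Q ?s3"
    proof (intro exI conjI allI impI)
      show "tightening b k T" by (rule tg)
      fix i assume "i < d"
      then show "snd ?s3 0 (int i) = tightened b k T i"
        using b(1) by (simp add: tightened_def unit_at_def)
    next
      show "snd ?s3 4 0 = sg (tightened b k T)" "0 \<le> sg (tightened b k T)"
        "sg (tightened b k T) \<le> 2 * (D * D) \<or> 0 < sg b \<and> (\<forall>i<d. \<sigma> i \<le> 0)"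
        using sgt rng by (auto simp: mult.commute)
    qed
    have T4: "\<bar>T\<bar> \<le> NR ^ 4" using T3 NR_power_mono[of 3 4] by simp
    have b4: "\<bar>sg b - \<sigma> k * T\<bar> \<le> NR ^ 3"
      using rng(1) sgt beta3 T0 Tle by (simp add: mult.commute)
    have e1: "rval ?p1 s = T" using beta DD kd sk by (simp add: T_def)
    show "triple (5 ::~ ?p1 ;; RStore 0 (var 19) (RSub (RLd 0 (var 19)) (rvar 5)) ;;
      4 ::~ RSub (rvar 4) (RMul (Ld 22 (var 19)) (rvar 5))) s (\<lambda>s' t. bnodes ?c + 1 + t \<le> 80 \<and> ?Q s')"
    proof (rule triple_Seq_RStore)
      show "\<bar>rval ?p1 s\<bar> \<le> NR ^ renv 5" unfolding e1 using T4 by simp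
      show "triple (RStore 0 (var 19) (RSub (RLd 0 (var 19)) (rvar 5)) ;;
        4 ::~ RSub (rvar 4) (RMul (Ld 22 (var 19)) (rvar 5))) (rst 5 (aval (Num 0) s) (rval ?p1 s) s)
        (\<lambda>s' t. bnodes ?c + 1 + (anodes (Num 0) + rnodes ?p1 + 1 + t) \<le> 80 \<and> ?Q s')"
        unfolding e1
        by (rule triple_Seq_RStore, simp, simp, insert bT b(1) kd, simp, rule triple_RStore)
          (insert Q3 sk beta b4, simp_all)
    qed simp_all
  next
    assume c: "\<not> bval ?c s"
    then have small: "sg b \<le> D * D \<or> fst s 19 0 < 0" using DD beta by auto
    have "?Q s"
    proof (intro exI[of _ 0] conjI allI impI)
      show "tightening b 0 0" by (simp add: tightening_def)
      show "snd s 0 (int i) = tightened b 0 0 i" if "i < d" for i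
        using that b(1) by (simp add: tightened_def)
      have tb: "sg (tightened b 0 0) = sg b" by (simp add: tightened_def[abs_def])
      show "snd s 4 0 = sg (tightened b 0 0)" "0 \<le> sg (tightened b 0 0)" unfolding tb using beta by auto
      have "sg b \<le> 2 * (D * D) \<or> 0 < sg b \<and> (\<forall>i<d. \<sigma> i \<le> 0)"
        using small k DDpos by (auto simp: best_ratio_def)
      then show "sg (tightened b 0 0) \<le> 2 * (D * D) \<or> 0 < sg b \<and> (\<forall>i<d. \<sigma> i \<le> 0)" unfolding tb .
    qed
    then show "triple Skip s (\<lambda>s' t. bnodes ?c + 1 + t \<le> 80 \<and> ?Q s')"
      by (intro triple_Skip) simp
  }
qed simp_all


lemma triple_load_b:
  "layout s \<Longrightarrow> triple load_b s (\<lambda>s' t. t \<le> 40 * n + 9 \<and> (\<forall>i<n. snd s' 2 (int i) = snd s 0 (int i)))"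
  unfolding load_b_def
  by (rule triple_for[where m = n and C = 12 and I = "\<lambda>k s'. \<forall>i<k. snd s' 2 (int i) = snd s 0 (int i)"];
      (rule triple_RStore_degree)?)
    (auto simp: layout_def less_Suc_eq)

lemma triple_load_difference:
  "layout s \<Longrightarrow> triple load_difference s (\<lambda>s' t. t \<le> 40 * n + 9 \<and>
    (\<forall>i<n. snd s' 2 (int i) = snd s 0 (int i) - fst s 25 (fst s 19 0 * int d + int i)))"
  unfolding load_difference_def
  by (rule triple_for[where m = n and C = 20 and
        I = "\<lambda>k s'. \<forall>i<k. snd s' 2 (int i) = snd s 0 (int i) - fst s 25 (fst s 19 0 * int d + int i)"];
      (rule triple_RStore_degree)?)
    (auto simp: layout_def less_Suc_eq)

lemma row_cong: "(\<And>j. j < n \<Longrightarrow> x j = y j) \<Longrightarrow> row i x = row i y"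
  unfolding row_def by (intro sum.cong) auto

lemma feasible_cong:
  assumes "\<And>j. j < n \<Longrightarrow> x j = y j"
  shows "x \<in> feasible b \<longleftrightarrow> y \<in> feasible b" "dot n f x = dot n f y"
  using row_cong[of x y] assms by (simp_all add: feasible_def dot_def)

lemma quot_cong:
  assumes "\<And>i. i < n \<Longrightarrow> u i = v i" "i < n"
  shows "quot u i = quot v i"
  using rmd_eq_if_basis_lattice[of u v "\<lambda>_. 0" i] assms by simp

lemma triple_read_answer:
  assumes L: "layout s" and W: "fst s 7 0 = W" "D \<le> W" and W20: "fst s 20 0 = 2 * W + 1"
    and table: "closed_table W (fst s 23) (fst s 24) (entry_of s)"
    and tight: "tightening b k T" and b': "\<And>i. i < d \<Longrightarrow> snd s 0 (int i) = tightened b k T i"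
    and beta: "snd s 4 0 = sg (tightened b k T)" "0 \<le> sg (tightened b k T)"
    and large: "sg (tightened b k T) \<le> W \<or> 0 < sg b \<and> (\<forall>i<d. \<sigma> i \<le> 0)"
  shows "triple read_answer s (\<lambda>s' t. t \<le> 400 * (n + 1)^2 \<and> correct_answer b s')"
    (is "triple _ _ ?Q")
  unfolding read_answer_def
proof (rule triple_Cond)
  let ?c = "RLess (RInt (var 7)) (rvar 4)"
  let ?b = "tightened b k T"
  have n2: "1 \<le> (n + 1)^2" "n + 1 \<le> (n + 1)^2" by (simp_all add: power2_eq_square)
  have W0: "0 \<le> W" using W(2) D_pos by simp
  have infeasible: "triple (Store 0 (Num 0) (Num 0)) s1 (\<lambda>s' t. ?Q s' (t0 + t))"
    if "feasible b = {}" "t0 + 3 \<le> 400 * (n + 1)^2" for s1 t0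
    by (rule triple_Store_degree) (use that in \<open>simp_all add: correct_answer_def\<close>)
  {
    assume "bval ?c s"
    then have "W < sg ?b" using W beta by simp
    then have "feasible b = {}" using large by (intro infeasible_nonpos_sigma) auto
    then show "triple (Store 0 (Num 0) (Num 0)) s (\<lambda>s' t. ?Q s' (bnodes ?c + 1 + t))"
      by (rule infeasible) (use n2 in simp)
  next
    assume "\<not> bval ?c s"
    then have small: "\<bar>sg ?b\<bar> \<le> W" using W beta by simp
    let ?slot = "Add (Mul (var 12) (var 20)) (Add (RMod (rvar 4) (Add (var 7) (Num 1))) (var 7))"
    let ?opt = "Store 0 (Num 0) (Num 2) ;; load_difference ;; solve"
    let ?p = "Cond (Less (Num 0) (Ld 23 (var 19)))
        (Cond (Less (Ld 24 (var 7)) (Num 0)) (Store 0 (Num 0) (Num 1)) ?opt)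
        (Store 0 (Num 0) (Num 0))"
    show "triple (load_b ;; solve ;; 19 ::= ?slot ;; ?p) s (\<lambda>s' t. ?Q s' (bnodes ?c + 1 + t))"
    proof (rule triple_Seq_mono[OF triple_load_b[OF L]], goal_cases)
      case s1: (1 s1 t1)
      have L1: "layout s1" using L s1(3) by (simp add: layout_def)
      show ?case
      proof (rule triple_Seq_mono[OF triple_solve[OF L1 refl]])
        fix s2 t2 assume s2: "t2 \<le> 120 * (n + 1)\<^sup>2 \<and> fst s2 12 0 = ix (\<lambda>i. snd s1 2 (int i)) \<and>
            (\<forall>i<n. snd s2 1 (int i) = quot (\<lambda>i. snd s1 2 (int i)) i)" "bounded s2"
          "\<forall>k. k \<notin> writes solve \<longrightarrow> fst s2 k = fst s1 k" "\<forall>k. k \<notin> rwrites solve \<longrightarrow> snd s2 k = snd s1 k"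
        have "ix (\<lambda>i. snd s1 2 (int i)) = ix ?b"
          using s1(1) b' n_le_d by (intro ix_cong) simp
        then have g: "fst s2 12 0 = ix ?b" using s2(1) by simp
        let ?s3 = "st 19 (aval (Num 0) s2) (aval ?slot s2) s2"
        have f2: "\<forall>k. k \<notin> {10, 11, 12} \<longrightarrow> fst s2 k = fst s k" "\<forall>k. k \<notin> {1, 2, 3} \<longrightarrow> snd s2 k = snd s k"
          using s1(3,4) s2(3,4) by simp_all
        have f3: "\<forall>k. k \<notin> {10, 11, 12, 19} \<longrightarrow> fst ?s3 k = fst s k" "\<forall>k. k \<notin> {1, 2, 3} \<longrightarrow> snd ?s3 k = snd s k"
          using f2 by simp_all
        have "sg ?b mod (1 + W) = sg ?b" using small beta(2) by (intro mod_pos_pos_trivial) auto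
        then have q: "fst ?s3 19 0 = slot W ?b"
          using g f2 W W20 W0 beta by (simp add: slot_def add.commute[of W])
        have cF: "bval (Less (Num 0) (Ld 23 (var 19))) ?s3 \<longleftrightarrow> 0 < fst s 23 (slot W ?b)"
          using f3(1) q by simp
        have cC: "bval (Less (Ld 24 (var 7)) (Num 0)) ?s3 \<longleftrightarrow> fst s 24 W < 0"
          using f3(1) W by simp
        let ?t3 = "bnodes ?c + 1 + (t1 + (t2 + (anodes (Num 0) + anodes ?slot + 1)))"
        have t3: "?t3 \<le> 120 * (n + 1)^2 + 40 * n + 50" using s1(1) s2(1) by simp
        have "triple ?p ?s3 (\<lambda>s' t. ?Q s' (?t3 + t))"
        proof (rule triple_Cond)
          let ?t4 = "?t3 + (bnodes (Less (Num 0) (Ld 23 (var 19))) + 1)"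
          {
            assume "\<not> bval (Less (Num 0) (Ld 23 (var 19))) ?s3"
            then have "feasible b = {}"
              using answer_infeasible[OF tight refl small W(2) table] cF by simp
            then have "triple (Store 0 (Num 0) (Num 0)) ?s3 (\<lambda>s' t. ?Q s' (?t4 + t))"
              by (rule infeasible) (use t3 n2 in simp)
            then show "triple (Store 0 (Num 0) (Num 0)) ?s3
              (\<lambda>s' t. ?Q s' (?t3 + (bnodes (Less (Num 0) (Ld 23 (var 19))) + 1 + t)))"
              by (simp only: add.assoc)
          next
            assume "bval (Less (Num 0) (Ld 23 (var 19))) ?s3"
            then have F: "0 < fst s 23 (slot W ?b)" using cF by simp
            let ?t5 = "?t4 + (bnodes (Less (Ld 24 (var 7)) (Num 0)) + 1)"
            have "triple (Cond (Less (Ld 24 (var 7)) (Num 0)) (Store 0 (Num 0) (Num 1)) ?opt) ?s3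
              (\<lambda>s' t. ?Q s' (?t4 + t))"
            proof (rule triple_Cond)
              assume "bval (Less (Ld 24 (var 7)) (Num 0)) ?s3"
              then have "\<exists>x\<in>feasible b. K < dot n c x" for K
                using answer_unbounded[OF tight refl small W(2) table F] cC by simp
              then show "triple (Store 0 (Num 0) (Num 1)) ?s3
                (\<lambda>s' t. ?Q s' (?t4 + (bnodes (Less (Ld 24 (var 7)) (Num 0)) + 1 + t)))"
                by - (rule triple_Store_degree, insert t3 n2, simp_all add: correct_answer_def)
            next
              assume "\<not> bval (Less (Ld 24 (var 7)) (Num 0)) ?s3"
              then have C: "\<not> fst s 24 W < 0" using cC by simp
              define x where "x = quot (\<lambda>i. ?b i - entry_of s (slot W ?b) i)"
              have x: "x \<in> feasible b" "\<And>y. y \<in> feasible b \<Longrightarrow> dot n c y \<le> dot n c x"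
                using answer_optimal[OF tight refl small W(2) table F C] by (auto simp: x_def)
              let ?s4 = "st 0 0 2 ?s3"
              have L4: "layout ?s4" using L f3(1) by (simp add: layout_def)
              have "triple (load_difference ;; solve) ?s4 (\<lambda>s' t. ?Q s' (?t5 + (anodes (Num 0) + anodes (Num 2) + 1 + t)))"
              proof (rule triple_Seq_mono[OF triple_load_difference[OF L4]], goal_cases)
                case s5: (1 s5 t5')
                have L5: "layout s5" using L4 s5(3) by (simp add: layout_def)
                have v5: "snd s5 2 (int i) = ?b i - entry_of s (slot W ?b) i" if "i < n" for i
                proof -
                  have "fst ?s4 19 0 = slot W ?b" using q by simp
                  moreover have "fst ?s4 25 = fst s 25" "snd ?s4 0 = snd s 0" using f3 by simp_all
                  ultimately show ?thesis using s5(1) that b'[of i] n_le_d by (simp add: entry_of_def)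
                qed
                have s0: "fst s5 0 0 = 2" using s5(3) by simp
                show ?case
                proof (rule triple_mono[OF triple_solve[OF L5 refl]])
                  fix s6 :: state and t6 assume s6: "t6 \<le> 120 * (n + 1)\<^sup>2 \<and> fst s6 12 0 = ix (\<lambda>i. snd s5 2 (int i)) \<and>
                      (\<forall>i<n. snd s6 1 (int i) = quot (\<lambda>i. snd s5 2 (int i)) i)"
                    "\<forall>k. k \<notin> writes solve \<longrightarrow> fst s6 k = fst s5 k"
                  have x6: "snd s6 1 (int j) = x j" if "j < n" for j
                    using s6(1) that quot_cong[of "\<lambda>i. snd s5 2 (int i)" "\<lambda>i. ?b i - entry_of s (slot W ?b) i" j] v5
                    by (simp add: x_def)
                  have "correct_answer b s6"
                    using feasible_cong[of "\<lambda>j. snd s6 1 (int j)" x, OF x6] x s0 s6(2)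
                    by (simp add: correct_answer_def)
                  moreover have "?t5 + (anodes (Num 0) + anodes (Num 2) + 1 + (t5' + t6)) \<le> 400 * (n + 1)^2"
                  proof -
                    have "?t5 + (anodes (Num 0) + anodes (Num 2) + 1 + (t5' + t6)) \<le>
                        (120 * (n + 1)^2 + 40 * n + 50) + 20 + (40 * n + 9) + 120 * (n + 1)^2"
                      using t3 s5(1) s6(1) by simp
                    also have "\<dots> \<le> 400 * (n + 1)^2" using n2 by simp
                    finally show ?thesis .
                  qed
                  ultimately show "?Q s6 (?t5 + (anodes (Num 0) + anodes (Num 2) + 1 + (t5' + t6)))" by blast
                qed
              qed
              then have "triple (load_difference ;; solve) (st 0 (aval (Num 0) ?s3) (aval (Num 2) ?s3) ?s3)
                (\<lambda>s' t. ?Q s' (?t4 + (bnodes (Less (Ld 24 (var 7)) (Num 0)) + 1 + (anodes (Num 0) + anodes (Num 2) + 1 + t))))"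
                by (simp only: add.assoc aval.simps)
              then show "triple ?opt ?s3
                (\<lambda>s' t. ?Q s' (?t4 + (bnodes (Less (Ld 24 (var 7)) (Num 0)) + 1 + t)))"
                by - (rule triple_Seq_Store_degree, simp_all only: awf.simps adeg.simps env_simps; simp)
            qed simp
            then show "triple (Cond (Less (Ld 24 (var 7)) (Num 0)) (Store 0 (Num 0) (Num 1)) ?opt) ?s3
              (\<lambda>s' t. ?Q s' (?t3 + (bnodes (Less (Num 0) (Ld 23 (var 19))) + 1 + t)))"
              by (simp only: add.assoc)
          }
        qed simp
        then show "triple (19 ::= ?slot ;; ?p) s2 (\<lambda>s' t. ?Q s' (bnodes ?c + 1 + (t1 + (t2 + t))))"
          by - (rule triple_Seq_Store_degree, simp, simp, simp, simp only: add.assoc)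
      qed
    qed
  }
qed simp

end

section \<open>Setup phases and composition of the program\<close>

definition finish :: com where
  "finish = set_window ;; choose_ratio ;; tighten ;; fill_table ;; read_answer"

definition setup_scalars :: com where
  "setup_scalars = 3 ::= Ld 0 (Num 0) ;; 4 ::= Ld 0 (Num 1) ;; 5 ::= Num 1 ;;
     for_loop 14 4 (5 ::= Mul (var 5) (entry (var 14) (var 14))) ;;
     9 ::= Mul (Mul (Add (var 4) (Num 1)) (var 5)) (var 5)"

definition set_functionals :: com where
  "set_functionals = for_loop 14 4 coefficient ;; Store 22 (var 4) (Sub (Num 0) (var 5))"

text \<open>The working bound is the largest absolute value among the pivot product and the
  coefficients of \<sigma>, so no minors have to be enumerated. Starting from the pivot product
  guarantees \<open>pivots_le\<close>.\<close>

definition max_coefficient :: com where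
  "max_coefficient = 6 ::= var 5 ;; for_loop 14 3
     (Cond (Less (var 6) (Ld 22 (var 14))) (6 ::= Ld 22 (var 14)) Skip ;;
      Cond (Less (var 6) (Sub (Num 0) (Ld 22 (var 14)))) (6 ::= Sub (Num 0) (Ld 22 (var 14))) Skip)"

text \<open>Reversing \<sigma> when its value at the right-hand side is negative leaves only large
  positive values to be reduced.\<close>

definition orient :: com where
  "orient = 4 ::~ RInt (Num 0) ;;
     for_loop 14 3 (4 ::~ RAdd (rvar 4) (RMul (Ld 22 (var 14)) (RLd 0 (var 14)))) ;;
     Cond (RLess (rvar 4) (RInt (Num 0)))
       (4 ::~ RSub (RInt (Num 0)) (rvar 4) ;; for_loop 14 3 (Store 22 (var 14) (Sub (Num 0) (Ld 22 (var 14)))))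
       Skip"

lemma phase_writes [simp]:
  "writes setup_scalars = {3, 4, 5, 9, 14}" "rwrites setup_scalars = {}"
  "writes set_functionals = {10, 11, 12, 13, 14, 21, 22}" "rwrites set_functionals = {1, 2, 3}"
  "writes max_coefficient = {6, 14}" "rwrites max_coefficient = {}"
  "writes orient = {14, 22}" "rwrites orient = {4}"
  by (auto simp: setup_scalars_def set_functionals_def max_coefficient_def orient_def)

context program
begin

lemma slots_nonneg: "0 \<le> W \<Longrightarrow> 0 \<le> slots W"
  using pivots_pos[of n] by (simp add: slots_def)

lemma initial_table:
  assumes L: "layout s" and F: "functionals s" and W: "0 \<le> W"
    and vars: "fst s 7 0 = W" "fst s 8 0 = slots W" "fst s 20 0 = 2 * W + 1"
    and zero: "fst s 23 = (\<lambda>_. 0)" "fst s 24 = (\<lambda>_. 0)" "fst s 25 = (\<lambda>_. 0)"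
  shows "table_inv W 0 (st 23 W 1 s)" "reached_upto W 0 (st 23 W 1 s)"
proof -
  have e: "entry_of (st 23 W 1 s) q = (\<lambda>_. 0)" for q
    using zero by (simp add: fun_eq_iff entry_of_def)
  have s0: "slot W (\<lambda>_. 0) = W" by (simp add: slot_def dot_zero ix_zero)
  have "valid_entry W W 0 (\<lambda>_. 0)"
    using W s0 by (simp add: valid_entry_def multisets_def dot_zero)
  then show "table_inv W 0 (st 23 W 1 s)"
    using L F vars zero e by (auto simp: table_inv_def layout_def functionals_def)
  show "reached_upto W 0 (st 23 W 1 s)"
    unfolding reached_upto_def
  proof (intro allI impI)
    fix v assume v: "in_window W v \<and> total d v \<le> int 0"
    then have "v = (\<lambda>_. 0)"
      using multisets_zero[of v d] total_nonneg[of v d] by (simp add: in_window_def)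
    then show "reached_in W (st 23 W 1 s) v"
      using s0 zero by (simp add: reached_def dot_zero)
  qed
qed

lemma triple_finish:
  assumes L: "layout s" and F: "functionals s" and piv: "fst s 5 0 = pivots n" and DD: "fst s 6 0 = D"
    and b: "\<And>i. i < d \<Longrightarrow> snd s 0 (int i) = b i" "\<And>i. i < d \<Longrightarrow> \<bar>b i\<bar> \<le> NR"
    and beta: "snd s 4 0 = sg b" "0 \<le> sg b"
    and zero: "fst s 23 = (\<lambda>_. 0)" "fst s 24 = (\<lambda>_. 0)" "fst s 25 = (\<lambda>_. 0)"
  shows "triple finish s (\<lambda>s' t. t \<le> fill_cost (nat (slots (2 * (D * D)))) + 400 * (n + 1)^2 + 80 * d + 160 \<and>
    correct_answer b s')"
    (is "triple _ _ ?Q")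
  unfolding finish_def
proof (rule triple_Seq_mono[OF triple_set_window[OF piv DD]])
  let ?W = "2 * (D * D)"
  have "D * 1 \<le> D * D" using D_pos by (intro mult_left_mono) auto
  then have W: "D \<le> ?W" "0 \<le> ?W" using D_pos by linarith+
  fix s1 :: state and t1 :: nat assume s1: "t1 \<le> 60 \<and> fst s1 7 0 = ?W \<and> fst s1 20 0 = 2 * ?W + 1 \<and> fst s1 8 0 = slots ?W"
    "bounded s1" "\<forall>k. k \<notin> writes set_window \<longrightarrow> fst s1 k = fst s k"
    "\<forall>k. k \<notin> rwrites set_window \<longrightarrow> snd s1 k = snd s k"
  have L1: "layout s1" "functionals s1" using L F s1(3) by (simp_all add: layout_def functionals_def)
  show "triple (choose_ratio ;; tighten ;; fill_table ;; read_answer) s1 (\<lambda>s' t. ?Q s' (t1 + t))"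
  proof (rule triple_Seq_mono[OF triple_choose_ratio[OF L1]], goal_cases)
    case s2: (1 s2 t2)
    have F2: "functionals s2" using L1 s2(3) by (simp add: functionals_def)
    have D2: "fst s2 6 0 = D" using DD s1(3) s2(3) by simp
    have b2: "\<And>i. i < d \<Longrightarrow> snd s2 0 (int i) = b i" "snd s2 4 0 = sg b"
      using b(1) beta(1) s1(4) s2(4) by simp_all
    show ?case
    proof (rule triple_Seq_mono[OF triple_tighten[OF F2 D2 conjunct2[OF s2(1)] b2(1) b(2) b2(2) beta(2)]], goal_cases)
      case s3: (3 s3 t3)
      then obtain k T where tg: "tightening b k T" "\<And>i. i < d \<Longrightarrow> snd s3 0 (int i) = tightened b k T i"
          "snd s3 4 0 = sg (tightened b k T)" "0 \<le> sg (tightened b k T)"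
          "sg (tightened b k T) \<le> ?W \<or> 0 < sg b \<and> (\<forall>i<d. \<sigma> i \<le> 0)" by blast
      have f3: "\<forall>k. k \<notin> {7, 8, 14, 19, 20} \<longrightarrow> fst s3 k = fst s k" "fst s3 7 0 = ?W" "fst s3 8 0 = slots ?W"
          "fst s3 20 0 = 2 * ?W + 1"
        using s1(1,3) s2(3) s3(3) by simp_all
      have L3: "layout s3" "functionals s3" using L F f3(1) by (simp_all add: layout_def functionals_def)
      have z3: "fst s3 23 = (\<lambda>_. 0)" "fst s3 24 = (\<lambda>_. 0)" "fst s3 25 = (\<lambda>_. 0)" using zero f3(1) by simp_all
      note init = initial_table[OF L3 W(2) f3(2-4) z3]
      have m: "slots ?W = int (nat (slots ?W))" using slots_nonneg[OF W(2)] by simp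
      show ?case
      proof (rule triple_Seq_mono[OF triple_fill_table[OF init(1) W init(2) m]], goal_cases)
        case s4: (1 s4 t4)
        have L4: "layout s4" using L3 s4(3) by (simp add: layout_def)
        have v4: "fst s4 7 0 = ?W" "fst s4 20 0 = 2 * ?W + 1" "\<And>i. i < d \<Longrightarrow> snd s4 0 (int i) = tightened b k T i"
          "snd s4 4 0 = sg (tightened b k T)"
          using f3 tg s4(3,4) by simp_all
        show ?case
          by (rule triple_mono[OF triple_read_answer[OF L4 v4(1) W(1) v4(2) conjunct2[OF s4(1)] tg(1) v4(3,4) tg(4,5)]])
            (use s1(1) s2(1) s3(1) s4(1) in auto)
      qed
    qed
  qed
qed

lemma triple_setup_scalars:
  assumes "fst s 0 0 = int d" "fst s 0 1 = int n" "fst s 1 = Harr"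
  shows "triple setup_scalars s (\<lambda>s' t. t \<le> 40 * n + 50 \<and> layout s' \<and> fst s' 5 0 = pivots n \<and>
    fst s' 9 0 = (int n + 1) * pivots n * pivots n)"
    (is "triple _ _ ?Q")
  unfolding setup_scalars_def
proof (rule triple_Seq_Store_degree)
  let ?body = "5 ::= Mul (var 5) (entry (var 14) (var 14))"
  let ?M = "Mul (Mul (Add (var 4) (Num 1)) (var 5)) (var 5)"
  let ?s3 = "st 5 0 1 (st 4 0 (int n) (st 3 0 (int d) s))"
  have "triple (for_loop 14 4 ?body ;; 9 ::= ?M) ?s3 (\<lambda>s' t. ?Q s' (11 + t))"
  proof (rule triple_Seq, rule triple_for[where m = n and C = 20 and I = "\<lambda>k s'. fst s' 5 0 = pivots k"], goal_cases)
    case step: (8 k s')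
    note k = step(1) and I = step(2) and kv = step(4) and f = step(5,6)
    have le: "\<bar>pivots k * H k k\<bar> \<le> N"
      using pivots_pos[of "Suc k"] pivots_mono[of "Suc k" n] pivots_le_N k by (simp add: pivots_Suc)
    show ?case
      by (rule triple_Store) (insert le I kv f assms Harr[of k k] k, simp_all add: entry_def pivots_Suc)
  next
    fix s' :: state and c :: nat assume I: "c \<le> (20 + 12) * n + 9" "fst s' 5 0 = pivots n"
      and f: "\<forall>k. k \<notin> insert 14 (writes ?body) \<longrightarrow> fst s' k = fst ?s3 k"
        "\<forall>k. k \<notin> rwrites ?body \<longrightarrow> snd s' k = snd ?s3 k"
    show "triple (9 ::= ?M) s' (\<lambda>s'' c'. ?Q s'' (11 + (c + c')))"
      by (rule triple_Store_degree) (insert I f assms, simp_all add: layout_def)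
  qed (simp_all add: pivots_def)
  then show "triple (4 ::= Ld 0 (Num 1) ;; 5 ::= Num 1 ;; for_loop 14 4 ?body ;; 9 ::= ?M)
    (st 3 (aval (Num 0) s) (aval (Ld 0 (Num 0)) s) s) (\<lambda>s' t. ?Q s' (anodes (Num 0) + anodes (Ld 0 (Num 0)) + 1 + t))"
    by - (rule triple_Seq_Store_degree, simp, simp, simp, rule triple_Seq_Store_degree, insert assms, simp_all)
qed simp_all

definition base_sigma :: "nat \<Rightarrow> int" where
  "base_sigma i = (if i < n then w i else - pivots n)"

lemma base_sigma_le: "i < d \<Longrightarrow> \<bar>base_sigma i\<bar> \<le> D"
  using minor_le[of i] pivots_le pivots_pos[of n] by (auto simp: base_sigma_def w_def)

lemma triple_set_functionals:
  assumes L: "layout_c s" and piv: "fst s 5 0 = pivots n" and M: "fst s 9 0 = (int n + 1) * pivots n * pivots n"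
    and zero: "fst s 21 = (\<lambda>_. 0)"
  shows "triple set_functionals s (\<lambda>s' t. t \<le> 600 * (n + 1)^3 \<and>
    (\<forall>i<d. fst s' 21 (int i) = \<gamma> i \<and> fst s' 22 (int i) = base_sigma i))"
    (is "triple _ _ ?Q")
  unfolding set_functionals_def
proof (rule triple_Seq, rule triple_for[where m = n and C = "500 * (n + 1)^2" and
      I = "\<lambda>k s'. (\<forall>i<k. fst s' 21 (int i) = \<gamma> i \<and> fst s' 22 (int i) = w i) \<and> fst s' 21 (int n) = 0"], goal_cases)
  case step: (8 k s')
  note k = step(1) and kv = step(4) and I = step(2) and f = step(5)
  have L': "layout_c s'" using L f by (simp add: layout_c_def layout_def)
  show ?case
    by (rule triple_mono[OF triple_coefficient[OF L' kv k]]) (insert I f piv M k, auto simp: less_Suc_eq)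
next
  fix s' :: state and t :: nat assume t: "t \<le> (500 * (n + 1)^2 + 12) * n + 9"
    and I: "(\<forall>i<n. fst s' 21 (int i) = \<gamma> i \<and> fst s' 22 (int i) = w i) \<and> fst s' 21 (int n) = 0"
    and f: "\<forall>k. k \<notin> insert 14 (writes coefficient) \<longrightarrow> fst s' k = fst s k"
  have s4: "fst s' 4 0 = int n" "fst s' 5 0 = pivots n" using L piv f by (simp_all add: layout_c_def layout_def)
  have "(500 * (n + 1)^2 + 12) * n + 9 + 10 \<le> 600 * (n + 1)^3"
    by (simp add: power2_eq_square power3_eq_cube algebra_simps)
  then have t': "t + 7 \<le> 600 * (n + 1)^3" using t by linarith
  \<comment> \<open>Position \<open>n\<close> of array 21 is never written: its initial zero is the
    value of \<gamma> there.\<close>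
  have q: "fst s' 21 (int i) = \<gamma> i \<and> ((fst s' 22)(int n := - pivots n)) (int i) = base_sigma i" if "i < d" for i
  proof -
    have "i < n \<or> i = n" using that d_le by linarith
    then show ?thesis using I by (auto simp: base_sigma_def \<gamma>_def)
  qed
  have "\<bar>- pivots n\<bar> \<le> N" using pivots_le_N pivots_pos[of n] by simp
  then show "triple (Store 22 (var 4) (Sub (Num 0) (var 5))) s' (\<lambda>s'' c'. ?Q s'' (t + c'))"
    by - (rule triple_Store, insert s4 t' q, simp_all)
qed (use L zero in \<open>auto simp: layout_c_def layout_def\<close>)

lemma triple_max_coefficient:
  assumes L: "layout s" and piv: "fst s 5 0 = pivots n"
    and F: "\<And>i. i < d \<Longrightarrow> fst s 22 (int i) = base_sigma i"
  shows "triple max_coefficient s (\<lambda>s' t. t \<le> 80 * d + 20 \<and> pivots n \<le> fst s' 6 0 \<and> fst s' 6 0 \<le> D \<and>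
    (\<forall>i<d. \<bar>base_sigma i\<bar> \<le> fst s' 6 0))"
    (is "triple _ _ ?Q")
  unfolding max_coefficient_def
proof (rule triple_Seq_Store_degree)
  let ?s = "st 6 (aval (Num 0) s) (aval (var 5) s) s"
  let ?b1 = "Cond (Less (var 6) (Ld 22 (var 14))) (6 ::= Ld 22 (var 14)) Skip"
  let ?b2 = "Cond (Less (var 6) (Sub (Num 0) (Ld 22 (var 14)))) (6 ::= Sub (Num 0) (Ld 22 (var 14))) Skip"
  show "triple (for_loop 14 3 (?b1 ;; ?b2)) ?s (\<lambda>s' t. ?Q s' (anodes (Num 0) + anodes (var 5) + 1 + t))"
  proof (rule triple_for[where m = d and C = 60 and I = "\<lambda>k s'. pivots n \<le> fst s' 6 0 \<and> fst s' 6 0 \<le> D \<and>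
      (\<forall>i<k. \<bar>base_sigma i\<bar> \<le> fst s' 6 0)"])
    fix k and s' :: state assume k: "k < d" and kv: "fst s' 14 0 = int k"
      and I: "pivots n \<le> fst s' 6 0 \<and> fst s' 6 0 \<le> D \<and> (\<forall>i<k. \<bar>base_sigma i\<bar> \<le> fst s' 6 0)"
      and f: "\<forall>k. k \<notin> insert 14 (writes (?b1 ;; ?b2)) \<longrightarrow> fst s' k = fst ?s k"
    have v: "fst s' 22 (int k) = base_sigma k" using F k f by simp
    have le: "\<bar>base_sigma k\<bar> \<le> D" "\<bar>base_sigma k\<bar> \<le> N" using base_sigma_le[OF k] D_le_N by auto
    let ?R = "\<lambda>s'' c. c \<le> 60 \<and> pivots n \<le> fst s'' 6 0 \<and> fst s'' 6 0 \<le> D \<and> (\<forall>i<Suc k. \<bar>base_sigma i\<bar> \<le> fst s'' 6 0)"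
    have b1: "triple ?b1 s' (\<lambda>s1 c. c \<le> 20 \<and> fst s1 6 0 = max (fst s' 6 0) (base_sigma k))"
      by (rule triple_Cond; (rule triple_Store_degree triple_Skip)?) (use v kv in auto)
    have "triple (?b1 ;; ?b2) s' ?R"
    proof (rule triple_Seq_mono[OF b1])
      fix s1 :: state and c1 :: nat assume s1: "c1 \<le> 20 \<and> fst s1 6 0 = max (fst s' 6 0) (base_sigma k)"
        "\<forall>k. k \<notin> writes ?b1 \<longrightarrow> fst s1 k = fst s' k"
      have v1: "fst s1 22 (int k) = base_sigma k" "fst s1 14 0 = int k" using s1(2) v kv by auto
      have r: "max (fst s1 6 0) (- base_sigma k) = max (fst s' 6 0) \<bar>base_sigma k\<bar>" using s1(1) by auto
      have "triple ?b2 s1 (\<lambda>s2 c. c \<le> 30 \<and> fst s2 6 0 = max (fst s1 6 0) (- base_sigma k))"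
        by (rule triple_Cond; (rule triple_Store triple_Skip)?) (use v1 le in auto)
      then show "triple ?b2 s1 (\<lambda>s2 c. ?R s2 (c1 + c))"
      proof (rule triple_mono)
        fix s2 :: state and c :: nat assume "c \<le> 30 \<and> fst s2 6 0 = max (fst s1 6 0) (- base_sigma k)"
        then have "fst s2 6 0 = max (fst s' 6 0) \<bar>base_sigma k\<bar>" "c \<le> 30" using r by auto
        then show "?R s2 (c1 + c)" using I le(1) s1(1) by (auto simp: less_Suc_eq)
      qed
    qed
    then show "triple (?b1 ;; ?b2) s' (\<lambda>s'' c. c \<le> 60 \<and> pivots n \<le> fst (st 14 0 (1 + int k) s'') 6 0 \<and>
        fst (st 14 0 (1 + int k) s'') 6 0 \<le> D \<and> (\<forall>i<Suc k. \<bar>base_sigma i\<bar> \<le> fst (st 14 0 (1 + int k) s'') 6 0))"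
      by simp
  qed (use L piv pivots_le in \<open>auto simp: layout_def\<close>)
qed simp_all

lemma triple_orient:
  assumes L: "layout s" and F: "\<And>i. i < d \<Longrightarrow> fst s 22 (int i) = base_sigma i"
    and b: "\<And>i. i < d \<Longrightarrow> snd s 0 (int i) = b i" "\<And>i. i < d \<Longrightarrow> \<bar>b i\<bar> \<le> NR"
  shows "triple orient s (\<lambda>s' t. t \<le> 80 * d + 60 \<and> (\<exists>\<epsilon>. (\<epsilon> = 1 \<or> \<epsilon> = -1) \<and>
    (\<forall>i<d. fst s' 22 (int i) = \<epsilon> * base_sigma i) \<and> snd s' 4 0 = \<epsilon> * dot d base_sigma b \<and> 0 \<le> snd s' 4 0))"
    (is "triple _ _ ?Q")
  unfolding orient_def
proof (rule triple_Seq_RStore_degree)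
  let ?s = "rst 4 (aval (Num 0) s) (rval (RInt (Num 0)) s) s"
  let ?body = "4 ::~ RAdd (rvar 4) (RMul (Ld 22 (var 14)) (RLd 0 (var 14)))"
  let ?flip = "Store 22 (var 14) (Sub (Num 0) (Ld 22 (var 14)))"
  let ?rest = "Cond (RLess (rvar 4) (RInt (Num 0))) (4 ::~ RSub (RInt (Num 0)) (rvar 4) ;; for_loop 14 3 ?flip) Skip"
  have dle: "\<bar>\<Sum>i<k. base_sigma i * b i\<bar> \<le> NR ^ 3" if "k \<le> d" for k
  proof -
    have "\<bar>\<Sum>i<k. base_sigma i * b i\<bar> \<le> (\<Sum>i<k. NR * NR)"
    proof (intro order_trans[OF sum_abs] sum_mono)
      fix i assume "i \<in> {..<k}"
      then have "\<bar>base_sigma i\<bar> \<le> NR" "\<bar>b i\<bar> \<le> NR"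
        using base_sigma_le[of i] D_le_N N_le_NR b(2)[of i] that by auto
      then show "\<bar>base_sigma i * b i\<bar> \<le> NR * NR" unfolding abs_mult by (intro mult_mono) auto
    qed
    also have "\<dots> = int k * (NR * NR)" by simp
    also have "\<dots> \<le> NR * (NR * NR)"
      using that d_le n_le_N N_le_NR by (intro mult_right_mono) auto
    finally show ?thesis by (simp add: eval_nat_numeral)
  qed
  have loop: "triple (for_loop 14 3 ?body) ?s (\<lambda>s' t. t \<le> 32 * d + 9 \<and> snd s' 4 0 = dot d base_sigma b)"
  proof (rule triple_for[where m = d and C = 20 and I = "\<lambda>k s'. snd s' 4 0 = (\<Sum>i<k. base_sigma i * b i)"], goal_cases)
    case step: (8 k s')
    note k = step(1) and kv = step(4) and I = step(2) and f = step(5,6)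
    show ?case
      by (rule triple_RStore) (insert dle[of "Suc k"] F[OF k] b(1)[OF k] k kv I f, simp_all)
  qed (use L in \<open>auto simp: layout_def dot_def\<close>)
  show "triple (for_loop 14 3 ?body ;; ?rest) ?s (\<lambda>s' t. ?Q s' (anodes (Num 0) + rnodes (RInt (Num 0)) + 1 + t))"
  proof (rule triple_Seq_mono[OF loop], rule triple_Cond)
    fix s1 :: state and t1 :: nat assume s1: "t1 \<le> 32 * d + 9 \<and> snd s1 4 0 = dot d base_sigma b"
      and f1: "\<forall>k. k \<notin> writes (for_loop 14 3 ?body) \<longrightarrow> fst s1 k = fst ?s k"
      "\<forall>k. k \<notin> rwrites (for_loop 14 3 ?body) \<longrightarrow> snd s1 k = snd ?s k"
    let ?k = "bnodes (RLess (rvar 4) (RInt (Num 0))) + 1"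
    have F1: "fst s1 22 (int i) = base_sigma i" if "i < d" for i using F[OF that] f1 by simp
    have s3: "fst s1 3 0 = int d" using L f1 by (simp add: layout_def)
    have beta3: "\<bar>dot d base_sigma b\<bar> \<le> NR ^ 3" using dle[of d] by (simp add: dot_def)
    {
      assume "bval (RLess (rvar 4) (RInt (Num 0))) s1"
      then have neg: "dot d base_sigma b < 0" using s1 by simp
      let ?s2 = "rst 4 0 (- dot d base_sigma b) s1"
      have "triple (for_loop 14 3 ?flip) ?s2 (\<lambda>s' t. t \<le> 32 * d + 9 \<and>
          (\<forall>i<d. fst s' 22 (int i) = - base_sigma i) \<and> snd s' 4 0 = - dot d base_sigma b)"
      proof (rule triple_for[where m = d and C = 20 and I = "\<lambda>k s'. (\<forall>i<k. fst s' 22 (int i) = - base_sigma i) \<and>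
            (\<forall>i<d. k \<le> i \<longrightarrow> fst s' 22 (int i) = base_sigma i)"], goal_cases)
        case step: (8 k s')
        note k = step(1) and kv = step(4) and I = step(2)
        have le: "\<bar>base_sigma k\<bar> \<le> N" using base_sigma_le[OF k] D_le_N by simp
        show ?case
          by (rule triple_Store) (insert le I kv k, auto simp: less_Suc_eq)
      qed (use s3 F1 in auto)
      then have flip: "triple (for_loop 14 3 ?flip) ?s2 (\<lambda>s' t.
          ?Q s' (anodes (Num 0) + rnodes (RInt (Num 0)) + 1 + (t1 + (?k + (anodes (Num 0) + rnodes (RSub (RInt (Num 0)) (rvar 4)) + 1 + t)))))"
        by (rule triple_mono) (insert s1 neg, auto intro!: exI[of _ "-1"])
      show "triple (4 ::~ RSub (RInt (Num 0)) (rvar 4) ;; for_loop 14 3 ?flip) s1 (\<lambda>s' t.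
          ?Q s' (anodes (Num 0) + rnodes (RInt (Num 0)) + 1 + (t1 + (?k + t))))"
        by (rule triple_Seq_RStore) (insert flip s1 beta3, simp_all)
    next
      assume "\<not> bval (RLess (rvar 4) (RInt (Num 0))) s1"
      then show "triple Skip s1 (\<lambda>s' t. ?Q s' (anodes (Num 0) + rnodes (RInt (Num 0)) + 1 + (t1 + (?k + t))))"
        using s1 F1 by (intro triple_Skip conjI exI[of _ 1]) simp_all
    }
  qed simp
qed simp_all

end

section \<open>Minors of the constraint matrix\<close>

lemma finite_square_submatrices: "finite (square_submatrices k A)"
proof -
  have "square_submatrices k A \<subseteq> (\<lambda>(I, J). submatrix A I J) ` (Pow {..<dim_row A} \<times> Pow {..<dim_col A})"
    by (force simp: square_submatrices_def)
  then show ?thesis by (rule finite_subset) simp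
qed

lemma minor_le_Delta:
  assumes "S \<in> square_submatrices n H" "rank_int H = n"
  shows "\<bar>det S\<bar> \<le> Delta H"
  unfolding Delta_def Delta_k_def assms(2)
  using assms(1) by (intro Max_ge finite_imageI finite_square_submatrices) auto

lemma pick_lessThan: "j < n \<Longrightarrow> pick {..<n} j = j"
proof -
  assume j: "j < n"
  then have "{a \<in> {..<n}. a < j} = {..<j}" by auto
  then show ?thesis using pick_card_in_set[of j "{..<n}"] j by simp
qed

locale nonsingular_hnf =
  fixes H :: "int mat" and n d :: nat
  assumes H: "H \<in> carrier_mat d n" and n_pos: "1 \<le> n" and hnf: "reduced_hnf H" and rank: "rank_int H = n"
    and minors: "\<And>S. S \<in> square_submatrices n H \<Longrightarrow> det S \<noteq> 0"
begin

abbreviation \<delta> :: int where "\<delta> \<equiv> det (top_square H)"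
text \<open>Coordinates of row \<open>p\<close> over the basis rows, scaled by \<delta>. By Cramer's
  rule they are, up to sign, the minors obtained by exchanging basis row \<open>q\<close> for row
  \<open>p\<close>.\<close>

definition coord :: "nat \<Rightarrow> nat \<Rightarrow> int" where
  "coord p q = (\<Sum>k<n. H $$ (p, k) * adj_mat (top_square H) $$ (k, q))"

definition rows_of :: "nat set \<Rightarrow> int mat" where
  "rows_of I = submatrix H I {..<n}"

lemma n_le_d: "n \<le> d"
  using hnf H by (simp add: reduced_hnf_def)

lemma rows_of_in:
  assumes "I \<subseteq> {..<d}" "card I = n"
  shows "rows_of I \<in> square_submatrices n H"
  unfolding square_submatrices_def rows_of_def using assms H
  by (intro CollectI exI[of _ I] exI[of _ "{..<n}"]) auto

lemma rows_of_carrier: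
  assumes "I \<subseteq> {..<d}" "card I = n"
  shows "rows_of I \<in> carrier_mat n n"
proof -
  have "{i. i < dim_row H \<and> i \<in> I} = I" "{j. j < dim_col H \<and> j \<in> {..<n}} = {..<n}"
    using assms H by auto
  then show ?thesis using assms by (intro carrier_matI) (simp_all add: rows_of_def dim_submatrix)
qed

lemma rows_of_index:
  assumes "I \<subseteq> {..<d}" "card I = n" "a < n" "k < n"
  shows "rows_of I $$ (a, k) = H $$ (pick I a, k)" "pick I a \<in> I"
proof -
  have "{i. i < dim_row H \<and> i \<in> I} = I" "{j. j < dim_col H \<and> j \<in> {..<n}} = {..<n}"
    using assms H by auto
  then show "rows_of I $$ (a, k) = H $$ (pick I a, k)"
    using assms pick_lessThan[of k n] by (simp add: rows_of_def submatrix_index)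
  show "pick I a \<in> I" using assms by (intro pick_in_set_le) simp
qed

lemma top: "top_square H \<in> carrier_mat n n"
  using H by (simp add: top_square_def)

lemma top_index: "i < n \<Longrightarrow> j < n \<Longrightarrow> top_square H $$ (i, j) = H $$ (i, j)"
  using H by (simp add: top_square_def)

lemma adj: "adj_mat (top_square H) \<in> carrier_mat n n"
  by (rule adj_mat(1)[OF top])

lemma delta_nonzero: "\<delta> \<noteq> 0"
  using hnf by (simp add: reduced_hnf_def Let_def)

lemma coord_top: "i < n \<Longrightarrow> j < n \<Longrightarrow> coord i j = (if i = j then \<delta> else 0)"
proof -
  assume ij: "i < n" "j < n"
  have "(top_square H * adj_mat (top_square H)) $$ (i, j) = coord i j"
    using ij top adj top_index by (simp add: scalar_prod_def coord_def lessThan_atLeast0)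
  then show ?thesis unfolding adj_mat(2)[OF top] using ij by (cases "i = j") auto
qed

lemma det_adj: "\<delta> * det (adj_mat (top_square H)) = \<delta> ^ n"
proof -
  have "det (top_square H * adj_mat (top_square H)) = \<delta> * det (adj_mat (top_square H))"
    by (rule det_mult[OF top adj])
  then show ?thesis unfolding adj_mat(2)[OF top] by (simp add: det_smult)
qed

lemma rows_of_adj:
  assumes "I \<subseteq> {..<d}" "card I = n" "a < n" "q < n"
  shows "(rows_of I * adj_mat (top_square H)) $$ (a, q) = coord (pick I a) q"
  using assms rows_of_carrier[OF assms(1,2)] adj rows_of_index(1)[OF assms(1-3)]
  by (simp add: scalar_prod_def coord_def lessThan_atLeast0)

lemma delta_le: "\<bar>\<delta>\<bar> \<le> Delta H"
proof -
  have "rows_of {..<n} = top_square H"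
    using rows_of_carrier[of "{..<n}"] top n_le_d rows_of_index(1)[of "{..<n}"]
    by (intro eq_matI) (auto simp: pick_lessThan top_index)
  moreover have "rows_of {..<n} \<in> square_submatrices n H" using n_le_d by (intro rows_of_in) auto
  ultimately show ?thesis using minor_le_Delta rank by metis
qed

text \<open>The submatrix times the adjugate has \<delta> times unit vectors as rows, except for the
  coordinates of row \<open>r\<close>. Expanding along column \<open>i\<close> leaves a single
  entry, and \<delta> to the power \<open>n - 1\<close>, the determinant of the adjugate,
  cancels.\<close>

lemma exchange_minor:
  assumes r: "n \<le> r" "r < d" and i: "i < n"
  shows "\<exists>S\<in>square_submatrices n H. \<bar>det S\<bar> = \<bar>coord r i\<bar>"
proof -
  let ?I = "insert r ({..<n} - {i})"
  have I: "?I \<subseteq> {..<d}" "card ?I = n" using r i by auto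
  let ?S = "rows_of ?I" and ?A = "adj_mat (top_square H)"
  let ?P = "?S * ?A"
  have S: "?S \<in> carrier_mat n n" by (rule rows_of_carrier[OF I])
  have P: "?P \<in> carrier_mat n n" using S adj by simp
  \<comment> \<open>A submatrix lists its rows in increasing order: dropping \<open>i\<close> shifts
    the later basis rows by one, and \<open>r\<close> comes last.\<close>
  have pick: "pick ?I a = (if a < i then a else Suc a)" if "a < n - 1" for a
  proof (cases "a < i")
    case True
    have "{x \<in> ?I. x < a} = {..<a}" using True i r by auto
    then show ?thesis using pick_card_in_set[of a ?I] True i by simp
  next
    case False
    have "{x \<in> ?I. x < Suc a} = {..<Suc a} - {i}" using False that i r by auto
    then have "card {x \<in> ?I. x < Suc a} = a" using False by simp
    moreover have "Suc a < n" using that by linarith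
    ultimately show ?thesis using pick_card_in_set[of "Suc a" ?I] False by simp
  qed
  have last: "pick ?I (n - 1) = r"
  proof -
    have "{x \<in> ?I. x < r} = {..<n} - {i}" using r by auto
    then have "card {x \<in> ?I. x < r} = n - 1" using i by simp
    then show ?thesis using pick_card_in_set[of r ?I] by simp
  qed
  have Pc: "?P $$ (a, q) = coord (pick ?I a) q" if "a < n" "q < n" for a q
    by (rule rows_of_adj[OF I that])
  have D: "mat_delete ?P (n - 1) i = \<delta> \<cdot>\<^sub>m 1\<^sub>m (n - 1)"
  proof (rule eq_matI)
    fix a b assume "a < dim_row (\<delta> \<cdot>\<^sub>m 1\<^sub>m (n - 1))" "b < dim_col (\<delta> \<cdot>\<^sub>m 1\<^sub>m (n - 1))"
    then have ab: "a < n - 1" "b < n - 1" by auto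
    have "mat_delete ?P (n - 1) i $$ (a, b) = ?P $$ (a, if b < i then b else Suc b)"
      using ab S adj by (simp add: mat_delete_def)
    also have "\<dots> = coord (if a < i then a else Suc a) (if b < i then b else Suc b)"
      using ab pick[OF ab(1)] by (subst Pc) auto
    also have "\<dots> = (if a = b then \<delta> else 0)"
      using ab by (subst coord_top) auto
    finally show "mat_delete ?P (n - 1) i $$ (a, b) = (\<delta> \<cdot>\<^sub>m 1\<^sub>m (n - 1)) $$ (a, b)"
      using ab by simp
  qed (use P in \<open>auto simp: mat_delete_def\<close>)
  have "det ?P = (\<Sum>k<n. ?P $$ (k, i) * cofactor ?P k i)"
    by (rule laplace_expansion_column[OF P i])
  also have "\<dots> = (\<Sum>k\<in>{n - 1}. ?P $$ (k, i) * cofactor ?P k i)"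
  proof (rule sum.mono_neutral_right)
    show "\<forall>k\<in>{..<n} - {n - 1}. ?P $$ (k, i) * cofactor ?P k i = 0"
    proof
      fix k assume "k \<in> {..<n} - {n - 1}"
      then have k: "k < n - 1" by auto
      have "?P $$ (k, i) = coord (if k < i then k else Suc k) i" using Pc[of k i] pick[OF k] k i by simp
      also have "\<dots> = 0" using k i by (subst coord_top) auto
      finally show "?P $$ (k, i) * cofactor ?P k i = 0" by simp
    qed
  qed (use n_pos in auto)
  also have "\<dots> = coord r i * ((-1) ^ (n - 1 + i) * \<delta> ^ (n - 1))"
    using Pc[of "n - 1" i] last i n_pos D by (simp add: cofactor_def det_smult)
  finally have "\<bar>det ?P\<bar> = \<bar>coord r i\<bar> * \<bar>\<delta> ^ (n - 1)\<bar>" by (simp add: abs_mult power_abs)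
  moreover have "det ?P = det ?S * det ?A" by (rule det_mult[OF S adj])
  moreover have "det ?A = \<delta> ^ (n - 1)"
  proof -
    have "\<delta> * det ?A = \<delta> * \<delta> ^ (n - 1)" using det_adj n_pos by (simp add: power_eq_if)
    then show ?thesis using delta_nonzero by simp
  qed
  ultimately have "\<bar>det ?S\<bar> * \<bar>\<delta> ^ (n - 1)\<bar> = \<bar>coord r i\<bar> * \<bar>\<delta> ^ (n - 1)\<bar>" by (simp add: abs_mult)
  then have "\<bar>det ?S\<bar> = \<bar>coord r i\<bar>" using delta_nonzero by simp
  then show ?thesis using rows_of_in[OF I] by blast
qed

lemma coord_le: "n \<le> r \<Longrightarrow> r < d \<Longrightarrow> i < n \<Longrightarrow> \<bar>coord r i\<bar> \<le> Delta H"
  using exchange_minor minor_le_Delta rank by metis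

lemma coord_nonzero: "n \<le> r \<Longrightarrow> r < d \<Longrightarrow> i < n \<Longrightarrow> coord r i \<noteq> 0"
  using exchange_minor minors by (metis abs_eq_0)

text \<open>Otherwise a combination of columns \<open>i\<close> and \<open>j\<close> of the adjugate
  is annihilated by \<open>r\<close>, \<open>r'\<close> and all basis rows except \<open>i\<close>
  and \<open>j\<close>. These \<open>n\<close> rows would form a singular maximal submatrix, since
  row \<open>i\<close> shows that the combination is nonzero.\<close>

lemma not_parallel:
  assumes r: "n \<le> r" "r < r'" "r' < d" and ij: "i < n" "j < n" "i \<noteq> j"
  shows "coord r i * coord r' j \<noteq> coord r j * coord r' i"
proof
  assume eq: "coord r i * coord r' j = coord r j * coord r' i"
  let ?I = "{r, r'} \<union> ({..<n} - {i, j})"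
  have I: "?I \<subseteq> {..<d}" using r n_le_d by auto
  have "card ?I = card {r, r'} + card ({..<n} - {i, j})"
    by (rule card_Un_disjoint) (use r in auto)
  also have "card ({..<n} - {i, j}) = n - 2" using ij by (simp add: card_Diff_subset)
  finally have c: "card ?I = n" using r ij by simp
  let ?S = "rows_of ?I" and ?A = "adj_mat (top_square H)"
  define x where "x = vec n (\<lambda>k. ?A $$ (k, i) * coord r j - ?A $$ (k, j) * coord r i)"
  have hx: "(\<Sum>k<n. H $$ (p, k) * x $ k) = coord p i * coord r j - coord p j * coord r i" for p
    by (simp add: x_def coord_def right_diff_distrib sum_subtractf sum_distrib_right mult.assoc)
  have S: "?S \<in> carrier_mat n n" by (rule rows_of_carrier[OF I c])
  have "?S *\<^sub>v x = 0\<^sub>v n"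
  proof (rule eq_vecI)
    fix a assume "a < dim_vec (0\<^sub>v n :: int vec)"
    then have a: "a < n" by simp
    have "(?S *\<^sub>v x) $ a = (\<Sum>k<n. H $$ (pick ?I a, k) * x $ k)"
      using a S rows_of_index(1)[OF I c a] by (simp add: scalar_prod_def x_def lessThan_atLeast0)
    also have "\<dots> = coord (pick ?I a) i * coord r j - coord (pick ?I a) j * coord r i" by (rule hx)
    also have "\<dots> = 0"
    proof -
      have "pick ?I a \<in> ?I" by (rule rows_of_index(2)[OF I c a a])
      then consider "pick ?I a = r" | "pick ?I a = r'" | "pick ?I a < n" "pick ?I a \<noteq> i" "pick ?I a \<noteq> j" by auto
      then show ?thesis
      proof cases
        case 2
        then show ?thesis using eq by (simp add: mult.commute)
      next
        case 3
        then show ?thesis using coord_top[of "pick ?I a"] ij by simp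
      qed (simp add: mult.commute)
    qed
    finally show "(?S *\<^sub>v x) $ a = 0\<^sub>v n $ a" using a by simp
  qed (use S in simp)
  moreover have "x \<noteq> 0\<^sub>v n"
  proof
    assume "x = 0\<^sub>v n"
    then have "coord i i * coord r j - coord i j * coord r i = 0" using hx[of i] by simp
    then show False using coord_top[of i] ij delta_nonzero coord_nonzero[of r j] r by simp
  qed
  moreover have "x \<in> carrier_vec n" by (simp add: x_def)
  ultimately have "det ?S = 0" using det_0_iff_vec_prod_zero[OF S] by blast
  then show False using minors[OF rows_of_in[OF I c]] by simp
qed

lemma few_rows:
  assumes "(2 * Delta H + 1)^2 < int n"
  shows "d = n \<or> d = Suc n"
proof (rule ccontr)
  assume "\<not> ?thesis"
  then have d: "Suc n < d" using n_le_d by auto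
  let ?f = "\<lambda>i. (coord n i, coord (Suc n) i)"
  have "inj_on ?f {..<n}"
  proof (rule inj_onI)
    fix i j assume "i \<in> {..<n}" "j \<in> {..<n}" "?f i = ?f j"
    then show "i = j" using not_parallel[of n "Suc n" i j] d by auto
  qed
  then have "n = card (?f ` {..<n})" by (simp add: card_image)
  also have "\<dots> \<le> card ({- Delta H..Delta H} \<times> {- Delta H..Delta H})"
    using coord_le[of n] coord_le[of "Suc n"] d by (intro card_mono) (auto simp: abs_le_iff minus_le_iff)
  also have "\<dots> = nat (2 * Delta H + 1) * nat (2 * Delta H + 1)"
    by (simp add: card_cartesian_product)
  finally have "int n \<le> (2 * Delta H + 1)^2"
    using delta_le by (simp add: power2_eq_square nat_mult_distrib[symmetric] le_nat_iff)
  then show False using assms by simp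
qed

end

section \<open>The whole algorithm\<close>

definition ilp_program :: com where
  "ilp_program = setup_scalars ;; set_functionals ;; max_coefficient ;; orient ;; finish"

lemma polynomial_cost:
  fixes n d m E :: nat
  assumes n: "1 \<le> n" and d: "d \<le> n + 1" and E: "1 \<le> E" "E * E \<le> n" and m: "m \<le> 5 * E ^ 3"
  defines "r \<equiv> 120 * (n + 1)^2 + 40 * n + 80 * d + 170"
  shows "((((r + 12) * d + 9) + 12) * m + 9 + 12) * m + 20 + 600 * (n + 1)^3 + 400 * (n + 1)^2
    + 40 * n + 240 * d + 290 \<le> 60000 * (n ^ 4 * E ^ 4)"
proof -
  have pw: "1 \<le> n ^ k" for k using n by simp
  have n12: "n \<le> n ^ 2" "n ^ 2 \<le> n ^ 3" "n ^ 3 \<le> n ^ 4" "n \<le> n ^ 4"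
    using n power_increasing[of 1 2 n] power_increasing[of 2 3 n] power_increasing[of 3 4 n]
      power_increasing[of 1 4 n] by auto
  have d2: "d \<le> 2 * n" using n d by simp
  have sq: "(n + 1)^2 \<le> 4 * n ^ 2"
    using power_mono[of "n + 1" "2 * n" 2] n by (simp add: power_mult_distrib)
  have cu: "(n + 1)^3 \<le> 8 * n ^ 3"
    using power_mono[of "n + 1" "2 * n" 3] n by (simp add: power_mult_distrib)
  \<comment> \<open>862 = 480 + 40 + 160 + 182, from \<open>(n + 1)^2 \<le> 4 * n ^ 2\<close>,
    \<open>d \<le> 2 * n\<close> and \<open>n \<le> n ^ 2\<close>.\<close>
  have r: "r + 12 \<le> 862 * n ^ 2"
    unfolding r_def using sq d2 n12(1) pw[of 2] by linarith
  have "(r + 12) * d \<le> (862 * n ^ 2) * (2 * n)" using r d2 by (intro mult_mono) auto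
  also have "\<dots> = 1724 * n ^ 3" by (simp add: power2_eq_square power3_eq_cube power4_eq_xxxx mult_ac)
  finally have a: "(r + 12) * d + 9 + 12 \<le> 1745 * n ^ 3" using pw[of 3] by linarith
  \<comment> \<open>The coefficient becomes 1745 * 25 = 43625; of the factor \<open>E ^ 6\<close>
    the part \<open>E * E\<close> is next bounded by \<open>n\<close>.\<close>
  have "((r + 12) * d + 9 + 12) * m * m \<le> (1745 * n ^ 3) * (5 * E ^ 3) * (5 * E ^ 3)"
    using a m by (intro mult_mono) auto
  also have "\<dots> = 43625 * (n ^ 3 * E ^ 4 * (E * E))" by (simp add: power2_eq_square power3_eq_cube power4_eq_xxxx mult_ac)
  also have "\<dots> \<le> 43625 * (n ^ 3 * E ^ 4 * n)" using E by (intro mult_left_mono) auto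
  also have "\<dots> = 43625 * (n ^ 4 * E ^ 4)" by (simp add: power2_eq_square power3_eq_cube power4_eq_xxxx mult_ac)
  finally have b: "((r + 12) * d + 9 + 12) * m * m \<le> 43625 * (n ^ 4 * E ^ 4)" .
  have E4: "1 \<le> E ^ 4" "E ^ 3 \<le> E ^ 4" using E power_increasing[of 3 4 E] by auto
  have X: "n ^ 4 \<le> n ^ 4 * E ^ 4" using E4(1) by simp
  have "E ^ 3 \<le> n ^ 4 * E ^ 4" using E4(2) pw[of 4] mult_mono[of 1 "n ^ 4" "E ^ 3" "E ^ 4"] by simp
  then have c: "21 * m \<le> 105 * (n ^ 4 * E ^ 4)" using m by linarith
  have "((((r + 12) * d + 9) + 12) * m + 9 + 12) * m = ((r + 12) * d + 9 + 12) * m * m + 21 * m"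
    by (simp add: distrib_right)
  then show ?thesis using b c sq cu X n12 pw[of 4] d2 by linarith
qed

context program
begin

lemma fill_cost_mono: "a \<le> b \<Longrightarrow> fill_cost a \<le> fill_cost b"
  unfolding fill_cost_def by (intro add_mono mult_mono) auto

lemma triple_program:
  assumes dims_s: "fst s 0 0 = int d" "fst s 0 1 = int n" and Hs: "fst s 1 = Harr"
    and cs: "\<And>j. j < n \<Longrightarrow> fst s 2 (int j) = c j"
    and zero: "\<And>k. 3 \<le> k \<Longrightarrow> fst s k = (\<lambda>_. 0)"
    and b: "\<And>i. i < d \<Longrightarrow> snd s 0 (int i) = b i" "\<And>i. i < d \<Longrightarrow> \<bar>b i\<bar> \<le> NR"
  shows "triple ilp_program s (\<lambda>s' t. t \<le> fill_cost (nat (slots (2 * (D * D)))) + 600 * (n + 1)^3 +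
     400 * (n + 1)^2 + 40 * n + 240 * d + 290 \<and> correct_answer b s')"
    (is "triple _ _ ?Q")
  unfolding ilp_program_def
proof (rule triple_Seq_mono[OF triple_setup_scalars[OF dims_s Hs]], goal_cases)
  case s1: (1 s1 t1)
  note f1 = s1(3,4)
  have L1: "layout_c s1" using s1 cs f1 by (simp add: layout_c_def)
  have z1: "fst s1 21 = (\<lambda>_. 0)" using zero[of 21] f1 by simp
  have p1: "fst s1 5 0 = pivots n" "fst s1 9 0 = (int n + 1) * pivots n * pivots n" using s1 by auto
  show ?case
  proof (rule triple_Seq_mono[OF triple_set_functionals[OF L1 p1 z1]], goal_cases)
    case s2: (1 s2 t2)
    note f2 = s2(3,4)
    have L2: "layout s2" using L1 f2 by (simp add: layout_c_def layout_def)
    have p2: "fst s2 5 0 = pivots n" using p1 f2 by simp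
    show ?case
    proof (rule triple_Seq_mono[OF triple_max_coefficient[OF L2 p2]])
      show "fst s2 22 (int i) = base_sigma i" if "i < d" for i using s2 that by simp
      fix s3 :: state and t3 :: nat
      assume s3: "t3 \<le> 80 * d + 20 \<and> pivots n \<le> fst s3 6 0 \<and> fst s3 6 0 \<le> D \<and> (\<forall>i<d. \<bar>base_sigma i\<bar> \<le> fst s3 6 0)"
        and f3: "\<forall>k. k \<notin> writes max_coefficient \<longrightarrow> fst s3 k = fst s2 k"
          "\<forall>k. k \<notin> rwrites max_coefficient \<longrightarrow> snd s3 k = snd s2 k"
      have L3: "layout s3" using L2 f3 by (simp add: layout_def)
      have F3: "fst s3 22 (int i) = base_sigma i" if "i < d" for i using s2 f3 that by simp
      have b3: "snd s3 0 (int i) = b i" if "i < d" for i using b(1)[OF that] f1 f2 f3 by simp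
      show "triple (orient ;; finish) s3 (\<lambda>s' t. ?Q s' (t1 + (t2 + (t3 + t))))"
      proof (rule triple_Seq_mono[OF triple_orient[OF L3 F3 b3 b(2)]], goal_cases)
        case s4: (4 s4 t4)
        note f4 = s4(3,4)
        from s4(1) obtain \<epsilon>' where e: "\<epsilon>' = 1 \<or> \<epsilon>' = -1" "\<forall>i<d. fst s4 22 (int i) = \<epsilon>' * base_sigma i"
            "snd s4 4 0 = \<epsilon>' * dot d base_sigma b" "0 \<le> snd s4 4 0" by blast
        define D' where "D' = fst s3 6 0"
        have D': "pivots n \<le> D'" "D' \<le> D" "\<And>i. i < d \<Longrightarrow> \<bar>base_sigma i\<bar> \<le> D'" using s3 by (auto simp: D'_def)
        \<comment> \<open>Bound and sign are known only in this state of the run, so the remaining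
          phases are reasoned about in a second instance with \<open>D'\<close> and
          \<open>\<epsilon>'\<close>; \<open>H\<close>, \<open>A\<close> and \<open>c\<close> stay
          the same.\<close>
        interpret p2: program mul N NR B0 B1 n H d Harr A c D' \<epsilon>'
        proof unfold_locales
          show "\<bar>\<Sum>k<n. H n k * A k i\<bar> \<le> D'" if "i < n" for i
            using D'(3)[of i] that n_le_d by (simp add: base_sigma_def w_def)
        qed (use D' e(1) D_le_N dims beyond adjugate in auto)
        have sig: "p2.\<sigma> i = \<epsilon>' * base_sigma i" if "i < d" for i
          using that d_le by (auto simp: p2.\<sigma>_def base_sigma_def)
        have sgb: "dot d p2.\<sigma> b = \<epsilon>' * dot d base_sigma b"
          unfolding dot_def sum_distrib_left using sig by (intro sum.cong) (auto simp: mult.assoc)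
        have L4: "layout s4" "fst s4 5 0 = pivots n" "fst s4 6 0 = D'"
          using L3 p2 f4 f3 by (simp_all add: layout_def D'_def)
        have F4: "p2.functionals s4"
          using e(2) s2 f3 f4 sig by (simp add: p2.functionals_def)
        have b4: "snd s4 0 (int i) = b i" if "i < d" for i using b3[OF that] f4 by simp
        have beta4: "snd s4 4 0 = dot d p2.\<sigma> b" "0 \<le> dot d p2.\<sigma> b" using e sgb by auto
        have z4: "fst s4 23 = (\<lambda>_. 0)" "fst s4 24 = (\<lambda>_. 0)" "fst s4 25 = (\<lambda>_. 0)"
          using zero f1 f2 f3 f4 by simp_all
        have "D' * D' \<le> D * D" using D' pivots_pos[of n] by (intro mult_mono) auto
        then have "slots (2 * (D' * D')) \<le> slots (2 * (D * D))"
          unfolding slots_def using pivots_pos[of n] by (intro mult_left_mono) auto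
        then have fc: "fill_cost (nat (slots (2 * (D' * D')))) \<le> fill_cost (nat (slots (2 * (D * D))))"
          by (intro fill_cost_mono) simp
        show ?case
          by (rule triple_mono[OF p2.triple_finish[OF L4(1) F4 L4(2,3) b4 b(2) beta4 z4]])
            (use s1 s2 s3 s4 fc in auto)
      qed
    qed
  qed
qed

end

section \<open>Bit sizes and the encoding of the input\<close>

lemma isize_mono: "\<bar>x\<bar> \<le> \<bar>y\<bar> \<Longrightarrow> isize x \<le> isize y"
  unfolding isize_def by (intro add_left_mono nat_mono ceiling_mono log_mono) auto

lemma isize_ge_log: "log 2 (real_of_int \<bar>x\<bar> + 1) \<le> real (isize x)"
  unfolding isize_def using le_of_int_ceiling[of "log 2 (real_of_int \<bar>x\<bar> + 1)"] by linarith

lemma isize_power: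
  assumes "1 \<le> M"
  shows "real (isize (M ^ k)) \<le> 3 + real k * log 2 (real_of_int M)"
proof -
  have M: "1 \<le> real_of_int M" using assms by simp
  have p: "1 \<le> M ^ k" using assms by simp
  have "real_of_int \<bar>M ^ k\<bar> = real_of_int M ^ k" using p by simp
  then have "log 2 (real_of_int \<bar>M ^ k\<bar> + 1) \<le> log 2 (2 * real_of_int M ^ k)"
    using one_le_power[OF M, of k] by (intro log_mono) linarith+
  also have "\<dots> = 1 + real k * log 2 (real_of_int M)"
    using M by (simp add: log_mult log_nat_power)
  finally have "real_of_int \<lceil>log 2 (real_of_int \<bar>M ^ k\<bar> + 1)\<rceil> \<le> 2 + real k * log 2 (real_of_int M)"
    using ceiling_correct[of "log 2 (real_of_int \<bar>M ^ k\<bar> + 1)"] by linarith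
  moreover have "0 \<le> log 2 (real_of_int \<bar>M ^ k\<bar> + 1)" by simp
  ultimately show ?thesis by (simp add: isize_def)
qed

text \<open>One plus a sum of absolute values is at most the product of the terms increased by one,
  whose logarithm is the sum of their logarithms.\<close>

lemma log_sum_le_isize:
  fixes f :: "nat \<Rightarrow> int"
  shows "log 2 (1 + real_of_int (\<Sum>j<k. \<bar>f j\<bar>)) \<le> (\<Sum>j<k. real (isize (f j)))"
proof (induction k)
  case (Suc k)
  let ?S = "real_of_int (\<Sum>j<k. \<bar>f j\<bar>)" and ?x = "real_of_int \<bar>f k\<bar>"
  have S: "0 \<le> ?S" by (simp add: sum_nonneg)
  have "0 \<le> (\<Sum>j<Suc k. \<bar>f j\<bar>)" by (intro sum_nonneg) simp
  then have pos: "0 \<le> real_of_int (\<Sum>j<Suc k. \<bar>f j\<bar>)" by linarith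
  have "1 + real_of_int (\<Sum>j<Suc k. \<bar>f j\<bar>) \<le> (1 + ?S) * (?x + 1)"
    using mult_nonneg_nonneg[OF S, of ?x] by (simp add: algebra_simps)
  then have "log 2 (1 + real_of_int (\<Sum>j<Suc k. \<bar>f j\<bar>)) \<le> log 2 ((1 + ?S) * (?x + 1))"
    using pos by (intro log_mono) linarith+
  also have "\<dots> = log 2 (1 + ?S) + log 2 (?x + 1)"
    using S by (intro log_mult_pos) linarith+
  finally show ?case using Suc.IH isize_ge_log[of "f k"] by simp
qed simp

lemma vsize_ge: "2 * dim_vec v \<le> vsize v"
proof -
  have "(\<Sum>i<dim_vec v. 1) \<le> (\<Sum>i<dim_vec v. isize (v $ i))"
    by (intro sum_mono) (simp add: isize_def)
  then show ?thesis by (simp add: vsize_def)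
qed

lemma log_sum_le_vsize: "log 2 (1 + real_of_int (\<Sum>j<dim_vec v. \<bar>v $ j\<bar>)) \<le> real (vsize v)"
  using log_sum_le_isize[of "\<lambda>j. v $ j" "dim_vec v"] by (simp add: vsize_def)

lemma concat_nth_uniform:
  assumes "\<And>xs. xs \<in> set xss \<Longrightarrow> length xs = n"
  shows "length (concat xss) = length xss * n"
    "i < length xss \<Longrightarrow> j < n \<Longrightarrow> concat xss ! (i * n + j) = xss ! i ! j"
  using assms
proof (induction xss arbitrary: i)
  case (Cons xs xss)
  {
    case 1
    then show ?case using Cons.IH(1) by simp
  next
    case 2
    then show ?case using Cons.IH(2)[of "i - 1"] by (cases i) (auto simp: nth_append)
  }
qed simp_all

lemma array_of_nat: "array_of xs (int i) = (if i < length xs then xs ! i else 0)"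
  by (simp add: array_of_def)

lemma array_of_le: "(\<And>x. x \<in> set xs \<Longrightarrow> \<bar>x\<bar> \<le> B) \<Longrightarrow> 0 \<le> B \<Longrightarrow> \<bar>array_of xs i\<bar> \<le> B"
  by (auto simp: array_of_def)

text \<open>The row index is unrestricted: reading past the last row gives the default 0, which
  agrees with extending the matrix by zero rows.\<close>

lemma array_of_rows:
  assumes H: "H \<in> carrier_mat d n" and j: "j < n"
  shows "array_of (concat (map list_of_vec (rows H))) (int i * int n + int j) = (if i < d then H $$ (i, j) else 0)"
proof -
  let ?xss = "map list_of_vec (rows H)"
  have len: "length xs = n" if "xs \<in> set ?xss" for xs using that H by (auto simp: rows_def)
  have l: "length (concat ?xss) = d * n" using concat_nth_uniform(1)[of ?xss n, OF len] H by simp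
  have "int i * int n + int j = int (i * n + j)" by simp
  then have e: "array_of (concat ?xss) (int i * int n + int j) =
      (if i * n + j < d * n then concat ?xss ! (i * n + j) else 0)"
    using array_of_nat[of "concat ?xss" "i * n + j"] l by simp
  show ?thesis
  proof (cases "i < d")
    case True
    then have "(i + 1) * n \<le> d * n" by (intro mult_right_mono) auto
    then have "i * n + j < d * n" using j by simp
    moreover have "concat ?xss ! (i * n + j) = H $$ (i, j)"
      using concat_nth_uniform(2)[of ?xss n i j, OF len] True j H by (simp add: list_of_vec_index)
    ultimately show ?thesis using e True by simp
  next
    case False
    then have "d * n \<le> i * n" by (intro mult_right_mono) auto
    then have "\<not> i * n + j < d * n" by linarith
    then show ?thesis using e False by simp
  qed
qed

context nonsingular_hnf
begin

section \<open>The given matrix as an instance of the slack system\<close>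

definition coeff :: "nat \<Rightarrow> nat \<Rightarrow> int" where
  "coeff i j = (if i < d \<and> j < n then H $$ (i, j) else 0)"

definition adj_entry :: "nat \<Rightarrow> nat \<Rightarrow> int" where
  "adj_entry i j = adj_mat (top_square H) $$ (i, j)"

lemma Delta_pos: "1 \<le> Delta H"
  using delta_le delta_nonzero by linarith

lemma lower_hnf_coeff: "lower_hnf n coeff"
proof
  have hnf': "\<forall>i<n. \<forall>j<n. i < j \<longrightarrow> H $$ (i, j) = 0"
    "\<forall>i<n. \<forall>j<i. 0 \<le> H $$ (i, j) \<and> H $$ (i, j) < H $$ (i, i)"
    "\<exists>s\<le>n. (\<forall>i<s. H $$ (i, i) = 1) \<and> (\<forall>i. s \<le> i \<and> i < n \<longrightarrow> 2 \<le> H $$ (i, i))"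
    using hnf H unfolding reduced_hnf_def Let_def by auto
  show "coeff i j = 0" if "i < n" "j < n" "i < j" for i j using that hnf'(1) by (simp add: coeff_def)
  show "0 \<le> coeff i j \<and> coeff i j < coeff i i" if "i < n" "j < i" for i j
    using that hnf'(2) n_le_d by (simp add: coeff_def)
  show "1 \<le> coeff i i" if i: "i < n" for i
  proof -
    obtain s where s: "\<forall>i<s. H $$ (i, i) = 1" "\<forall>i. s \<le> i \<and> i < n \<longrightarrow> 2 \<le> H $$ (i, i)"
      using hnf'(3) by blast
    have "1 \<le> H $$ (i, i)"
    proof (cases "i < s")
      case False
      then have "2 \<le> H $$ (i, i)" using s(2) i by simp
      then show ?thesis by simp
    qed (use s(1) in simp)
    then show ?thesis using i n_le_d by (simp add: coeff_def)
  qed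
qed

interpretation lower_hnf n coeff
  by (rule lower_hnf_coeff)

lemma pivots_delta: "pivots n = \<delta>"
proof -
  have "\<delta> = prod_list (diag_mat (top_square H))"
    by (rule det_lower_triangular[OF _ top])
      (use top_index upper_zero n_le_d in \<open>auto simp: coeff_def\<close>)
  also have "\<dots> = (\<Prod>i<n. top_square H $$ (i, i))"
    using top by (simp add: prod_list_diag_prod lessThan_atLeast0)
  also have "\<dots> = pivots n"
    unfolding pivots_def using n_le_d by (intro prod.cong) (auto simp: top_index coeff_def)
  finally show ?thesis by simp
qed

lemma coeff_coord: "r < d \<Longrightarrow> (\<Sum>k<n. coeff r k * adj_entry k i) = coord r i"
  by (simp add: coord_def coeff_def adj_entry_def)

lemma slack_system_coeff:
  assumes "d = n \<or> d = Suc n"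
  shows "slack_system n coeff d adj_entry (Delta H) 1"
proof unfold_locales
  show "d = n \<or> d = Suc n" by fact
  show "coeff n k = 0" if "d = n" for k unfolding coeff_def using that by simp
  show "(\<Sum>k<n. coeff i k * adj_entry k j) = (if i = j then pivots n else 0)" if "i < n" "j < n" for i j
    using coeff_coord[of i j] coord_top[OF that] that n_le_d by (simp add: pivots_delta)
  show "\<bar>\<Sum>k<n. coeff n k * adj_entry k i\<bar> \<le> Delta H" if "i < n" for i
  proof (cases "d = n")
    case True
    then show ?thesis unfolding coeff_def using Delta_pos by simp
  next
    case False
    then have "n < d" using assms by auto
    then show ?thesis using coeff_coord[of n i] coord_le[of n i] that by simp
  qed
  show "pivots n \<le> Delta H" using delta_le by (simp add: pivots_delta)
qed auto

text \<open>The time bound does not mention the size of \<open>H\<close>, so its entries must be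
  bounded by \<open>n\<close> and \<Delta>. A basis entry is at most its pivot; the row below the
  basis, times the pivot product, is a combination of basis rows with minors as
  coefficients.\<close>

lemma coeff_le:
  assumes "d = n \<or> d = Suc n" and i: "i < d" and j: "j < n"
  shows "\<bar>coeff i j\<bar> \<le> int n * Delta H * Delta H"
proof -
  interpret slack_system n coeff d adj_entry "\<lambda>_. 0" "Delta H" 1
    by (rule slack_system_coeff[OF assms(1)])
  have DD: "Delta H \<le> int n * Delta H * Delta H"
  proof -
    have "1 * Delta H * 1 \<le> int n * Delta H * Delta H"
      using n_pos Delta_pos by (intro mult_mono) auto
    then show ?thesis by simp
  qed
  have diag: "coeff i i \<le> Delta H" if "i < n" for i
  proof -
    have "1 * coeff i i \<le> pivots i * coeff i i"
      using pivots_pos[of i] diag_pos[OF that] that by (intro mult_right_mono) auto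
    also have "\<dots> \<le> pivots n" using pivots_mono[of "Suc i" n] that by (simp add: pivots_Suc)
    finally show ?thesis using pivots_le by simp
  qed
  have top: "0 \<le> coeff i j \<and> coeff i j \<le> Delta H" if "i < n" "j < n" for i j
  proof -
    consider "i < j" | "i = j" | "j < i" by linarith
    then show ?thesis
    proof cases
      case 1
      then show ?thesis using upper_zero[OF that] Delta_pos by simp
    next
      case 2
      then show ?thesis using diag[OF that(1)] diag_pos[OF that(1)] by simp
    next
      case 3
      then show ?thesis using diag[OF that(1)] off_diag[OF that(1) 3] by simp
    qed
  qed
  show ?thesis
  proof (cases "i < n")
    case True
    then show ?thesis using top[OF True j] DD by simp
  next
    case False
    then have i: "i = n" using i assms(1) by auto
    have rj: "row i' (\<lambda>k. if k = j then 1 else 0) = coeff i' j" for i'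
      using j by (simp add: row_def if_distrib cong: if_cong)
    have "pivots n * (\<Sum>k<n. coeff n k * (if k = j then 1 else 0)) = (\<Sum>i<n. w i * coeff i j)"
      using functional_row[of "\<lambda>i. coeff i j" "\<lambda>k. if k = j then 1 else 0" "coeff n"] rj by (simp add: w_def)
    moreover have "(\<Sum>k<n. coeff n k * (if k = j then 1 else 0)) = coeff n j"
      using rj[of n] by (simp add: row_def)
    ultimately have "pivots n * coeff n j = (\<Sum>i<n. w i * coeff i j)" by simp
    then have "\<bar>pivots n * coeff n j\<bar> \<le> (\<Sum>i<n. \<bar>w i * coeff i j\<bar>)" by (simp add: sum_abs)
    also have "\<dots> \<le> (\<Sum>i<n. Delta H * Delta H)"
    proof (rule sum_mono)
      fix i assume "i \<in> {..<n}"
      then show "\<bar>w i * coeff i j\<bar> \<le> Delta H * Delta H"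
        using top[of i j] minor_le[of i] j Delta_pos unfolding abs_mult
        by (intro mult_mono) (auto simp: w_def)
    qed
    also have "\<dots> = int n * Delta H * Delta H" by simp
    finally have "pivots n * \<bar>coeff n j\<bar> \<le> int n * Delta H * Delta H"
      using pivots_pos[of n] by (simp add: abs_mult)
    moreover have "1 * \<bar>coeff n j\<bar> \<le> pivots n * \<bar>coeff n j\<bar>"
      using pivots_pos[of n] by (intro mult_right_mono) auto
    ultimately show ?thesis using i by simp
  qed
qed

end

section \<open>From step counts to the time bounds\<close>

lemma mult_cost_power:
  fixes mul :: "nat \<Rightarrow> real"
  assumes "\<And>k. mul (2 * k) \<le> C * mul k" "0 \<le> C"
  shows "mul (2 ^ j * k) \<le> C ^ j * mul k"
proof (induction j)
  case (Suc j)
  have "mul (2 ^ Suc j * k) = mul (2 * (2 ^ j * k))" by (simp add: mult.assoc)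
  also have "\<dots> \<le> C * mul (2 ^ j * k)" by (rule assms(1))
  also have "\<dots> \<le> C * (C ^ j * mul k)" using Suc assms(2) by (intro mult_left_mono) auto
  finally show ?case by (simp add: mult.assoc)
qed simp

lemma (in nonsingular_hnf) solves:
  assumes mul: "mono mul" "\<And>k. real k \<le> mul k" "\<And>k. mul (2 * k) \<le> C * mul k" "0 \<le> C"
    and c: "c \<in> carrier_vec n" and b: "b \<in> carrier_vec d"
    and large: "Delta H * (2 * Delta H + 1)^2 < int n"
  shows "\<exists>s t t'. exec mul (\<lambda>_. 0) ilp_program (ilp_input H c b) s t \<and>
      exec mul isize ilp_program (ilp_input H c b) s t' \<and>
      ilp_correct c (integer_points (polyhedron H b)) (ilp_output n s) \<and>
      t \<le> 180000 * C ^ 7 * (real n ^ 4 * real_of_int (Delta H) ^ 4 * mul (vsize c + e)) \<and>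
      t' \<le> 180000 * C ^ 7 * (real n ^ 4 * real_of_int (Delta H) ^ 4 * mul (vsize c + vsize b + e))"
proof -
  define D where "D = Delta H"
  have D1: "1 \<le> D" using Delta_pos by (simp add: D_def)
  have sq: "1 \<le> (2 * D + 1)^2" "D \<le> (2 * D + 1)^2" "9 \<le> (2 * D + 1)^2"
    using D1 power_mono[of 3 "2 * D + 1" 2] by (auto simp: power2_eq_square algebra_simps)
  have "1 * (2 * D + 1)^2 \<le> D * (2 * D + 1)^2" using D1 by (intro mult_right_mono) auto
  then have small: "(2 * Delta H + 1)^2 < int n" using large by (simp add: D_def)
  have "D * D \<le> D * (2 * D + 1)^2" using sq(2) D1 by (intro mult_left_mono) auto
  then have DDn: "D * D \<le> int n" using large by (simp add: D_def)
  have Dn: "D \<le> int n" "9 \<le> int n" using sq small by (auto simp: D_def)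
  have dims: "d = n \<or> d = Suc n" by (rule few_rows[OF small])
  define cf where "cf = (\<lambda>j. c $ j)"
  define bf where "bf = (\<lambda>i. b $ i)"
  define Sc where "Sc = (\<Sum>j<n. \<bar>c $ j\<bar>)"
  define Sb where "Sb = (\<Sum>j<d. \<bar>b $ j\<bar>)"
  \<comment> \<open>\<open>N\<close> dominates the dimensions, the entries of \<open>c\<close> and,
    as \<open>D \<le> int n\<close>, the minors. The product form splits its logarithm into a term
    in \<open>n\<close> and a term bounded by \<open>vsize c\<close>.\<close>
  define N where "N = (int n + 2) * (1 + Sc)"
  define NR where "NR = N * (1 + Sb)"
  have S0: "0 \<le> Sc" "0 \<le> Sb" by (auto simp: Sc_def Sb_def sum_nonneg)
  have "(int n + 2) * 1 \<le> N" unfolding N_def using S0 by (intro mult_left_mono) auto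
  then have N: "int n + 2 \<le> N" by simp
  have "N * 1 \<le> NR" unfolding NR_def using S0 N by (intro mult_left_mono) auto
  then have NR: "N \<le> NR" by simp
  have cN: "\<bar>c $ j\<bar> \<le> N" if "j < n" for j
  proof -
    have "\<bar>c $ j\<bar> \<le> Sc" unfolding Sc_def using that member_le_sum[of j "{..<n}" "\<lambda>j. \<bar>c $ j\<bar>"] by simp
    also have "\<dots> \<le> 1 * (1 + Sc)" by simp
    also have "\<dots> \<le> N" unfolding N_def using S0 by (intro mult_right_mono) auto
    finally show ?thesis .
  qed
  have bN: "\<bar>b $ j\<bar> \<le> NR" if "j < d" for j
  proof -
    have "\<bar>b $ j\<bar> \<le> Sb" unfolding Sb_def using that member_le_sum[of j "{..<d}" "\<lambda>j. \<bar>b $ j\<bar>"] by simp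
    also have "\<dots> \<le> 1 * (1 + Sb)" by simp
    also have "\<dots> \<le> NR" unfolding NR_def using S0 N by (intro mult_right_mono) auto
    finally show ?thesis .
  qed
  define s0 where "s0 = ilp_input H c b"
  define Harr where "Harr = fst s0 1"
  have s0: "fst s0 0 = array_of [int d, int n]" "fst s0 1 = array_of (concat (map list_of_vec (rows H)))"
    "fst s0 2 = array_of (list_of_vec c)" "snd s0 0 = array_of (list_of_vec b)"
    "\<And>k. 3 \<le> k \<Longrightarrow> fst s0 k = (\<lambda>_. 0)" "\<And>k. 1 \<le> k \<Longrightarrow> snd s0 k = (\<lambda>_. 0)"
    using H by (auto simp: s0_def ilp_input_def)
  interpret machine mul N NR "isize (N ^ 60)" "isize (NR ^ 60)"
  proof
    show "10 \<le> N" "N \<le> NR" using N NR Dn by auto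
    show "isize x \<le> isize (N ^ 60)" if "\<bar>x\<bar> \<le> N ^ 60" for x using that by (intro isize_mono) simp
    show "isize x \<le> isize (NR ^ 60)" if "\<bar>x\<bar> \<le> NR ^ 60" for x using that by (intro isize_mono) simp
  qed (use mul in auto)
  interpret slack_system n coeff d adj_entry cf D 1
    unfolding D_def by (rule slack_system_coeff[OF dims])
  interpret program mul N NR "isize (N ^ 60)" "isize (NR ^ 60)" n coeff d Harr adj_entry cf D 1
  proof unfold_locales
    show "Harr (int i * int n + int j) = coeff i j" if "j < n" for i j
      unfolding Harr_def s0(2) coeff_def using array_of_rows[OF H that, of i] that by simp
    show "pivots n \<le> N" using pivots_le Dn N by simp
    show "D \<le> N" using Dn N by simp
  qed (use n_pos dims N in auto)
  have "bounded s0"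
    unfolding bounded_def
  proof (intro conjI allI)
    have N0: "0 \<le> N" "0 \<le> NR" using N NR by auto
    fix k :: nat and i :: int
    have HN: "\<bar>x\<bar> \<le> N ^ 3" if x: "x \<in> set (concat (map list_of_vec (rows H)))" for x
    proof -
      obtain i j where ij: "i < d" "j < n" "x = H $$ (i, j)"
        using x H by (auto simp: rows_def set_list_of_vec vec_set_def)
      have "\<bar>coeff i j\<bar> \<le> int n * Delta H * Delta H" by (rule coeff_le[OF dims ij(1,2)])
      also have "\<dots> \<le> N * N * N" using Dn N D1 unfolding D_def by (intro mult_mono) auto
      finally show ?thesis using ij by (simp add: coeff_def power3_eq_cube)
    qed
    consider "k = 0" | "k = 1" | "k = 2" | "3 \<le> k" by linarith
    then show "\<bar>fst s0 k i\<bar> \<le> N ^ env k"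
    proof cases
      case 1
      have "\<bar>array_of [int d, int n] i\<bar> \<le> N"
        using N dims N0 by (intro array_of_le) auto
      then show ?thesis using 1 s0(1) by simp
    next
      case 2
      have "\<bar>array_of (concat (map list_of_vec (rows H))) i\<bar> \<le> N ^ 3"
        using HN N0 by (intro array_of_le) auto
      then show ?thesis using 2 s0(2) by simp
    next
      case 3
      have "\<bar>array_of (list_of_vec c) i\<bar> \<le> N"
        using cN c N0 by (intro array_of_le) (auto simp: set_list_of_vec vec_set_def)
      then show ?thesis using 3 s0(3) by simp
    next
      case 4
      then show ?thesis using s0(5) N0 by simp
    qed
    show "\<bar>snd s0 k i\<bar> \<le> NR ^ renv k"
    proof (cases "k = 0")
      case True
      have "NR ^ 1 \<le> NR ^ 4" using N NR by (intro power_increasing) auto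
      then have "\<bar>array_of (list_of_vec b) i\<bar> \<le> NR ^ 4"
        using bN b N0 by (intro array_of_le) (auto simp: set_list_of_vec vec_set_def intro: order_trans)
      then show ?thesis using True s0(4) by simp
    next
      case False
      then show ?thesis using s0(6)[of k] N0 by simp
    qed
  qed
  have "triple ilp_program s0 (\<lambda>s' t. t \<le> fill_cost (nat (slots (2 * (D * D)))) + 600 * (n + 1)^3 +
     400 * (n + 1)^2 + 40 * n + 240 * d + 290 \<and> correct_answer bf s')"
  proof (rule triple_program)
    show "fst s0 0 0 = int d" "fst s0 0 1 = int n" unfolding s0(1) by (simp_all add: array_of_def)
    show "fst s0 1 = Harr" by (simp add: Harr_def)
    show "fst s0 2 (int j) = cf j" if "j < n" for j
      using that c by (simp add: s0(3) array_of_nat cf_def list_of_vec_index)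
    show "fst s0 k = (\<lambda>_. 0)" if "3 \<le> k" for k by (rule s0(5)[OF that])
    show "snd s0 0 (int i) = bf i" if "i < d" for i
      using that b by (simp add: s0(4) array_of_nat bf_def list_of_vec_index)
    show "\<bar>bf i\<bar> \<le> NR" if "i < d" for i using bN[OF that] by (simp add: bf_def)
  qed
  then obtain s' t where st: "runs ilp_program s0 s' t" "correct_answer bf s'"
      "t \<le> fill_cost (nat (slots (2 * (D * D)))) + 600 * (n + 1)^3 + 400 * (n + 1)^2 + 40 * n + 240 * d + 290"
    using \<open>bounded s0\<close> by (auto simp: triple_def)
  have t: "t \<le> 60000 * (n ^ 4 * nat D ^ 4)"
  proof -
    have m: "nat (slots (2 * (D * D))) \<le> 5 * nat D ^ 3"
    proof -
      have "slots (2 * (D * D)) \<le> D * (2 * (2 * (D * D)) + 1)"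
        unfolding slots_def using pivots_le D1 by (intro mult_right_mono) auto
      also have "\<dots> \<le> 5 * D ^ 3"
        using D1 mult_mono[of 1 "D * D" D D] mult_mono[of 1 D 1 D] by (simp add: power3_eq_cube algebra_simps)
      also have "\<dots> = int (5 * nat D ^ 3)" using D1 by simp
      finally show ?thesis by (simp only: nat_le_iff)
    qed
    have "int (nat D * nat D) \<le> int n" using DDn D1 by simp
    then have E: "nat D * nat D \<le> n" by linarith
    have "t \<le> ((((relax_cost + 12) * d + 9) + 12) * nat (slots (2 * (D * D))) + 9 + 12) * nat (slots (2 * (D * D))) + 20
        + 600 * (n + 1)^3 + 400 * (n + 1)^2 + 40 * n + 240 * d + 290"
      using st(3) by (simp add: fill_cost_def)
    also have "\<dots> \<le> 60000 * (n ^ 4 * nat D ^ 4)"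
      unfolding relax_cost_def by (rule polynomial_cost) (use n_pos d_le D1 E m in auto)
    finally show ?thesis .
  qed
  \<comment> \<open>\<open>n + 2 \<le> 2 ^ (n + 1)\<close> and \<open>n + 1 \<le> vsize c\<close>
    pay for the dimension, so the operand size needs no extra term for it.\<close>
  have logN: "log 2 (real_of_int N) \<le> 2 * real (vsize c)"
  proof -
    have "log 2 (real n + 2) \<le> real (n + 1)"
    proof -
      have "n + 2 \<le> 2 ^ (n + 1)" using less_exp[of "n + 1"] by linarith
      then have "real (n + 2) \<le> 2 ^ (n + 1)" by (metis of_nat_le_iff of_nat_numeral of_nat_power)
      then have "log 2 (real n + 2) \<le> log 2 (2 ^ (n + 1))" by (intro log_mono) linarith+
      also have "\<dots> = real (n + 1)" by (rule log_pow_cancel) auto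
      finally show ?thesis .
    qed
    also have "\<dots> \<le> real (vsize c)" using vsize_ge[of c] c n_pos by simp
    finally have 1: "log 2 (real n + 2) \<le> real (vsize c)" .
    have 2: "log 2 (1 + real_of_int Sc) \<le> real (vsize c)"
      using log_sum_le_vsize[of c] c by (simp add: Sc_def)
    have "log 2 (real_of_int N) = log 2 (real n + 2) + log 2 (1 + real_of_int Sc)"
      unfolding N_def using S0 by (simp add: log_mult_pos)
    then show ?thesis using 1 2 by simp
  qed
  have logNR: "log 2 (real_of_int NR) \<le> 2 * real (vsize c) + real (vsize b)"
  proof -
    have "log 2 (1 + real_of_int Sb) \<le> real (vsize b)"
      using log_sum_le_vsize[of b] b by (simp add: Sb_def)
    moreover have "log 2 (real_of_int NR) = log 2 (real_of_int N) + log 2 (1 + real_of_int Sb)"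
      unfolding NR_def using S0 N by (simp add: log_mult_pos)
    ultimately show ?thesis using logN by simp
  qed
  have vc: "1 \<le> vsize c" using vsize_ge[of c] c n_pos by simp
  \<comment> \<open>Sizes are at most \<open>3 + 60 * (2 * v) \<le> 128 * v\<close>, and 128 amounts
    to seven doublings: the origin of \<open>C ^ 7\<close>.\<close>
  have mulC: "mul a \<le> C ^ 7 * mul (v + e)" if "a \<le> 128 * v" for a v
  proof -
    have "mul a \<le> mul (2 ^ 7 * (v + e))" using that by (intro monoD[OF mul(1)]) simp
    also have "\<dots> \<le> C ^ 7 * mul (v + e)" by (rule mult_cost_power[where mul = mul and C = C, OF mul(3,4)])
    finally show ?thesis .
  qed
  have size_bound: "isize (M ^ k) \<le> 128 * v"
    if "1 \<le> M" "log 2 (real_of_int M) \<le> 2 * real v" "1 \<le> v" "k = 60" for M k v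
  proof -
    have "real (isize (M ^ k)) \<le> 3 + real k * log 2 (real_of_int M)" by (rule isize_power[OF that(1)])
    also have "\<dots> \<le> 3 + 60 * (2 * real v)" using that(2,4) by simp
    also have "\<dots> \<le> real (128 * v)" using that(3) by simp
    finally show ?thesis by (simp only: of_nat_le_iff)
  qed
  have B0: "isize (N ^ 60) \<le> 128 * vsize c"
    by (rule size_bound) (use logN vc N in auto)
  have B1: "isize (NR ^ 60) \<le> 128 * (vsize c + vsize b)"
    by (rule size_bound) (use logNR vc N NR in auto)
  \<comment> \<open>180000 is 60000 for the step count times the factor 3 in the price of a
    step.\<close>
  have time: "real t * (3 * mul B) \<le> 180000 * C ^ 7 * (real n ^ 4 * real_of_int (Delta H) ^ 4 * mul (v + e))"
    if "B \<le> 128 * v" for B v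
  proof -
    have mB: "mul B \<le> C ^ 7 * mul (v + e)" "0 \<le> mul B" using mulC[OF that] mul(2)[of B] by auto
    have "real t \<le> real (60000 * (n ^ 4 * nat D ^ 4))" using t by (rule of_nat_mono)
    also have "\<dots> = 60000 * (real n ^ 4 * real_of_int D ^ 4)" using D1 by simp
    finally have "real t * (3 * mul B) \<le> (60000 * (real n ^ 4 * real_of_int D ^ 4)) * (3 * (C ^ 7 * mul (v + e)))"
      using mB D1 by (intro mult_mono) auto
    then show ?thesis by (simp add: D_def mult_ac)
  qed
  obtain t1 where t1: "exec mul (\<lambda>_. 0) ilp_program s0 s' t1" "t1 \<le> real t * (3 * mul (isize (N ^ 60)))"
    using st(1) charges_0 unfolding runs_def by blast
  have "charges isize (isize (NR ^ 60))"
    unfolding charges_def using N NR by (auto intro!: isize_mono power_mono)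
  then obtain t2 where t2: "exec mul isize ilp_program s0 s' t2" "t2 \<le> real t * (3 * mul (isize (NR ^ 60)))"
    using st(1) unfolding runs_def by blast
  have points: "x \<in> integer_points (polyhedron H b) \<longleftrightarrow> x \<in> carrier_vec n \<and> (\<lambda>j. x $ j) \<in> feasible bf" for x
  proof -
    have e: "(map_mat real_of_int H *\<^sub>v map_vec real_of_int x) $ i = real_of_int (row i (\<lambda>j. x $ j))"
      if "x \<in> carrier_vec n" "i < d" for i
      using that H by (simp add: scalar_prod_def row_def coeff_def lessThan_atLeast0)
    show ?thesis
      using H b e by (auto simp: integer_points_def polyhedron_def less_eq_vec_def feasible_def bf_def)
  qed
  have obj: "c \<bullet> x = dot n cf (\<lambda>j. x $ j)" if "x \<in> carrier_vec n" for x
    using that by (simp add: scalar_prod_def dot_def cf_def lessThan_atLeast0)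
  have lift: "vec n x \<in> integer_points (polyhedron H b)" "c \<bullet> vec n x = dot n cf x" if "x \<in> feasible bf" for x
    using that points[of "vec n x"] obj[of "vec n x"] feasible_cong[of x "\<lambda>j. vec n x $ j"] by simp_all
  have "ilp_correct c (integer_points (polyhedron H b)) (ilp_output n s')"
  proof -
    consider "fst s' 0 0 = 0" | "fst s' 0 0 = 1" | "fst s' 0 0 \<noteq> 0" "fst s' 0 0 \<noteq> 1" by blast
    then show ?thesis
    proof cases
      case 1
      then have "feasible bf = {}" using st(2) by (simp add: correct_answer_def)
      then show ?thesis using 1 points by (auto simp: ilp_output_def)
    next
      case 2
      then have "\<forall>K. \<exists>x\<in>feasible bf. K < dot n cf x" using st(2) by (simp add: correct_answer_def)
      then show ?thesis using 2 lift by (simp add: ilp_output_def) metis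
    next
      case 3
      let ?x = "\<lambda>j. snd s' 1 (int j)"
      have x: "?x \<in> feasible bf" "\<And>y. y \<in> feasible bf \<Longrightarrow> dot n cf y \<le> dot n cf ?x"
        using st(2) 3 by (auto simp: correct_answer_def)
      have "ilp_output n s' = Optimal (vec n ?x)" using 3 by (simp add: ilp_output_def)
      then show ?thesis using lift[OF x(1)] x(2) points obj by simp
    qed
  qed
  then show ?thesis
    using t1 t2 time[OF B0] time[OF B1] unfolding s0_def by (meson order_trans)
qed

theorem corollary3:
  fixes mul :: "nat \<Rightarrow> real"
  assumes "mult_cost mul"
  shows "\<exists>(p :: com) (K :: real). \<forall>(n :: nat) (m :: nat) (d :: nat) (H :: int mat) (c :: int vec) (b :: int vec).
    n \<ge> 1 \<and> d = n + m \<and>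
    H \<in> carrier_mat d n \<and> c \<in> carrier_vec n \<and> b \<in> carrier_vec d \<and>
    rank_int H = n \<and> reduced_hnf H \<and>
    (\<forall>S \<in> square_submatrices n H. det S \<noteq> 0) \<and>
    real n > real_of_int (Delta H * (2 * Delta H + 1)^2) + log 2 (real_of_int (Delta H))
    \<longrightarrow>
    (\<exists>s t t'.
      exec mul (\<lambda>_. 0) p (ilp_input H c b) s t \<and>
      exec mul isize p (ilp_input H c b) s t' \<and>
      ilp_correct c (integer_points (polyhedron H b)) (ilp_output n s) \<and>
      t \<le> K * (max 1 (log 2 (real_of_int (Delta H))) * real n ^ 4 * real_of_int (Delta H) ^ 4
               * mul (vsize c + nat \<lceil>log 2 (real_of_int (Delta H))\<rceil>)) \<and>
      t' \<le> K * (max 1 (log 2 (real_of_int (Delta H))) * real n ^ 4 * real_of_int (Delta H) ^ 4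
               * mul (vsize c + vsize b + nat \<lceil>log 2 (real_of_int (Delta H))\<rceil>)))"
proof -
  have mul: "mono mul" "\<And>k. real k \<le> mul k" using assms by (auto simp: mult_cost_def)
  obtain C where C: "\<And>k. mul (2 * k) \<le> C * mul k" using assms by (auto simp: mult_cost_def)
  \<comment> \<open>The doubling constant is positive because \<open>mul 2\<close> is at least 2;
    its powers may then serve as factors of upper bounds.\<close>
  have "0 < C * mul 1" using mul(2)[of 2] C[of 1] by simp
  moreover have "0 < mul 1" using mul(2)[of 1] by simp
  ultimately have C0: "0 \<le> C" by (simp add: zero_less_mult_iff)
  show ?thesis
  proof (intro exI[of _ ilp_program] exI[of _ "180000 * C ^ 7"] allI impI)
    fix n m d :: nat and H :: "int mat" and c b :: "int vec"
    assume a: "n \<ge> 1 \<and> d = n + m \<and>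
      H \<in> carrier_mat d n \<and> c \<in> carrier_vec n \<and> b \<in> carrier_vec d \<and>
      rank_int H = n \<and> reduced_hnf H \<and> (\<forall>S \<in> square_submatrices n H. det S \<noteq> 0) \<and>
      real n > real_of_int (Delta H * (2 * Delta H + 1)^2) + log 2 (real_of_int (Delta H))"
    interpret nonsingular_hnf H n d using a by unfold_locales auto
    let ?e = "nat \<lceil>log 2 (real_of_int (Delta H))\<rceil>" and ?l = "max 1 (log 2 (real_of_int (Delta H)))"
    have "0 \<le> log 2 (real_of_int (Delta H))" using Delta_pos by simp
    then have "real_of_int (Delta H * (2 * Delta H + 1)^2) < real_of_int (int n)" using a by simp
    then have large: "Delta H * (2 * Delta H + 1)^2 < int n" by (simp only: of_int_less_iff)
    have le: "180000 * C ^ 7 * (real n ^ 4 * real_of_int (Delta H) ^ 4 * mul v) \<le>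
        180000 * C ^ 7 * (?l * real n ^ 4 * real_of_int (Delta H) ^ 4 * mul v)" for v
    proof -
      have "0 \<le> mul v" using mul(2)[of v] by linarith
      then have "1 * (real n ^ 4 * real_of_int (Delta H) ^ 4 * mul v) \<le>
          ?l * (real n ^ 4 * real_of_int (Delta H) ^ 4 * mul v)"
        using Delta_pos by (intro mult_right_mono) auto
      then show ?thesis using C0 by (intro mult_left_mono) (auto simp: mult.assoc)
    qed
    show "\<exists>s t t'. exec mul (\<lambda>_. 0) ilp_program (ilp_input H c b) s t \<and>
      exec mul isize ilp_program (ilp_input H c b) s t' \<and>
      ilp_correct c (integer_points (polyhedron H b)) (ilp_output n s) \<and>
      t \<le> 180000 * C ^ 7 * (?l * real n ^ 4 * real_of_int (Delta H) ^ 4 * mul (vsize c + ?e)) \<and>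
      t' \<le> 180000 * C ^ 7 * (?l * real n ^ 4 * real_of_int (Delta H) ^ 4 * mul (vsize c + vsize b + ?e))"
      using solves[OF mul C C0 _ _ large, of c b ?e] a le by (meson order_trans)
  qed
qed

end
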